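(* Let $0\to E_1\xrightarrow{\alpha}E_2\xrightarrow{\beta}E_3\to0$ be an admissible triple of complete $C_2$-spaces over a finite field $\mathbb F_q$, $E_m=(I_m,F_m,V_m)$. Let $E_1$ be a $cfC_2$-space and $E_3$ a $dfC_2$-space. Let $o\in I_2$. Then, in $\mathcal D_{F_2^0(o)}(\check E_2)$, $$\mathbf F(\delta_{E_1})=\delta_{\check E_3},$$ where $\delta_{E_1}=\alpha_*(\mathbf 1)\in\mathcal D_{F_2(o)}(E_2)$ and $\delta_{\check E_3}=\check\beta_*(\mathbf 1)\in\mathcal D_{F_2^0(o)}(\check E_2)$.
   Context: Fix a finite field $\mathbb F_q$ and a nontrivial character $\psi:\mathbb F_q\to\mathbb C^*$. Vector spaces on which filtrations are considered are over $\mathbb F_q$. **$C_1$-spaces.** A filtered vector space $(I,F,V)$: a vector space $V$, a partially ordered set $I$ such that for all $i,j\in I$ there are $k,l\in I$ with $k\le i\le l$, $k\le j\le l$, and a map $F$ from $I$ to subspaces of $V$ with $F(i)\subset F(j)$ for $i\le j$, $\bigcap F(i)=0$, $\bigcup F(i)=V$. It is a $C_1$-space if all $F(j)/F(i)$, $i\le j$, are finite-dimensional; complete if $V\to\varinjlim_i\varprojlim_{j\le i}F(i)/F(j)$ is an isomorphism; compact if $F(i)=V$ for some $i$; discrete if $F(j)=0$ for some $j$. $(I_1,F_1,V)$ dominates $(I_2,F_2,V)$ if there is an order-preserving $\phi:I_2\to I_1$ with $F_1(\phi(i))=F_2(i)$ and for each $j\in I_1$ there are $i_1,i_2\in I_2$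 with $\phi(i_1)\le j\le\phi(i_2)$. An admissible triple $0\to E_1\xrightarrow{\alpha}E_2\xrightarrow{\beta}E_3\to0$ of $C_1$-spaces is an exact sequence of the underlying vector spaces such that $(I_1,F_1,V_1)$ dominates $(I_2,F_1',V_1)$ with $F_1'(i)=F_2(i)\cap V_1$, $(I_3,F_3,V_3)$ dominates $(I_2,F_3',V_3)$ with $F_3'(i)=\beta(F_2(i))$, and the induced sequences of quotients $F_1'(j)/F_1'(i)$, $F_2(j)/F_2(i)$, $F_3'(j)/F_3'(i)$ are exact. Dual: $\check E=(I^0,F^0,\check V)$, $\check V=\bigcup F(i)^\perp\subset V^*$, $F^0(i)=F(i)^\perp$, $I^0$ = $I$ with reversed order. For a $C_1$-space $E=(I,F,V)$: $\mathcal D(E)$ = functions $V\to\mathbb C$ supported in some $F(j)$ and invariant under translations by some $F(i)$; $\mu(E)\subset\mathcal D(E)^*$ = one-dimensional space of translation-invariant functionals; $\mu(F(i)):=\mu(\mathbf 1_{F(i)})$. Canonically $\mu(E)\otimes\mu(\check E)=\mathbb C$ for $E$ complete, where $\mu^{-1}(F(i)^\perp)=\mu(F(i))^{-1}$. For an admissible triple, $\mu(E_1)\otimes\mu(E_3)=\mu(E_2)$ via $(\mu_1\otimes\mu_3)(F_2(j))=\mu_1(F_2(j)\cap V_1)\mu_3(\beta(F_2(j)))$; $\alpha^*:\mathcal D(E_2)\to\mathcal D(E_1)$ is restriction $f\mapsto f\circ\alpha$; $\beta_*:\mathcal D(E_2)\otimes\mu(E_1)\to\mathcal D(E_3)$ is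 $\beta_*(f\otimes\mu_1)(w)=\mu_1(v_1\mapsto f(w'+\alpha(v_1)))$, $w'\in\beta^{-1}(w)$; if $E_3$ is discrete, $\alpha_*:\mathcal D(E_1)\to\mathcal D(E_2)$ is extension by zero. For complete $E$: $\mathbf F_\mu:\mathcal D(E)\to\mathcal D(\check E)$, $\mathbf F_\mu(f)(w)=\mu(v\mapsto f(v)\overline{\psi(w(v))})$. **$C_2$-spaces.** A $C_2$-space is a filtered vector space $E=(I,F,V)$ together with, for all $i\le j$, a $C_1$-space structure $E_{i,j}$ on $F(j)/F(i)$ such that $0\to E_{i,j}\to E_{i,k}\to E_{j,k}\to0$ is an admissible triple of $C_1$-spaces for all $i\le j\le k$. It is complete if all $E_{i,j}$ are complete and $V=\varinjlim_i\varprojlim_{j\le i}F(i)/F(j)$; a $cfC_2$-space if all $E_{i,j}$ are compact; a $dfC_2$-space if all $E_{i,j}$ are discrete. An admissible triple of $C_2$-spaces $0\to E_1\xrightarrow{\alpha}E_2\xrightarrow{\beta}E_3\to 0$ is an exact sequence of vector spaces such that $(I_1,F_1,V_1)$ dominates $(I_2,F_2(i)\cap V_1,V_1)$, $(I_3,F_3,V_3)$ dominates $(I_2,\beta(F_2(i)),V_3)$ (as filtered spaces), giving order-preserving $\varepsilon:I_2\to I_1$ with $F_2(i)\cap V_1=F_1(\varepsilon(i))$ and $\gamma:I_2\to I_3$ with $\beta(F_2(i))=F_3(\gamma(i))$, and such that $0\to F_1(\varepsilon(j))/F_1(\varepsilon(i))\to F_2(j)/F_2(i)\to F_3(\gamma(j))/F_3(\gamma(i))\to0$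 is an admissible triple of $C_1$-spaces for $i\le j\in I_2$. Dual: $\check E=(I^0,F^0,\check V)$ with $\check V=\varinjlim_{j\in I}\varprojlim_{i\ge j}\check E_{j,i}\subset V^*$, $F^0(j)=\varprojlim_{i\ge j}\check E_{j,i}$ (the elements of $\check V$ vanishing on $F(j)$), and for $j\le i$ in $I$ the $C_1$-space $F^0(j)/F^0(i)$ is $\check E_{j,i}$. An admissible triple induces an admissible triple $0\to\check E_3\xrightarrow{\check\beta}\check E_2\xrightarrow{\check\alpha}\check E_1\to 0$ with $\check\alpha(F_2^0(i))=F_1^0(\varepsilon(i))$, $F_2^0(i)\cap\check V_3=F_3^0(\gamma(i))$. The dual of a $cfC_2$-space is a $dfC_2$-space and conversely. **Virtual measures.** $\mu(F(i)\mid F(j))=\varinjlim_{l\le i,\,l\le j}\mathrm{Hom}_{\mathbb C}(\mu(F(i)/F(l)),\mu(F(j)/F(l)))$, a one-dimensional $\mathbb C$-space; for $l'\le l$ the (iso) transition map sends $f$ to $f'(a\otimes c)=f(a)\otimes c$ using $\mu(F(i)/F(l'))=\mu(F(i)/F(l))\otimes\mu(F(l)/F(l'))$ and likewise for $j$. Composition gives canonical isomorphisms $\mu(F(i)\mid F(j))\otimes\mu(F(j)\mid F(l))=\mu(F(i)\mid F(l))$; also $\mu(F(j)\mid F(i))=\mu(F(i)\mid F(j))^*$ and $\mu(F(i)\mid F(j))=\mu(F(j)/F(i))$ for $i\le j$. Canonically $\mu(F(i)\mid F(j))=\mu(F^0(i)\mid F^0(j))$ (from $\mu(E_{i,j})^*=\mu(\check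 E_{i,j})$). For an admissible triple, $\mu(F_2(i)\mid F_2(j))=\mu(F_1(\varepsilon(i))\mid F_1(\varepsilon(j)))\otimes\mu(F_3(\gamma(i))\mid F_3(\gamma(j)))$. For a $cfC_2$-space, each $\mu(F(i)\mid F(j))$ is identified with $\mathbb C$ by the multiplicative system of elements $1_{ij}$ which for $i\le j$ is the invariant measure on $F(j)/F(i)$ of total mass 1. For a $dfC_2$-space, each $\mu(F(i)\mid F(j))$ is identified with $\mathbb C$ by the multiplicative system $\delta_{ij}$ which for $i\le j$ is the invariant measure on $F(j)/F(i)$ giving mass 1 to $\{0\}$. **Spaces.** For $o\in I$: $\mathcal D_{F(o)}(E)=\varprojlim_i\varprojlim_l\mathcal D(F(i)/F(l))\otimes\mu(F(l)\mid F(o))$ over $i\ge l$, with transition maps, for $i\ge j\ge l$, the restriction $\mathcal D(F(i)/F(l))\otimes\mu(F(l)\mid F(o))\to\mathcal D(F(j)/F(l))\otimes\mu(F(l)\mid F(o))$ and the pushforward to $\mathcal D(F(i)/F(j))\otimes\mu(F(j)\mid F(o))$ (using $\mu(F(l)\mid F(o))=\mu(F(j)/F(l))\otimes\mu(F(j)\mid F(o))$). For $cfC_2$- and $dfC_2$-spaces, using the identifications $\mu(F(i)\mid F(j))=\mathbb C$ given by the elements $1_{ij}$ (for a $cfC_2$-space) or $\delta_{ij}$ (for a $dfC_2$-space), this space is independent of $o$ and is written $\mathcal D(E)=\varprojlim_{i\ge l}\mathcal D(F(i)/F(l))$. **Fourier transform** ($E$ complete). $\mathbf F:\mathcal D_{F(o)}(E)\to\mathcal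 D_{F^0(o)}(\check E)$ is the projective limit of the maps $\mathcal D(F(i)/F(j))\otimes\mu(F(j)\mid F(o))\to\mathcal D(F^0(j)/F^0(i))\otimes\mu(F^0(i)\mid F^0(o))$, $f\otimes(\rho\otimes\lambda)\mapsto\mathbf F_\rho(f)\otimes\lambda$, where $\rho\in\mu(F(i)/F(j))=\mu(F(j)\mid F(i))$, $\lambda\in\mu(F(i)\mid F(o))=\mu(F^0(i)\mid F^0(o))$. **Image map and characteristic function.** If $E_3$ is a $dfC_2$-space, then using $\mu(F_3(\gamma(i))\mid F_3(\gamma(j)))=\mathbb C$ one has $\mu(F_2(i)\mid F_2(j))=\mu(F_1(\varepsilon(i))\mid F_1(\varepsilon(j)))$, and $\alpha_*:\mathcal D_{F_1(\varepsilon(o))}(E_1)\to\mathcal D_{F_2(o)}(E_2)$ is the projective limit over $i\ge j\in I_2$ of the extension-by-zero maps $\mathcal D(F_1(\varepsilon(i))/F_1(\varepsilon(j)))\to\mathcal D(F_2(i)/F_2(j))$ tensored with $\mu(F_2(j)\mid F_2(o))$. If $E_1$ is a $cfC_2$-space, $\mathbf 1\in\mathcal D(E_1)=\mathcal D_{F_1(\varepsilon(o))}(E_1)$ is the element given by the compatible system of constant functions $1\in\mathcal D(F_1(i)/F_1(j))$. If $E_1$ is $cfC_2$ and $E_3$ is $dfC_2$, put $\delta_{E_1}=\alpha_*(\mathbf 1)$; $\delta_{\check E_3}$ is the same construction for the dual triple, with $\check E_3$ ($cfC_2$) as subobject and $\check E_1$ ($dfC_2$) as quotient. *)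

theory Defs
  imports Complex_Main "HOL-Library.Function_Algebras" "HOL-Library.Indicator_Function"
begin

text \<open>
  Vector spaces over the finite field \<open>'f\<close> are subspaces (carriers) of an ambient vector space
  given by an abelian group type and a scalar multiplication.  A function defined on a carrier is
  represented by a total function that is \<open>0\<close> off the carrier wherever equality of such functions
  matters (functionals, locally constant functions, measures, virtual measures).
\<close>

section \<open>Filtered spaces and \<open>C\<^sub>1\<close>-spaces\<close>

record ('f, 'v, 'i) filtered =
  scl :: "'f \<Rightarrow> 'v \<Rightarrow> 'v"
  carr :: "'v set"
  idx :: "'i set"
  leq :: "'i \<Rightarrow> 'i \<Rightarrow> bool"
  fil :: "'i \<Rightarrow> 'v set"

definition ile :: "('f, 'v, 'i, 'm) filtered_scheme \<Rightarrow> 'i \<Rightarrow> 'i \<Rightarrow> bool" where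
  "ile X i j \<longleftrightarrow> i \<in> idx X \<and> j \<in> idx X \<and> leq X i j"

definition filtered_space ::
  "('f :: {field, finite}, 'v :: ab_group_add, 'i, 'm) filtered_scheme \<Rightarrow> bool" where
  "filtered_space X \<longleftrightarrow>
     vector_space (scl X) \<and> module.subspace (scl X) (carr X) \<and>
     partial_order_on (idx X) {(i, j). ile X i j} \<and>
     (\<forall>i\<in>idx X. \<forall>j\<in>idx X. \<exists>k l. ile X k i \<and> ile X i l \<and> ile X k j \<and> ile X j l) \<and>
     (\<forall>i\<in>idx X. module.subspace (scl X) (fil X i) \<and> fil X i \<subseteq> carr X) \<and>
     (\<forall>i j. ile X i j \<longrightarrow> fil X i \<subseteq> fil X j) \<and>
     (\<Inter>i\<in>idx X. fil X i) = {0} \<and> (\<Union>i\<in>idx X. fil X i) = carr X"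

definition c1_space ::
  "('f :: {field, finite}, 'v :: ab_group_add, 'i, 'm) filtered_scheme \<Rightarrow> bool" where
  "c1_space X \<longleftrightarrow> filtered_space X \<and>
     (\<forall>i j. ile X i j \<longrightarrow>
        (\<exists>B. finite B \<and> B \<subseteq> fil X j \<and> fil X j \<subseteq> module.span (scl X) (B \<union> fil X i)))"

text \<open>
  An element of the direct limit over \<open>i\<close> of the projective limits over \<open>j \<le> i\<close> of \<open>F(i)/F(j)\<close>
  is represented, for some \<open>i\<close>, by a family of vectors \<open>x\<^sub>j \<in> F(i)\<close> (\<open>j \<le> i\<close>) with
  \<open>x\<^sub>k \<equiv> x\<^sub>j mod F(j)\<close> for \<open>k \<le> j\<close>; a vector \<open>v\<close> of the space maps to it iff \<open>v \<equiv> x\<^sub>j mod F(j)\<close>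
  for all \<open>j \<le> i\<close>.  Bijectivity of the map into the limit is then the following condition.
\<close>

definition complete_filtered ::
  "('f, 'v :: ab_group_add, 'i, 'm) filtered_scheme \<Rightarrow> bool" where
  "complete_filtered X \<longleftrightarrow>
     (\<forall>i\<in>idx X. \<forall>x.
        (\<forall>j. ile X j i \<longrightarrow> x j \<in> fil X i) \<and>
        (\<forall>j k. ile X k j \<and> ile X j i \<longrightarrow> x k - x j \<in> fil X j) \<longrightarrow>
        (\<exists>!v. v \<in> carr X \<and> (\<forall>j. ile X j i \<longrightarrow> v - x j \<in> fil X j)))"

definition compact_filtered :: "('f, 'v, 'i, 'm) filtered_scheme \<Rightarrow> bool" where
  "compact_filtered X \<longleftrightarrow> (\<exists>i\<in>idx X. fil X i = carr X)"

definition discrete_filtered :: "('f, 'v :: ab_group_add, 'i, 'm) filtered_scheme \<Rightarrow> bool" where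
  "discrete_filtered X \<longleftrightarrow> (\<exists>j\<in>idx X. fil X j = {0})"

definition dominates_via ::
  "('j \<Rightarrow> 'i) \<Rightarrow> ('f, 'v, 'i, 'm) filtered_scheme \<Rightarrow> ('f, 'v, 'j, 'n) filtered_scheme \<Rightarrow> bool" where
  "dominates_via \<phi> X Y \<longleftrightarrow>
     carr X = carr Y \<and>
     (\<forall>i\<in>idx Y. \<phi> i \<in> idx X \<and> fil X (\<phi> i) = fil Y i) \<and>
     (\<forall>i j. ile Y i j \<longrightarrow> ile X (\<phi> i) (\<phi> j)) \<and>
     (\<forall>j\<in>idx X. \<exists>i1\<in>idx Y. \<exists>i2\<in>idx Y. ile X (\<phi> i1) j \<and> ile X j (\<phi> i2))"

definition dominates ::
  "('f, 'v, 'i, 'm) filtered_scheme \<Rightarrow> ('f, 'v, 'j, 'n) filtered_scheme \<Rightarrow> bool" where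
  "dominates X Y \<longleftrightarrow> (\<exists>\<phi>. dominates_via \<phi> X Y)"

definition sub_fil ::
  "('v \<Rightarrow> 'w) \<Rightarrow> ('f, 'v, 'i, 'm) filtered_scheme \<Rightarrow> ('f, 'w, 'j, 'n) filtered_scheme
   \<Rightarrow> ('f, 'v, 'j) filtered" where
  "sub_fil \<alpha> X Y = \<lparr>scl = scl X, carr = carr X, idx = idx Y, leq = leq Y,
     fil = (\<lambda>i. {v \<in> carr X. \<alpha> v \<in> fil Y i})\<rparr>"

definition img_fil ::
  "('w \<Rightarrow> 'v) \<Rightarrow> ('f, 'v, 'i, 'm) filtered_scheme \<Rightarrow> ('f, 'w, 'j, 'n) filtered_scheme
   \<Rightarrow> ('f, 'v, 'j) filtered" where
  "img_fil \<beta> X Y = \<lparr>scl = scl X, carr = carr X, idx = idx Y, leq = leq Y,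
     fil = (\<lambda>i. \<beta> ` fil Y i)\<rparr>"

definition lin_map ::
  "('f \<Rightarrow> 'v \<Rightarrow> 'v) \<Rightarrow> 'v set \<Rightarrow> ('f \<Rightarrow> 'w \<Rightarrow> 'w) \<Rightarrow> 'w set
   \<Rightarrow> ('v :: ab_group_add \<Rightarrow> 'w :: ab_group_add) \<Rightarrow> bool" where
  "lin_map s V s' W h \<longleftrightarrow>
     (\<forall>x\<in>V. h x \<in> W) \<and> (\<forall>x\<in>V. \<forall>y\<in>V. h (x + y) = h x + h y) \<and>
     (\<forall>c. \<forall>x\<in>V. h (s c x) = s' c (h x))"

definition short_exact ::
  "('f, 'v1 :: ab_group_add, 'i1, 'm1) filtered_scheme
   \<Rightarrow> ('f, 'v2 :: ab_group_add, 'i2, 'm2) filtered_scheme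
   \<Rightarrow> ('f, 'v3 :: ab_group_add, 'i3, 'm3) filtered_scheme
   \<Rightarrow> ('v1 \<Rightarrow> 'v2) \<Rightarrow> ('v2 \<Rightarrow> 'v3) \<Rightarrow> bool" where
  "short_exact X1 X2 X3 \<alpha> \<beta> \<longleftrightarrow>
     lin_map (scl X1) (carr X1) (scl X2) (carr X2) \<alpha> \<and>
     lin_map (scl X2) (carr X2) (scl X3) (carr X3) \<beta> \<and>
     inj_on \<alpha> (carr X1) \<and> \<beta> ` carr X2 = carr X3 \<and>
     {v \<in> carr X2. \<beta> v = 0} = \<alpha> ` carr X1"

text \<open>
  The last conjunct of the next definition is exactness of
  \<open>0 \<rightarrow> F\<^sub>1'(j)/F\<^sub>1'(i) \<rightarrow> F\<^sub>2(j)/F\<^sub>2(i) \<rightarrow> F\<^sub>3'(j)/F\<^sub>3'(i) \<rightarrow> 0\<close>, written with representatives.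
\<close>

definition admissible1 ::
  "('f :: {field, finite}, 'v1 :: ab_group_add, 'i1, 'm1) filtered_scheme
   \<Rightarrow> ('f, 'v2 :: ab_group_add, 'i2, 'm2) filtered_scheme
   \<Rightarrow> ('f, 'v3 :: ab_group_add, 'i3, 'm3) filtered_scheme
   \<Rightarrow> ('v1 \<Rightarrow> 'v2) \<Rightarrow> ('v2 \<Rightarrow> 'v3) \<Rightarrow> bool" where
  "admissible1 X1 X2 X3 \<alpha> \<beta> \<longleftrightarrow>
     c1_space X1 \<and> c1_space X2 \<and> c1_space X3 \<and> short_exact X1 X2 X3 \<alpha> \<beta> \<and>
     dominates X1 (sub_fil \<alpha> X1 X2) \<and> dominates X3 (img_fil \<beta> X3 X2) \<and>
     (let F1 = fil (sub_fil \<alpha> X1 X2); F2 = fil X2; F3 = fil (img_fil \<beta> X3 X2) in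
      \<forall>i j. ile X2 i j \<longrightarrow>
        (\<forall>u\<in>F1 j. \<alpha> u \<in> F2 i \<longrightarrow> u \<in> F1 i) \<and>
        (\<forall>v\<in>F2 j. \<beta> v \<in> F3 i \<longleftrightarrow> (\<exists>u\<in>F1 j. v - \<alpha> u \<in> F2 i)) \<and>
        (\<forall>w\<in>F3 j. \<exists>v\<in>F2 j. w - \<beta> v \<in> F3 i))"

definition lin_forms ::
  "('f :: {field, finite}, 'v :: ab_group_add, 'i, 'm) filtered_scheme \<Rightarrow> ('v \<Rightarrow> 'f) set" where
  "lin_forms X = {w. lin_map (scl X) (carr X) (*) UNIV w \<and> (\<forall>v. v \<notin> carr X \<longrightarrow> w v = 0)}"

definition annih ::
  "('f :: {field, finite}, 'v :: ab_group_add, 'i, 'm) filtered_scheme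
   \<Rightarrow> 'v set \<Rightarrow> ('v \<Rightarrow> 'f) set" where
  "annih X A = {w \<in> lin_forms X. \<forall>v\<in>A. w v = 0}"

definition dual1 ::
  "('f :: {field, finite}, 'v :: ab_group_add, 'i, 'm) filtered_scheme
   \<Rightarrow> ('f, 'v \<Rightarrow> 'f, 'i) filtered" where
  "dual1 X = \<lparr>scl = (\<lambda>c w v. c * w v), carr = (\<Union>i\<in>idx X. annih X (fil X i)),
     idx = idx X, leq = (\<lambda>i j. leq X j i), fil = (\<lambda>i. annih X (fil X i))\<rparr>"

text \<open>The transpose of a map with domain the carrier of \<open>X\<close>; also restriction along that map.\<close>

definition pullback ::
  "('f, 'v, 'i, 'm) filtered_scheme \<Rightarrow> ('v \<Rightarrow> 'w) \<Rightarrow> ('w \<Rightarrow> 'b :: zero) \<Rightarrow> 'v \<Rightarrow> 'b" where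
  "pullback X \<alpha> f = (\<lambda>v. if v \<in> carr X then f (\<alpha> v) else 0)"

section \<open>Functions and measures on \<open>C\<^sub>1\<close>-spaces\<close>

definition sch :: "('f, 'v :: ab_group_add, 'i, 'm) filtered_scheme \<Rightarrow> ('v \<Rightarrow> complex) set" where
  "sch X = {f. (\<exists>j\<in>idx X. \<forall>v. v \<notin> fil X j \<longrightarrow> f v = 0) \<and>
               (\<exists>i\<in>idx X. \<forall>v\<in>carr X. \<forall>u\<in>fil X i. f (v + u) = f v)}"

type_synonym 'v fnl = "('v \<Rightarrow> complex) \<Rightarrow> complex"

definition meas :: "('f, 'v :: ab_group_add, 'i, 'm) filtered_scheme \<Rightarrow> 'v fnl set" where
  "meas X = {m.
     (\<forall>f\<in>sch X. \<forall>g\<in>sch X. m (f + g) = m f + m g) \<and>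
     (\<forall>c. \<forall>f\<in>sch X. m (\<lambda>v. c * f v) = c * m f) \<and>
     (\<forall>f\<in>sch X. \<forall>a\<in>carr X. m (\<lambda>v. f (v + a)) = m f) \<and>
     (\<forall>f. f \<notin> sch X \<longrightarrow> m f = 0)}"

definition mass :: "'v fnl \<Rightarrow> 'v set \<Rightarrow> complex" where
  "mass m A = m (indicator A)"

text \<open>The identification of \<open>\<mu>(X) \<otimes> \<mu>(X dual)\<close> with the complex numbers.\<close>

definition meas_pair ::
  "('f :: {field, finite}, 'v :: ab_group_add, 'i, 'm) filtered_scheme
   \<Rightarrow> 'v fnl \<Rightarrow> ('v \<Rightarrow> 'f) fnl \<Rightarrow> complex" where
  "meas_pair X m n = (THE z. \<forall>i\<in>idx X. mass m (fil X i) * mass n (fil (dual1 X) i) = z)"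

text \<open>The identification of \<open>\<mu>(X\<^sub>1) \<otimes> \<mu>(X\<^sub>3)\<close> with \<open>\<mu>(X\<^sub>2)\<close> for an admissible triple.\<close>

definition meas_tensor ::
  "('f, 'v1 :: ab_group_add, 'i1, 'm1) filtered_scheme
   \<Rightarrow> ('f, 'v2 :: ab_group_add, 'i2, 'm2) filtered_scheme
   \<Rightarrow> ('f, 'v3 :: ab_group_add, 'i3, 'm3) filtered_scheme
   \<Rightarrow> ('v1 \<Rightarrow> 'v2) \<Rightarrow> ('v2 \<Rightarrow> 'v3) \<Rightarrow> 'v1 fnl \<Rightarrow> 'v3 fnl \<Rightarrow> 'v2 fnl" where
  "meas_tensor X1 X2 X3 \<alpha> \<beta> m1 m3 =
     (THE m. m \<in> meas X2 \<and>
        (\<forall>j\<in>idx X2. mass m (fil X2 j) =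
           mass m1 (fil (sub_fil \<alpha> X1 X2) j) * mass m3 (fil (img_fil \<beta> X3 X2) j)))"

definition push1 ::
  "('f, 'v1 :: ab_group_add, 'i1, 'm1) filtered_scheme
   \<Rightarrow> ('f, 'v2 :: ab_group_add, 'i2, 'm2) filtered_scheme
   \<Rightarrow> ('f, 'v3 :: ab_group_add, 'i3, 'm3) filtered_scheme
   \<Rightarrow> ('v1 \<Rightarrow> 'v2) \<Rightarrow> ('v2 \<Rightarrow> 'v3) \<Rightarrow> ('v2 \<Rightarrow> complex) \<Rightarrow> 'v1 fnl \<Rightarrow> 'v3 \<Rightarrow> complex" where
  "push1 X1 X2 X3 \<alpha> \<beta> f m1 =
     (\<lambda>w. if w \<in> carr X3
          then m1 (pullback X1 \<alpha> (\<lambda>v. f ((SOME w'. w' \<in> carr X2 \<and> \<beta> w' = w) + v)))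
          else 0)"

definition ext0 ::
  "('f, 'v, 'i, 'm) filtered_scheme \<Rightarrow> ('v \<Rightarrow> 'w) \<Rightarrow> ('v \<Rightarrow> complex) \<Rightarrow> 'w \<Rightarrow> complex" where
  "ext0 X \<alpha> f = (\<lambda>w. if w \<in> \<alpha> ` carr X then f (inv_into (carr X) \<alpha> w) else 0)"

definition nontrivial_character :: "('f :: {field, finite} \<Rightarrow> complex) \<Rightarrow> bool" where
  "nontrivial_character \<psi> \<longleftrightarrow>
     (\<forall>x. \<psi> x \<noteq> 0) \<and> (\<forall>x y. \<psi> (x + y) = \<psi> x * \<psi> y) \<and> (\<exists>x. \<psi> x \<noteq> 1)"

definition fourier1 ::
  "('f :: {field, finite} \<Rightarrow> complex) \<Rightarrow> ('f, 'v :: ab_group_add, 'i, 'm) filtered_scheme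
   \<Rightarrow> 'v fnl \<Rightarrow> ('v \<Rightarrow> complex) \<Rightarrow> ('v \<Rightarrow> 'f) \<Rightarrow> complex" where
  "fourier1 \<psi> X m f =
     (\<lambda>w. if w \<in> carr (dual1 X) then m (\<lambda>v. f v * cnj (\<psi> (w v))) else 0)"

section \<open>\<open>C\<^sub>2\<close>-spaces\<close>

text \<open>
  The quotient \<open>F(j)/F(i)\<close>, for \<open>i \<le> j\<close>, is given up to canonical isomorphism: as a \<open>C\<^sub>1\<close>-space
  \<open>lev i j\<close> with a linear surjection \<open>quo i j\<close> from \<open>F(j)\<close> whose kernel is \<open>F(i)\<close>.  The maps
  \<open>incl i j k : F(j)/F(i) \<rightarrow> F(k)/F(i)\<close> and \<open>proj i j k : F(k)/F(i) \<rightarrow> F(k)/F(j)\<close> are determined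
  by the maps \<open>quo\<close> through \<open>c2_space\<close>.
  They are part of the data so that the dual, whose quotients \<open>F\<^sup>0(j)/F\<^sup>0(i)\<close> are by definition the
  dual \<open>C\<^sub>1\<close>-spaces, is an object of the same kind, with the transposed maps.
\<close>

record ('f, 'v, 'w, 'i, 'k) c2 = "('f, 'v, 'i) filtered" +
  lev :: "'i \<Rightarrow> 'i \<Rightarrow> ('f, 'w, 'k) filtered"
  quo :: "'i \<Rightarrow> 'i \<Rightarrow> 'v \<Rightarrow> 'w"
  incl :: "'i \<Rightarrow> 'i \<Rightarrow> 'i \<Rightarrow> 'w \<Rightarrow> 'w"
  proj :: "'i \<Rightarrow> 'i \<Rightarrow> 'i \<Rightarrow> 'w \<Rightarrow> 'w"

definition c2_space ::
  "('f :: {field, finite}, 'v :: ab_group_add, 'w :: ab_group_add, 'i, 'k) c2 \<Rightarrow> bool" where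
  "c2_space E \<longleftrightarrow> filtered_space E \<and>
     (\<forall>i j. ile E i j \<longrightarrow>
        c1_space (lev E i j) \<and>
        lin_map (scl E) (fil E j) (scl (lev E i j)) (carr (lev E i j)) (quo E i j) \<and>
        quo E i j ` fil E j = carr (lev E i j) \<and>
        {v \<in> fil E j. quo E i j v = 0} = fil E i) \<and>
     (\<forall>i j k. ile E i j \<and> ile E j k \<longrightarrow>
        (\<forall>v\<in>fil E j. incl E i j k (quo E i j v) = quo E i k v) \<and>
        (\<forall>v\<in>fil E k. proj E i j k (quo E i k v) = quo E j k v) \<and>
        admissible1 (lev E i j) (lev E i k) (lev E j k) (incl E i j k) (proj E i j k))"

definition complete2 ::
  "('f :: {field, finite}, 'v :: ab_group_add, 'w :: ab_group_add, 'i, 'k) c2 \<Rightarrow> bool" where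
  "complete2 E \<longleftrightarrow> complete_filtered E \<and> (\<forall>i j. ile E i j \<longrightarrow> complete_filtered (lev E i j))"

definition cf_c2_space ::
  "('f :: {field, finite}, 'v :: ab_group_add, 'w :: ab_group_add, 'i, 'k) c2 \<Rightarrow> bool" where
  "cf_c2_space E \<longleftrightarrow> c2_space E \<and> (\<forall>i j. ile E i j \<longrightarrow> compact_filtered (lev E i j))"

definition df_c2_space ::
  "('f :: {field, finite}, 'v :: ab_group_add, 'w :: ab_group_add, 'i, 'k) c2 \<Rightarrow> bool" where
  "df_c2_space E \<longleftrightarrow> c2_space E \<and> (\<forall>i j. ile E i j \<longrightarrow> discrete_filtered (lev E i j))"

text \<open>
  The elements of \<open>F\<^sup>0(j)\<close>, the projective limit over \<open>i \<ge> j\<close> of the duals of \<open>F(i)/F(j)\<close>, as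
  functionals on the whole space.
\<close>

definition dual_fil ::
  "('f :: {field, finite}, 'v :: ab_group_add, 'w :: ab_group_add, 'i, 'k) c2
   \<Rightarrow> 'i \<Rightarrow> ('v \<Rightarrow> 'f) set" where
  "dual_fil E j = {\<phi> \<in> lin_forms E. \<forall>i. ile E j i \<longrightarrow>
     (\<exists>w\<in>carr (dual1 (lev E j i)). \<forall>v\<in>fil E i. \<phi> v = w (quo E j i v))}"

definition dual2 ::
  "('f :: {field, finite}, 'v :: ab_group_add, 'w :: ab_group_add, 'i, 'k) c2
   \<Rightarrow> ('f, 'v \<Rightarrow> 'f, 'w \<Rightarrow> 'f, 'i, 'k) c2" where
  "dual2 E = \<lparr>scl = (\<lambda>c \<phi> v. c * \<phi> v), carr = (\<Union>j\<in>idx E. dual_fil E j),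
     idx = idx E, leq = (\<lambda>i j. leq E j i), fil = dual_fil E,
     lev = (\<lambda>i j. dual1 (lev E j i)),
     quo = (\<lambda>i j \<phi>. THE w. w \<in> carr (dual1 (lev E j i)) \<and> (\<forall>v\<in>fil E i. \<phi> v = w (quo E j i v))),
     incl = (\<lambda>i j k. pullback (lev E k i) (proj E k j i)),
     proj = (\<lambda>i j k. pullback (lev E k j) (incl E k j i))\<rparr>"

text \<open>
  The maps of a triple of \<open>C\<^sub>2\<close>-spaces together with the index maps \<open>\<epsilon>\<close>, \<open>\<gamma>\<close> and the maps
  \<open>alphaq i j\<close>, \<open>betaq i j\<close> induced on the quotients \<open>F(j)/F(i)\<close>.
\<close>

record ('v1, 'w1, 'i1, 'v2, 'w2, 'i2, 'v3, 'w3, 'i3) triple2 =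
  alpha :: "'v1 \<Rightarrow> 'v2"
  beta :: "'v2 \<Rightarrow> 'v3"
  eps :: "'i2 \<Rightarrow> 'i1"
  gam :: "'i2 \<Rightarrow> 'i3"
  alphaq :: "'i2 \<Rightarrow> 'i2 \<Rightarrow> 'w1 \<Rightarrow> 'w2"
  betaq :: "'i2 \<Rightarrow> 'i2 \<Rightarrow> 'w2 \<Rightarrow> 'w3"

definition admissible2 ::
  "('f :: {field, finite}, 'v1 :: ab_group_add, 'w1 :: ab_group_add, 'i1, 'k1) c2
   \<Rightarrow> ('f, 'v2 :: ab_group_add, 'w2 :: ab_group_add, 'i2, 'k2) c2
   \<Rightarrow> ('f, 'v3 :: ab_group_add, 'w3 :: ab_group_add, 'i3, 'k3) c2
   \<Rightarrow> ('v1, 'w1, 'i1, 'v2, 'w2, 'i2, 'v3, 'w3, 'i3) triple2 \<Rightarrow> bool" where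
  "admissible2 E1 E2 E3 T \<longleftrightarrow>
     c2_space E1 \<and> c2_space E2 \<and> c2_space E3 \<and>
     short_exact E1 E2 E3 (alpha T) (beta T) \<and>
     dominates_via (eps T) E1 (sub_fil (alpha T) E1 E2) \<and>
     dominates_via (gam T) E3 (img_fil (beta T) E3 E2) \<and>
     (\<forall>i j. ile E2 i j \<longrightarrow>
        (\<forall>v\<in>fil E1 (eps T j).
           alphaq T i j (quo E1 (eps T i) (eps T j) v) = quo E2 i j (alpha T v)) \<and>
        (\<forall>v\<in>fil E2 j.
           betaq T i j (quo E2 i j v) = quo E3 (gam T i) (gam T j) (beta T v)) \<and>
        admissible1 (lev E1 (eps T i) (eps T j)) (lev E2 i j) (lev E3 (gam T i) (gam T j))
          (alphaq T i j) (betaq T i j))"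

definition dual_triple ::
  "('f :: {field, finite}, 'v1 :: ab_group_add, 'w1 :: ab_group_add, 'i1, 'k1) c2
   \<Rightarrow> ('f, 'v2 :: ab_group_add, 'w2 :: ab_group_add, 'i2, 'k2) c2
   \<Rightarrow> ('v1, 'w1, 'i1, 'v2, 'w2, 'i2, 'v3, 'w3, 'i3) triple2
   \<Rightarrow> ('v3 \<Rightarrow> 'f, 'w3 \<Rightarrow> 'f, 'i3, 'v2 \<Rightarrow> 'f, 'w2 \<Rightarrow> 'f, 'i2, 'v1 \<Rightarrow> 'f, 'w1 \<Rightarrow> 'f, 'i1) triple2" where
  "dual_triple E1 E2 T = \<lparr>alpha = pullback E2 (beta T), beta = pullback E1 (alpha T),
     eps = gam T, gam = eps T,
     alphaq = (\<lambda>i j. pullback (lev E2 j i) (betaq T j i)),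
     betaq = (\<lambda>i j. pullback (lev E1 (eps T j) (eps T i)) (alphaq T j i))\<rparr>"

section \<open>Virtual measures\<close>

text \<open>
  The transition maps of the direct system defining \<open>\<mu>(F(i) | F(j))\<close> are isomorphisms, so the
  equivalence class of a germ contains exactly one element for each \<open>l \<le> i, j\<close>: it is the graph of
  a family of linear maps compatible with the transition maps.  Elements of \<open>\<mu>(F(i) | F(j))\<close> are
  these families.
\<close>

type_synonym ('i, 'w) vmeas = "'i \<Rightarrow> 'w fnl \<Rightarrow> 'w fnl"

definition meas_hom :: "'v fnl set \<Rightarrow> 'v fnl set \<Rightarrow> ('v fnl \<Rightarrow> 'v fnl) set" where
  "meas_hom A B = {h.
     (\<forall>a\<in>A. h a \<in> B) \<and> (\<forall>a\<in>A. \<forall>a'\<in>A. h (a + a') = h a + h a') \<and>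
     (\<forall>c. \<forall>a\<in>A. h (\<lambda>f. c * a f) = (\<lambda>f. c * h a f)) \<and> (\<forall>a. a \<notin> A \<longrightarrow> h a = 0)}"

text \<open>For \<open>i \<le> j \<le> k\<close>: \<open>\<mu>(F(j)/F(i)) \<otimes> \<mu>(F(k)/F(j)) = \<mu>(F(k)/F(i))\<close>.\<close>

definition lev_tensor ::
  "('f, 'v, 'w :: ab_group_add, 'i, 'k) c2 \<Rightarrow> 'i \<Rightarrow> 'i \<Rightarrow> 'i \<Rightarrow> 'w fnl \<Rightarrow> 'w fnl \<Rightarrow> 'w fnl" where
  "lev_tensor E i j k =
     meas_tensor (lev E i j) (lev E i k) (lev E j k) (incl E i j k) (proj E i j k)"

definition virt :: "('f, 'v, 'w :: ab_group_add, 'i, 'k) c2 \<Rightarrow> 'i \<Rightarrow> 'i \<Rightarrow> ('i, 'w) vmeas set" where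
  "virt E i j = {h.
     (\<forall>l. \<not> (ile E l i \<and> ile E l j) \<longrightarrow> h l = 0) \<and>
     (\<forall>l. ile E l i \<and> ile E l j \<longrightarrow> h l \<in> meas_hom (meas (lev E l i)) (meas (lev E l j))) \<and>
     (\<forall>l l'. ile E l' l \<and> ile E l i \<and> ile E l j \<longrightarrow>
        (\<forall>c\<in>meas (lev E l' l). \<forall>a\<in>meas (lev E l i).
           h l' (lev_tensor E l' l i c a) = lev_tensor E l' l j c (h l a)))}"

definition vscale :: "complex \<Rightarrow> ('i, 'w) vmeas \<Rightarrow> ('i, 'w) vmeas" where
  "vscale z h = (\<lambda>l a f. z * h l a f)"

text \<open>The identification of \<open>\<mu>(F(j)/F(i))\<close> with \<open>\<mu>(F(i) | F(j))\<close> for \<open>i \<le> j\<close>.\<close>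

definition virt_of ::
  "('f, 'v, 'w :: ab_group_add, 'i, 'k) c2 \<Rightarrow> 'i \<Rightarrow> 'i \<Rightarrow> 'w fnl \<Rightarrow> ('i, 'w) vmeas" where
  "virt_of E i j \<nu> =
     (\<lambda>l a. if ile E l i \<and> a \<in> meas (lev E l i) then lev_tensor E l i j a \<nu> else 0)"

text \<open>Composition \<open>\<mu>(F(i) | F(j)) \<otimes> \<mu>(F(j) | F(k)) = \<mu>(F(i) | F(k))\<close>.\<close>

definition virt_comp ::
  "('f, 'v, 'w :: ab_group_add, 'i, 'k) c2 \<Rightarrow> 'i \<Rightarrow> 'i \<Rightarrow> 'i
   \<Rightarrow> ('i, 'w) vmeas \<Rightarrow> ('i, 'w) vmeas \<Rightarrow> ('i, 'w) vmeas" where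
  "virt_comp E i j k g h =
     (THE \<theta>. \<theta> \<in> virt E i k \<and>
        (\<forall>l. ile E l i \<and> ile E l j \<and> ile E l k \<longrightarrow> (\<forall>a\<in>meas (lev E l i). \<theta> l a = h l (g l a))))"

text \<open>
  The identification \<open>\<mu>(F(i) | F(j)) = \<mu>(F\<^sup>0(i) | F\<^sup>0(j))\<close>.  On the dual side the families are
  indexed by \<open>k \<ge> i, j\<close> and consist of maps from \<open>\<mu>\<close> of the dual of \<open>F(k)/F(i)\<close> to \<open>\<mu>\<close> of the dual
  of \<open>F(k)/F(j)\<close>.  The image of \<open>h\<close> is the family of maps transposed, with respect to the pairing
  of measures on a space and on its dual, to
  \<open>\<mu>(F(k)/F(j)) = \<mu>(F(j) | F(k)) \<rightarrow> \<mu>(F(i) | F(k)) = \<mu>(F(k)/F(i))\<close>, composition with \<open>h\<close>.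
  For \<open>i \<le> j\<close> and \<open>h\<close> given by a nonzero \<open>\<nu> \<in> \<mu>(F(j)/F(i))\<close> it is the inverse of the element given by the
  dual measure of \<open>\<nu>\<close> on \<open>F\<^sup>0(i)/F\<^sup>0(j)\<close>.
\<close>

definition virt_dual ::
  "('f :: {field, finite}, 'v :: ab_group_add, 'w :: ab_group_add, 'i, 'k) c2
   \<Rightarrow> 'i \<Rightarrow> 'i \<Rightarrow> ('i, 'w) vmeas \<Rightarrow> ('i, 'w \<Rightarrow> 'f) vmeas" where
  "virt_dual E i j h =
     (THE h'. h' \<in> virt (dual2 E) i j \<and>
        (\<forall>k. ile E i k \<and> ile E j k \<longrightarrow>
           (\<forall>n\<in>meas (dual1 (lev E i k)). \<forall>s\<in>meas (lev E j k). \<forall>r\<in>meas (lev E i k).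
              virt_of E i k r = virt_comp E i j k h (virt_of E j k s) \<longrightarrow>
              meas_pair (lev E j k) s (h' k n) = meas_pair (lev E i k) r n)))"

text \<open>
  The multiplicative system of elements of \<open>\<mu>(F(i) | F(j))\<close> extending a choice of measures \<open>\<nu> i j\<close>
  on \<open>F(j)/F(i)\<close> for \<open>i \<le> j\<close>.
\<close>

definition mult_system ::
  "('f, 'v, 'w :: ab_group_add, 'i, 'k) c2 \<Rightarrow> ('i \<Rightarrow> 'i \<Rightarrow> 'w fnl) \<Rightarrow> 'i \<Rightarrow> 'i \<Rightarrow> ('i, 'w) vmeas" where
  "mult_system E \<nu> =
     (THE \<theta>.
        (\<forall>i j. \<not> (i \<in> idx E \<and> j \<in> idx E) \<longrightarrow> \<theta> i j = 0) \<and>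
        (\<forall>i\<in>idx E. \<forall>j\<in>idx E. \<theta> i j \<in> virt E i j) \<and>
        (\<forall>i\<in>idx E. \<forall>j\<in>idx E. \<forall>k\<in>idx E. virt_comp E i j k (\<theta> i j) (\<theta> j k) = \<theta> i k) \<and>
        (\<forall>i j. ile E i j \<longrightarrow> \<theta> i j = virt_of E i j (\<nu> i j)))"

definition cf_system ::
  "('f, 'v, 'w :: ab_group_add, 'i, 'k) c2 \<Rightarrow> 'i \<Rightarrow> 'i \<Rightarrow> ('i, 'w) vmeas" where
  "cf_system E =
     mult_system E (\<lambda>i j. THE m. m \<in> meas (lev E i j) \<and> mass m (carr (lev E i j)) = 1)"

definition df_system ::
  "('f, 'v, 'w :: ab_group_add, 'i, 'k) c2 \<Rightarrow> 'i \<Rightarrow> 'i \<Rightarrow> ('i, 'w) vmeas" where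
  "df_system E = mult_system E (\<lambda>i j. THE m. m \<in> meas (lev E i j) \<and> mass m {0} = 1)"

text \<open>
  For an admissible triple:
  \<open>\<mu>(F\<^sub>1(\<epsilon>(i)) | F\<^sub>1(\<epsilon>(j))) \<otimes> \<mu>(F\<^sub>3(\<gamma>(i)) | F\<^sub>3(\<gamma>(j))) = \<mu>(F\<^sub>2(i) | F\<^sub>2(j))\<close>.
\<close>

definition triple_tensor ::
  "('f, 'v1, 'w1 :: ab_group_add, 'i1, 'k1) c2 \<Rightarrow> ('f, 'v2, 'w2 :: ab_group_add, 'i2, 'k2) c2
   \<Rightarrow> ('f, 'v3, 'w3 :: ab_group_add, 'i3, 'k3) c2
   \<Rightarrow> ('v1, 'w1, 'i1, 'v2, 'w2, 'i2, 'v3, 'w3, 'i3) triple2 \<Rightarrow> 'i2 \<Rightarrow> 'i2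
   \<Rightarrow> 'w1 fnl \<Rightarrow> 'w3 fnl \<Rightarrow> 'w2 fnl" where
  "triple_tensor E1 E2 E3 T i j =
     meas_tensor (lev E1 (eps T i) (eps T j)) (lev E2 i j) (lev E3 (gam T i) (gam T j))
       (alphaq T i j) (betaq T i j)"

definition virt_tensor ::
  "('f, 'v1, 'w1 :: ab_group_add, 'i1, 'k1) c2 \<Rightarrow> ('f, 'v2, 'w2 :: ab_group_add, 'i2, 'k2) c2
   \<Rightarrow> ('f, 'v3, 'w3 :: ab_group_add, 'i3, 'k3) c2
   \<Rightarrow> ('v1, 'w1, 'i1, 'v2, 'w2, 'i2, 'v3, 'w3, 'i3) triple2 \<Rightarrow> 'i2 \<Rightarrow> 'i2
   \<Rightarrow> ('i1, 'w1) vmeas \<Rightarrow> ('i3, 'w3) vmeas \<Rightarrow> ('i2, 'w2) vmeas" where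
  "virt_tensor E1 E2 E3 T i j h1 h3 =
     (THE h. h \<in> virt E2 i j \<and>
        (\<forall>l. ile E2 l i \<and> ile E2 l j \<longrightarrow>
           (\<forall>a1\<in>meas (lev E1 (eps T l) (eps T i)). \<forall>a3\<in>meas (lev E3 (gam T l) (gam T i)).
              h l (triple_tensor E1 E2 E3 T l i a1 a3) =
                triple_tensor E1 E2 E3 T l j (h1 (eps T l) a1) (h3 (gam T l) a3))))"

section \<open>The spaces \<open>\<D>\<^bsub>F(b)\<^esub>(E)\<close> and the Fourier transform\<close>

text \<open>
  For a line \<open>L\<close> of virtual measures, \<open>\<D>(X) \<otimes> L\<close> is realized as a space of \<open>L\<close>-valued functions on
  \<open>X\<close>; all its elements are pure tensors since \<open>L\<close> is one-dimensional.  A linear map on \<open>\<D>(X) \<otimes> L\<close>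
  prescribed on pure tensors is written below as the unique value at a pure representation.
\<close>

definition tens :: "('w \<Rightarrow> complex) \<Rightarrow> ('i, 'u) vmeas \<Rightarrow> 'w \<Rightarrow> ('i, 'u) vmeas" where
  "tens f h = (\<lambda>v. vscale (f v) h)"

definition tens_space ::
  "('w \<Rightarrow> complex) set \<Rightarrow> ('i, 'u) vmeas set \<Rightarrow> ('w \<Rightarrow> ('i, 'u) vmeas) set" where
  "tens_space D L = {tens f h | f h. f \<in> D \<and> h \<in> L}"

text \<open>
  For \<open>i \<ge> j \<ge> l\<close>, the map from \<open>\<D>(F(i)/F(l)) \<otimes> \<mu>(F(l) | F(b))\<close> to \<open>\<D>(F(i)/F(j)) \<otimes> \<mu>(F(j) | F(b))\<close>.
\<close>

definition push2 ::
  "('f, 'v, 'w :: ab_group_add, 'i, 'k) c2 \<Rightarrow> 'i \<Rightarrow> 'i \<Rightarrow> 'i \<Rightarrow> 'i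
   \<Rightarrow> ('w \<Rightarrow> ('i, 'w) vmeas) \<Rightarrow> 'w \<Rightarrow> ('i, 'w) vmeas" where
  "push2 E b i j l t =
     (THE t'. \<exists>f \<nu> h. f \<in> sch (lev E l i) \<and> \<nu> \<in> meas (lev E l j) \<and> h \<in> virt E j b \<and>
        t = tens f (virt_comp E l j b (virt_of E l j \<nu>) h) \<and>
        t' = tens (push1 (lev E l j) (lev E l i) (lev E j i) (incl E l j i) (proj E l j i) f \<nu>) h)"

text \<open>
  Elements are families \<open>t\<close> with \<open>t i l\<close> in \<open>\<D>(F(i)/F(l)) \<otimes> \<mu>(F(l) | F(b))\<close> for \<open>l \<le> i\<close>.
\<close>

definition sch2 ::
  "('f, 'v, 'w :: ab_group_add, 'i, 'k) c2 \<Rightarrow> 'i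
   \<Rightarrow> ('i \<Rightarrow> 'i \<Rightarrow> 'w \<Rightarrow> ('i, 'w) vmeas) set" where
  "sch2 E b = {t.
     (\<forall>i l. \<not> ile E l i \<longrightarrow> t i l = 0) \<and>
     (\<forall>i l. ile E l i \<longrightarrow> t i l \<in> tens_space (sch (lev E l i)) (virt E l b)) \<and>
     (\<forall>i j l. ile E l j \<and> ile E j i \<longrightarrow>
        pullback (lev E l j) (incl E l j i) (t i l) = t j l \<and>
        push2 E b i j l (t i l) = t i j)}"

text \<open>
  The component of index \<open>(j, i)\<close>, \<open>j \<le> i\<close>, of a transform lies in
  \<open>\<D>(F\<^sup>0(j)/F\<^sup>0(i)) \<otimes> \<mu>(F\<^sup>0(i) | F\<^sup>0(b))\<close>.
\<close>

definition fourier2 ::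
  "('f :: {field, finite} \<Rightarrow> complex)
   \<Rightarrow> ('f, 'v :: ab_group_add, 'w :: ab_group_add, 'i, 'k) c2 \<Rightarrow> 'i
   \<Rightarrow> ('i \<Rightarrow> 'i \<Rightarrow> 'w \<Rightarrow> ('i, 'w) vmeas)
   \<Rightarrow> 'i \<Rightarrow> 'i \<Rightarrow> ('w \<Rightarrow> 'f) \<Rightarrow> ('i, 'w \<Rightarrow> 'f) vmeas" where
  "fourier2 \<psi> E b t = (\<lambda>j i. if ile E j i then
     (THE t'. \<exists>f \<rho> h. f \<in> sch (lev E j i) \<and> \<rho> \<in> meas (lev E j i) \<and> h \<in> virt E i b \<and>
        t i j = tens f (virt_comp E j i b (virt_of E j i \<rho>) h) \<and>
        t' = tens (fourier1 \<psi> (lev E j i) \<rho> f) (virt_dual E i b h))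
     else 0)"

text \<open>The image map \<open>\<alpha>\<^sub>*\<close> for a triple whose third term is a \<open>dfC\<^sub>2\<close>-space.\<close>

definition image2 ::
  "('f, 'v1, 'w1 :: ab_group_add, 'i1, 'k1) c2 \<Rightarrow> ('f, 'v2, 'w2 :: ab_group_add, 'i2, 'k2) c2
   \<Rightarrow> ('f, 'v3, 'w3 :: ab_group_add, 'i3, 'k3) c2
   \<Rightarrow> ('v1, 'w1, 'i1, 'v2, 'w2, 'i2, 'v3, 'w3, 'i3) triple2 \<Rightarrow> 'i2
   \<Rightarrow> ('i1 \<Rightarrow> 'i1 \<Rightarrow> 'w1 \<Rightarrow> ('i1, 'w1) vmeas) \<Rightarrow> 'i2 \<Rightarrow> 'i2 \<Rightarrow> 'w2 \<Rightarrow> ('i2, 'w2) vmeas" where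
  "image2 E1 E2 E3 T b t = (\<lambda>i j. if ile E2 j i then
     (THE t'. \<exists>f h. f \<in> sch (lev E1 (eps T j) (eps T i)) \<and> h \<in> virt E1 (eps T j) (eps T b) \<and>
        t (eps T i) (eps T j) = tens f h \<and>
        t' = tens (ext0 (lev E1 (eps T j) (eps T i)) (alphaq T j i) f)
               (virt_tensor E1 E2 E3 T j b h (df_system E3 (gam T j) (gam T b))))
     else 0)"

text \<open>
  The element \<open>\<one>\<close> of \<open>\<D>\<^bsub>F(b)\<^esub>(E)\<close> for a \<open>cfC\<^sub>2\<close>-space, the lines \<open>\<mu>(F(l) | F(b))\<close> being
  trivialized by the elements \<open>1\<^bsub>lb\<^esub>\<close>.
\<close>

definition one2 ::
  "('f, 'v, 'w :: ab_group_add, 'i, 'k) c2 \<Rightarrow> 'i \<Rightarrow> 'i \<Rightarrow> 'i \<Rightarrow> 'w \<Rightarrow> ('i, 'w) vmeas" where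
  "one2 E b = (\<lambda>i l. if ile E l i
     then tens (indicator (carr (lev E l i))) (cf_system E l b) else 0)"

definition delta2 ::
  "('f, 'v1, 'w1 :: ab_group_add, 'i1, 'k1) c2 \<Rightarrow> ('f, 'v2, 'w2 :: ab_group_add, 'i2, 'k2) c2
   \<Rightarrow> ('f, 'v3, 'w3 :: ab_group_add, 'i3, 'k3) c2
   \<Rightarrow> ('v1, 'w1, 'i1, 'v2, 'w2, 'i2, 'v3, 'w3, 'i3) triple2 \<Rightarrow> 'i2
   \<Rightarrow> 'i2 \<Rightarrow> 'i2 \<Rightarrow> 'w2 \<Rightarrow> ('i2, 'w2) vmeas" where
  "delta2 E1 E2 E3 T b = image2 E1 E2 E3 T b (one2 E1 (eps T b))"

end

theory Submission
  imports Defs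
begin

text \<open>
  Since \<open>E\<^sub>1\<close> is a \<open>cfC\<^sub>2\<close>-space and \<open>E\<^sub>3\<close> a \<open>dfC\<^sub>2\<close>-space, the image \<open>K\<^sub>i\<^sub>j\<close> of \<open>E\<^sub>1\<close> in the quotient
  \<open>F\<^sub>2(j)/F\<^sub>2(i)\<close> is an open and compact subspace, compatible with the inclusions and projections
  between the quotients.  The identifications \<open>1\<^sub>i\<^sub>j\<close> on \<open>E\<^sub>1\<close> and \<open>\<delta>\<^sub>i\<^sub>j\<close> on \<open>E\<^sub>3\<close> combine to the
  multiplicative system of measures on \<open>E\<^sub>2\<close> giving mass \<open>1\<close> to the \<open>K\<^sub>i\<^sub>j\<close>, and with respect to it
  the components of \<open>\<alpha>\<^sub>*(\<one>)\<close> are the indicator functions of the \<open>K\<^sub>i\<^sub>j\<close>.  By orthogonality of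
  characters the Fourier transform of the indicator function of \<open>K\<^sub>i\<^sub>j\<close> for this measure is the
  indicator function of the annihilator of \<open>K\<^sub>i\<^sub>j\<close>, which is the image of the dual of \<open>E\<^sub>3\<close>; and the
  dual measures give mass \<open>1\<close> to these annihilators.
\<close>

section \<open>Lattices and transversals\<close>

text \<open>The subspaces \<open>K\<close> need not belong to the filtration of a quotient, whereas
  the tensor product of measures and their pairing with the dual are defined through masses of
  filtration members only. Masses are therefore compared on all lattices, the subspaces between two
  members of the filtration; nested lattices have finite index, and statements on measures become
  statements on indices. The other obstacle is that tensor products, compositions and duals of
  virtual measures, multiplicative systems and the transforms are definite descriptions, which mean
  something only after existence and uniqueness are known. Hence an invariant functional has to be
  constructed and shown to span a line, and every virtual measure is written as a multiple of the
  one given by the \<open>K\<close>. Each description then becomes an equation between scalars, and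
  two representations of one pure tensor differ only by moving scalars, which the transforms
  respect. The setting is kept self-dual: annihilators of a compatible family of lattices form a
  compatible family for the dual, so one lemma evaluates the delta of the triple and of the dual
  triple.\<close>

definition is_lattice :: "('f :: {field, finite}, 'v :: ab_group_add, 'i) filtered \<Rightarrow> 'v set \<Rightarrow> bool" where
  "is_lattice X U \<longleftrightarrow> module.subspace (scl X) U \<and>
     (\<exists>i\<in>idx X. fil X i \<subseteq> U) \<and> (\<exists>j\<in>idx X. U \<subseteq> fil X j)"

text \<open>Finite sets of representatives replace sums over quotient types. For subgroups
  \<open>U\<close> and \<open>W\<close>, the set \<open>R\<close> represents W/(W \<inter>
  U).\<close>

definition transversal :: "'v :: ab_group_add set \<Rightarrow> 'v set \<Rightarrow> 'v set \<Rightarrow> bool" where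
  "transversal U W R \<longleftrightarrow> finite R \<and> R \<subseteq> W \<and> (\<forall>w\<in>W. \<exists>!r. r \<in> R \<and> w - r \<in> U)"

text \<open>For \<open>K\<close> the whole carrier and for \<open>K\<close> equal to {0} the body is
  literally the description used in \<open>cf_system\<close> and in \<open>df_system\<close>, so
  both normalizations are instances of one notion.\<close>

definition haar :: "('f :: {field, finite}, 'v :: ab_group_add, 'i) filtered \<Rightarrow> 'v set \<Rightarrow> 'v fnl" where
  "haar X K = (THE m. m \<in> meas X \<and> mass m K = 1)"

locale c1 =
  fixes X :: "('f :: {field, finite}, 'v :: ab_group_add, 'i) filtered"
  assumes c1: "c1_space X"

sublocale c1 \<subseteq> vector_space "scl X"
  using c1 by (simp add: c1_space_def filtered_space_def)

context c1
begin

lemma filtered: "filtered_space X"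
  using c1 by (simp add: c1_space_def)

lemma subspace_carr: "subspace (carr X)"
  using filtered by (simp add: filtered_space_def)

lemma subspace_fil: "i \<in> idx X \<Longrightarrow> subspace (fil X i)"
  using filtered by (simp add: filtered_space_def)

lemma fil_subset_carr: "i \<in> idx X \<Longrightarrow> fil X i \<subseteq> carr X"
  using filtered by (simp add: filtered_space_def)

lemma fil_mono: "ile X i j \<Longrightarrow> fil X i \<subseteq> fil X j"
  using filtered by (simp add: filtered_space_def)

lemma ex_bounds:
  assumes "i \<in> idx X" "j \<in> idx X"
  obtains k l where "ile X k i" "ile X k j" "ile X i l" "ile X j l" "ile X k l"
proof -
  obtain k l where *: "ile X k i" "ile X i l" "ile X k j" "ile X j l"
    using filtered[unfolded filtered_space_def] assms by meson
  moreover have "trans {(i, j). ile X i j}"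
    using filtered by (simp add: filtered_space_def partial_order_on_def preorder_on_def)
  then have "ile X k l" using * by (auto dest: transD)
  ultimately show ?thesis using that by blast
qed

lemma ex_idx: "\<exists>i. i \<in> idx X"
proof (rule ccontr)
  assume "\<nexists>i. i \<in> idx X"
  then have "carr X = {}" using filtered by (auto simp: filtered_space_def)
  then show False using subspace_0[OF subspace_carr] by simp
qed

lemma ile_idx: "ile X i j \<Longrightarrow> i \<in> idx X" "ile X i j \<Longrightarrow> j \<in> idx X"
  by (auto simp: ile_def)

lemma UN_fil: "(\<Union>i\<in>idx X. fil X i) = carr X"
  using filtered by (simp add: filtered_space_def)

lemma lattice_subspace: "is_lattice X U \<Longrightarrow> subspace U"
  by (simp add: is_lattice_def)

lemma lattice_subset_carr: "is_lattice X U \<Longrightarrow> U \<subseteq> carr X"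
  using fil_subset_carr by (auto simp: is_lattice_def)

lemma lattice_fil: "i \<in> idx X \<Longrightarrow> is_lattice X (fil X i)"
  by (auto simp: is_lattice_def subspace_fil)

lemma lattice_sandwich:
  "\<lbrakk>is_lattice X U; is_lattice X W; subspace V; U \<subseteq> V; V \<subseteq> W\<rbrakk> \<Longrightarrow> is_lattice X V"
  unfolding is_lattice_def by (metis subset_trans)

lemma lattice_span:
  assumes "is_lattice X U" "is_lattice X W" "U \<subseteq> W" "R \<subseteq> W"
  shows "is_lattice X (span (R \<union> U))" "span (R \<union> U) \<subseteq> W"
proof -
  show "span (R \<union> U) \<subseteq> W" using assms by (intro span_minimal) (auto simp: lattice_subspace)
  then show "is_lattice X (span (R \<union> U))"
    using assms(1,2) by (rule lattice_sandwich[rotated -1]) (auto intro: span_base)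
qed

lemma lattice_bounds:
  assumes "is_lattice X U" "is_lattice X W"
  obtains i j where "i \<in> idx X" "j \<in> idx X" "ile X i j"
    "fil X i \<subseteq> U" "fil X i \<subseteq> W" "U \<subseteq> fil X j" "W \<subseteq> fil X j"
proof -
  obtain a b c d where *: "a \<in> idx X" "fil X a \<subseteq> U" "b \<in> idx X" "fil X b \<subseteq> W"
    "c \<in> idx X" "U \<subseteq> fil X c" "d \<in> idx X" "W \<subseteq> fil X d"
    using assms unfolding is_lattice_def by meson
  obtain i l where i: "ile X i a" "ile X i b" "ile X a l" "ile X b l" by (rule ex_bounds[OF *(1) *(3)])
  obtain k j where j: "ile X c j" "ile X d j" by (rule ex_bounds[OF *(5) *(7)])
  obtain i' j' where ij: "ile X i' i" "ile X i' j" "ile X i j'" "ile X j j'" "ile X i' j'"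
    by (rule ex_bounds[of i j]) (use i j ile_idx in blast)+
  have "fil X i' \<subseteq> fil X i" "fil X j \<subseteq> fil X j'" "fil X i \<subseteq> fil X a" "fil X i \<subseteq> fil X b"
    "fil X c \<subseteq> fil X j" "fil X d \<subseteq> fil X j" using ij i j fil_mono by blast+
  then show ?thesis using that[of i' j'] ij * ile_idx by blast
qed

text \<open>This is where finiteness of the scalar field enters: a new generator contributes only
  finitely many multiples.\<close>

lemma finite_span: "finite B \<Longrightarrow> finite (span B)"
proof (induction B rule: finite_induct)
  case (insert a B)
  have "span (insert a B) \<subseteq> (\<lambda>(k, x). x + scl X k a) ` (UNIV \<times> span B)"
  proof
    fix x assume "x \<in> span (insert a B)"
    then obtain k where "x - scl X k a \<in> span B" by (auto simp: span_insert)
    then show "x \<in> (\<lambda>(k, x). x + scl X k a) ` (UNIV \<times> span B)"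
      by (intro image_eqI[of _ _ "(k, x - scl X k a)"]) auto
  qed
  then show ?case using insert.IH by (auto intro: finite_subset)
qed simp

section \<open>Finite index of lattices and choice of representatives\<close>

lemma lattice_finite_cover:
  assumes "is_lattice X U" "is_lattice X W"
  obtains R where "finite R" "\<And>w. w \<in> W \<Longrightarrow> \<exists>r\<in>R. w - r \<in> U"
proof -
  obtain i j where ij: "i \<in> idx X" "j \<in> idx X" "ile X i j" "fil X i \<subseteq> U" "W \<subseteq> fil X j"
    using lattice_bounds[OF assms] by metis
  then obtain B where B: "finite B" "fil X j \<subseteq> span (B \<union> fil X i)"
    using c1 unfolding c1_space_def by blast
  have "\<exists>r\<in>span B. w - r \<in> U" if "w \<in> W" for w
  proof -
    have "w \<in> span (B \<union> fil X i)" using that B ij by blast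
    then obtain x y where xy: "w = x + y" "x \<in> span B" "y \<in> fil X i"
      using ij(1) by (auto simp: span_Un span_eq_iff[THEN iffD2] subspace_fil)
    then show ?thesis using ij by (intro bexI[of _ x]) auto
  qed
  then show ?thesis using that finite_span[OF B(1)] by blast
qed

lemma transversal_exists:
  assumes "is_lattice X U" "is_lattice X W"
  obtains R where "transversal U W R"
proof -
  obtain R0 where R0: "finite R0" "\<And>w. w \<in> W \<Longrightarrow> \<exists>r\<in>R0. w - r \<in> U"
    using lattice_finite_cover[OF assms] by blast
  have U: "subspace U" using assms by (simp add: lattice_subspace)
  \<comment> \<open>The predicate depends only on the coset of \<open>w\<close> modulo
    \<open>U\<close>, so the choice is constant on cosets and its values form a transversal.
    Finiteness comes from the cover \<open>R0\<close>, whose elements may lie outside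
    \<open>W\<close>.\<close>
  define rep where "rep w = (SOME r. r \<in> W \<and> w - r \<in> U)" for w
  have rep: "rep w \<in> W \<and> w - rep w \<in> U" if "w \<in> W" for w
    unfolding rep_def by (rule someI[of _ w]) (use that subspace_0[OF U] in simp)
  have rep_cong: "rep w = rep w'" if "w - w' \<in> U" for w w'
  proof -
    have "w - r \<in> U \<longleftrightarrow> w' - r \<in> U" for r
      using subspace_diff[OF U, of "w - r" "w - w'"] subspace_add[OF U, of "w' - r" "w - w'"] that
      by auto
    then show ?thesis by (simp add: rep_def)
  qed
  have "rep ` W \<subseteq> rep ` R0" using R0(2) rep_cong by blast
  then have "finite (rep ` W)" using R0(1) finite_subset by blast
  moreover have "\<exists>!r. r \<in> rep ` W \<and> w - r \<in> U" if w: "w \<in> W" for w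
  proof (rule ex1I[of _ "rep w"])
    show "rep w \<in> rep ` W \<and> w - rep w \<in> U" using rep w by blast
    fix r assume r: "r \<in> rep ` W \<and> w - r \<in> U"
    then obtain x where x: "x \<in> W" "r = rep x" by blast
    then have "(w - r) - (x - r) \<in> U" using r rep subspace_diff[OF U] by blast
    then show "r = rep w" using rep_cong[of w x] x by simp
  qed
  ultimately have "transversal U W (rep ` W)"
    unfolding transversal_def using rep by blast
  then show ?thesis using that by blast
qed

end

text \<open>Sending a representative to the one of the same coset in the other set is a bijection,
  and \<open>f\<close> agrees at both ends.\<close>

lemma transversal_sum_eq:
  fixes f :: "'v :: ab_group_add \<Rightarrow> complex"
  assumes "transversal U W R" "transversal U W S"
    and U: "\<And>u. u \<in> U \<Longrightarrow> - u \<in> U"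
    and f: "\<And>v u. v \<in> W \<Longrightarrow> u \<in> U \<Longrightarrow> f (v + u) = f v"
  shows "sum f R = sum f S"
proof -
  define g where "g R w = (THE r. r \<in> R \<and> w - r \<in> U)" for R and w :: 'v
  have g: "g R w \<in> R \<and> w - g R w \<in> U" "\<And>r. r \<in> R \<Longrightarrow> w - r \<in> U \<Longrightarrow> g R w = r"
    if "transversal U W R" "w \<in> W" for w R
  proof -
    have ex: "\<exists>!r. r \<in> R \<and> w - r \<in> U" using that by (auto simp: transversal_def)
    show "g R w \<in> R \<and> w - g R w \<in> U" unfolding g_def by (rule theI'[OF ex])
    show "g R w = r" if "r \<in> R" "w - r \<in> U" for r
      unfolding g_def by (rule the1_equality[OF ex]) (use that in simp)
  qed
  have sub: "R \<subseteq> W" "S \<subseteq> W" using assms by (auto simp: transversal_def)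
  show ?thesis
  proof (rule sum.reindex_bij_witness[of _ "g R" "g S"])
    fix r assume r: "r \<in> R"
    with sub have rW: "r \<in> W" by auto
    note gr = g(1)[OF assms(2) rW]
    then have "g S r \<in> W" using sub by auto
    then show "g R (g S r) = r" using g(2)[OF assms(1), of "g S r" r] gr U[of "r - g S r"] r by auto
    show "g S r \<in> S" using gr by simp
    show "f (g S r) = f r" using f[of "g S r" "r - g S r"] gr \<open>g S r \<in> W\<close> by simp
  next
    fix s assume s: "s \<in> S"
    with sub have sW: "s \<in> W" by auto
    note gs = g(1)[OF assms(1) sW]
    then have "g R s \<in> W" using sub by auto
    then show "g S (g R s) = s" using g(2)[OF assms(2), of "g R s" s] gs U[of "s - g R s"] s by auto
    show "g R s \<in> R" using gs by simp
  qed
qed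

lemma transversal_inj:
  assumes "transversal U W R" "r \<in> R" "s \<in> R" "r - s \<in> U" "0 \<in> U"
  shows "r = s"
proof -
  have "r \<in> W" using assms by (auto simp: transversal_def)
  then have "\<exists>!x. x \<in> R \<and> r - x \<in> U" using assms by (auto simp: transversal_def)
  then show ?thesis using assms by auto
qed

text \<open>Multiplicativity of the index, [W:V] = [W:U] [U:V], with explicit representatives: those
  of W/U plus those of U/V.\<close>

lemma transversal_tower:
  assumes R: "transversal U W R" and S: "transversal V U S"
    and U: "0 \<in> U" "\<And>x y. x \<in> U \<Longrightarrow> y \<in> U \<Longrightarrow> x + y \<in> U" "\<And>x y. x \<in> U \<Longrightarrow> y \<in> U \<Longrightarrow> x - y \<in> U"
    and V: "0 \<in> V" "V \<subseteq> U"
    and W: "\<And>x y. x \<in> W \<Longrightarrow> y \<in> U \<Longrightarrow> x + y \<in> W"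
  shows "transversal V W ((\<lambda>(r, s). r + s) ` (R \<times> S))" "inj_on (\<lambda>(r, s). r + s) (R \<times> S)"
proof -
  have fin: "finite R" "finite S" and sub: "R \<subseteq> W" "S \<subseteq> U"
    using R S by (auto simp: transversal_def)
  have uniq: "r = r' \<and> s = s'"
    if "r \<in> R" "r' \<in> R" "s \<in> S" "s' \<in> S" "(r + s) - (r' + s') \<in> V" for r s r' s'
  proof -
    have "s - s' \<in> U" using that sub U(3) by blast
    then have "(r + s) - (r' + s') - (s - s') \<in> U" using that V U(3) by blast
    then have "r - r' \<in> U" by (simp add: algebra_simps)
    then have r: "r = r'" using transversal_inj[OF R] that U by blast
    then have "s - s' \<in> V" using that by simp
    then show ?thesis using r transversal_inj[OF S] that V by blast
  qed
  show "inj_on (\<lambda>(r, s). r + s) (R \<times> S)"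
  proof (rule inj_onI, clarify)
    fix r s r' s' assume *: "r \<in> R" "s \<in> S" "r' \<in> R" "s' \<in> S" "r + s = r' + s'"
    then have "(r + s) - (r' + s') \<in> V" using V by simp
    then show "r = r' \<and> s = s'" using uniq * by blast
  qed
  show "transversal V W ((\<lambda>(r, s). r + s) ` (R \<times> S))"
    unfolding transversal_def
  proof (intro conjI ballI)
    show "finite ((\<lambda>(r, s). r + s) ` (R \<times> S))" using fin by simp
    show "(\<lambda>(r, s). r + s) ` (R \<times> S) \<subseteq> W" using W sub by auto
    fix w assume "w \<in> W"
    then obtain r where r: "r \<in> R" "w - r \<in> U" using R unfolding transversal_def by blast
    then obtain s where s: "s \<in> S" "w - r - s \<in> V" using S unfolding transversal_def by blast
    show "\<exists>!x. x \<in> (\<lambda>(r, s). r + s) ` (R \<times> S) \<and> w - x \<in> V"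
    proof (rule ex1I[of _ "r + s"])
      show "r + s \<in> (\<lambda>(r, s). r + s) ` (R \<times> S) \<and> w - (r + s) \<in> V"
        using r s by (auto simp: diff_diff_eq)
      fix x assume x: "x \<in> (\<lambda>(r, s). r + s) ` (R \<times> S) \<and> w - x \<in> V"
      then obtain r' s' where x': "x = r' + s'" "r' \<in> R" "s' \<in> S" by auto
      have "w - r' - s' \<in> U" using x x' V by (auto simp: diff_diff_eq)
      then have "(w - r' - s') + s' \<in> U" using x' sub U by blast
      then have "r = r'" using R r x' \<open>w \<in> W\<close> unfolding transversal_def by auto
      moreover have "s = s'" using S s r x x' \<open>r = r'\<close> unfolding transversal_def
        by (auto simp: diff_diff_eq)
      ultimately show "x = r + s" using x' by simp
    qed
  qed
qed

section \<open>Invariant measures\<close>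

context c1
begin

section \<open>Functions of bounded support invariant under a lattice\<close>

lemma schI:
  assumes "is_lattice X U" "is_lattice X W" "\<And>v. v \<notin> W \<Longrightarrow> f v = 0"
    "\<And>v u. v \<in> carr X \<Longrightarrow> u \<in> U \<Longrightarrow> f (v + u) = f v"
  shows "f \<in> sch X"
proof -
  obtain i j where "i \<in> idx X" "j \<in> idx X" "fil X i \<subseteq> U" "W \<subseteq> fil X j"
    using lattice_bounds[OF assms(1,2)] by metis
  then show ?thesis using assms(3,4) unfolding sch_def by blast
qed

text \<open>Besides invariance and support the inclusion U \<subseteq> K is arranged, since the
  normalized sums below are divided by the index of \<open>U\<close> in \<open>K\<close>.\<close>

lemma schE:
  assumes "f \<in> sch X" "is_lattice X K"
  obtains U W where "is_lattice X U" "is_lattice X W" "U \<subseteq> K" "K \<subseteq> W" "U \<subseteq> W"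
    "\<And>v. v \<notin> W \<Longrightarrow> f v = 0" "\<And>v u. v \<in> carr X \<Longrightarrow> u \<in> U \<Longrightarrow> f (v + u) = f v"
proof -
  obtain a b where ab: "a \<in> idx X" "b \<in> idx X" "\<And>v. v \<notin> fil X b \<Longrightarrow> f v = 0"
    "\<And>v u. v \<in> carr X \<Longrightarrow> u \<in> fil X a \<Longrightarrow> f (v + u) = f v"
    using assms(1) unfolding sch_def by blast
  obtain i where i: "i \<in> idx X" "fil X i \<subseteq> fil X a" "fil X i \<subseteq> K"
    using lattice_bounds[OF lattice_fil[OF ab(1)] assms(2)] by metis
  obtain j where j: "j \<in> idx X" "fil X b \<subseteq> fil X j" "K \<subseteq> fil X j"
    using lattice_bounds[OF lattice_fil[OF ab(2)] assms(2)] by metis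
  show ?thesis
    by (rule that[OF lattice_fil[OF i(1)] lattice_fil[OF j(1)]]) (use i j ab in blast)+
qed

lemma sch_two:
  assumes "f \<in> sch X" "g \<in> sch X" "is_lattice X K"
  obtains U W where "is_lattice X U" "is_lattice X W" "U \<subseteq> K" "K \<subseteq> W" "U \<subseteq> W"
    "\<And>v. v \<notin> W \<Longrightarrow> f v = 0" "\<And>v u. v \<in> carr X \<Longrightarrow> u \<in> U \<Longrightarrow> f (v + u) = f v"
    "\<And>v. v \<notin> W \<Longrightarrow> g v = 0" "\<And>v u. v \<in> carr X \<Longrightarrow> u \<in> U \<Longrightarrow> g (v + u) = g v"
proof -
  obtain U W where f: "is_lattice X U" "is_lattice X W" "U \<subseteq> K" "K \<subseteq> W" "U \<subseteq> W"
    "\<And>v. v \<notin> W \<Longrightarrow> f v = 0" "\<And>v u. v \<in> carr X \<Longrightarrow> u \<in> U \<Longrightarrow> f (v + u) = f v"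
    using schE[OF assms(1,3)] by metis
  obtain V Y where g: "is_lattice X V" "is_lattice X Y" "V \<subseteq> U" "V \<subseteq> Y"
    "\<And>v. v \<notin> Y \<Longrightarrow> g v = 0" "\<And>v u. v \<in> carr X \<Longrightarrow> u \<in> V \<Longrightarrow> g (v + u) = g v"
    using schE[OF assms(2) f(1)] by metis
  obtain j where j: "j \<in> idx X" "W \<subseteq> fil X j" "Y \<subseteq> fil X j"
    using lattice_bounds[OF f(2) g(2)] by metis
  show ?thesis
    by (rule that[OF g(1) lattice_fil[OF j(1)]]) (use f g j in blast)+
qed

lemma is_lattice_ex: "\<exists>K. is_lattice X K"
  using ex_idx lattice_fil by blast

lemma sch_add: "f \<in> sch X \<Longrightarrow> g \<in> sch X \<Longrightarrow> (\<lambda>v. f v + g v) \<in> sch X"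
proof -
  assume fg: "f \<in> sch X" "g \<in> sch X"
  obtain K where K: "is_lattice X K" using is_lattice_ex by blast
  obtain U W where UW: "is_lattice X U" "is_lattice X W" "U \<subseteq> K" "K \<subseteq> W" "U \<subseteq> W"
    "\<And>v. v \<notin> W \<Longrightarrow> f v = 0" "\<And>v u. v \<in> carr X \<Longrightarrow> u \<in> U \<Longrightarrow> f (v + u) = f v"
    "\<And>v. v \<notin> W \<Longrightarrow> g v = 0" "\<And>v u. v \<in> carr X \<Longrightarrow> u \<in> U \<Longrightarrow> g (v + u) = g v"
    by (fact sch_two[OF fg K])
  show ?thesis by (rule schI[OF UW(1,2)]) (simp_all add: UW(6-))
qed

lemma sch_scale: "f \<in> sch X \<Longrightarrow> (\<lambda>v. c * f v) \<in> sch X"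
  unfolding sch_def mem_Collect_eq by (metis mult_zero_right)

lemma sch_zero: "(\<lambda>v. 0) \<in> sch X"
  using ex_idx unfolding sch_def by blast

lemma sch_sum: "(\<And>r. r \<in> R \<Longrightarrow> g r \<in> sch X) \<Longrightarrow> (\<lambda>v. \<Sum>r\<in>R. g r v) \<in> sch X"
proof (induction R rule: infinite_finite_induct)
  case (insert r R)
  have "(\<lambda>v. g r v + (\<Sum>r\<in>R. g r v)) \<in> sch X"
    by (rule sch_add) (use insert in auto)
  then show ?case using insert.hyps by simp
qed (simp_all add: sch_zero)

lemma lattice_translate: "is_lattice X W \<Longrightarrow> a \<in> W \<Longrightarrow> v + a \<in> W \<longleftrightarrow> v \<in> W"
  using subspace_add[of W v a] subspace_diff[of W "v + a" a] lattice_subspace[of W] by auto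

lemma sch_translate:
  assumes "f \<in> sch X" "a \<in> carr X"
  shows "(\<lambda>v. f (v + a)) \<in> sch X"
proof -
  obtain k where k: "k \<in> idx X" "a \<in> fil X k" using assms(2) UN_fil by blast
  obtain U W where f: "is_lattice X U" "is_lattice X W" "fil X k \<subseteq> W"
    "\<And>v. v \<notin> W \<Longrightarrow> f v = 0" "\<And>v u. v \<in> carr X \<Longrightarrow> u \<in> U \<Longrightarrow> f (v + u) = f v"
    using schE[OF assms(1) lattice_fil[OF k(1)]] by metis
  show ?thesis
  proof (rule schI[OF f(1,2)])
    show "f (v + a) = 0" if "v \<notin> W" for v
      using that f(3,4) k lattice_translate[OF f(2), of a v] by blast
    show "f (v + u + a) = f (v + a)" if "v \<in> carr X" "u \<in> U" for v u
      using f(5)[of "v + a" u] that assms(2) subspace_add[OF subspace_carr] by (simp add: ac_simps)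
  qed
qed

lemma sch_indicator: "is_lattice X U \<Longrightarrow> indicator U \<in> sch X"
  by (rule schI[of U U]) (auto simp: indicator_def lattice_translate)

section \<open>Invariant functionals are determined by the mass of one lattice\<close>

lemma meas_add: "m \<in> meas X \<Longrightarrow> f \<in> sch X \<Longrightarrow> g \<in> sch X \<Longrightarrow> m (\<lambda>v. f v + g v) = m f + m g"
  by (simp add: meas_def plus_fun_def)

text \<open>Functionals in \<open>meas X\<close> vanish off \<open>sch X\<close>, and scaling by a
  nonzero constant preserves membership in both directions. Hence \<open>f\<close> may be arbitrary,
  which spares membership conditions in the later rewriting of pushforwards and Fourier
  transforms.\<close>

lemma meas_scale:
  assumes "m \<in> meas X"
  shows "m (\<lambda>v. c * f v) = c * m f"
proof (cases "f \<in> sch X")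
  case False
  show ?thesis
  proof (cases "c = 0")
    case True
    have "\<forall>c. \<forall>f\<in>sch X. m (\<lambda>v. c * f v) = c * m f" using assms by (simp add: meas_def)
    from this[rule_format, OF sch_zero, of 0] show ?thesis using True by simp
  next
    case c: False
    have "(\<lambda>v. c * f v) \<notin> sch X" using sch_scale[of "\<lambda>v. c * f v" "1 / c"] False c by auto
    then show ?thesis using False assms by (simp add: meas_def)
  qed
qed (use assms in \<open>simp add: meas_def\<close>)

lemma meas_translate:
  assumes "m \<in> meas X" "a \<in> carr X"
  shows "m (\<lambda>v. f (v + a)) = m f"
proof (cases "f \<in> sch X")
  case False
  have "(\<lambda>v. f (v + a)) \<notin> sch X"
    using sch_translate[of "\<lambda>v. f (v + a)" "- a"] False assms subspace_neg[OF subspace_carr] by auto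
  then show ?thesis using False assms by (simp add: meas_def)
qed (use assms in \<open>simp add: meas_def\<close>)

lemma meas_zero: "m \<in> meas X \<Longrightarrow> m (\<lambda>v. 0) = 0"
  using meas_scale[of m 0 "\<lambda>v. 0"] by simp

lemma meas_sum:
  "m \<in> meas X \<Longrightarrow> (\<And>r. r \<in> R \<Longrightarrow> g r \<in> sch X) \<Longrightarrow> m (\<lambda>v. \<Sum>r\<in>R. g r v) = (\<Sum>r\<in>R. m (g r))"
proof (induction R rule: infinite_finite_induct)
  case (insert r R)
  have "m (\<lambda>v. g r v + (\<Sum>r\<in>R. g r v)) = m (g r) + m (\<lambda>v. \<Sum>r\<in>R. g r v)"
    by (rule meas_add) (use insert in \<open>auto intro: sch_sum\<close>)
  then show ?case using insert by simp
qed (simp_all add: meas_zero)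

text \<open>The function is the finite sum over \<open>r\<close> in \<open>R\<close> of
  \<open>f r\<close> times the indicator of the coset r + U, and by translation invariance all these
  cosets have the mass of \<open>U\<close>.\<close>

lemma meas_transversal:
  assumes m: "m \<in> meas X" and U: "is_lattice X U" and W: "is_lattice X W"
    and R: "transversal U W R"
    and f: "\<And>v. v \<notin> W \<Longrightarrow> f v = 0" "\<And>v u. v \<in> carr X \<Longrightarrow> u \<in> U \<Longrightarrow> f (v + u) = f v"
  shows "m f = sum f R * mass m U"
proof -
  have RW: "R \<subseteq> W" "finite R" using R by (auto simp: transversal_def)
  have RX: "R \<subseteq> carr X" using RW lattice_subset_carr[OF W] by blast
  have neg: "- r \<in> carr X" if "r \<in> R" for r
    using that RX subspace_neg[OF subspace_carr] by blast
  let ?g = "\<lambda>r v. f r * indicator U (v + - r)"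
  have eq: "f v = (\<Sum>r\<in>R. ?g r v)" for v
  proof (cases "v \<in> W")
    case True
    then obtain r where r: "r \<in> R" "v - r \<in> U" "\<And>s. s \<in> R \<Longrightarrow> v - s \<in> U \<Longrightarrow> s = r"
      using R unfolding transversal_def by blast
    have "(\<Sum>r\<in>R. ?g r v) = (\<Sum>s\<in>R. if s = r then f r else 0)"
    proof (rule sum.cong[OF refl])
      fix s assume s: "s \<in> R"
      show "?g s v = (if s = r then f r else 0)"
      proof (cases "s = r")
        case False
        then have "v + - s \<notin> U" using r(3)[OF s] by auto
        then show ?thesis using False by simp
      qed (use r(2) in simp)
    qed
    also have "\<dots> = f r" using r(1) RW(2) by simp
    also have "\<dots> = f v" using f(2)[OF _ r(2), of r] RX r(1) by auto
    finally show ?thesis by simp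
  next
    case False
    \<comment> \<open>If \<open>v\<close> lies in the coset of \<open>r\<close>, invariance gives f
      r = f v, which vanishes outside \<open>W\<close>; otherwise the indicator vanishes.\<close>
    have "?g r v = 0" if "r \<in> R" for r
    proof (cases "v - r \<in> U")
      case True
      then have vr: "v - r \<in> carr X" using lattice_subset_carr[OF U] by blast
      have "- (v - r) \<in> U" by (rule subspace_neg[OF lattice_subspace[OF U] True])
      then have "f (v + - (v - r)) = f v"
        using f(2)[of v "- (v - r)"] subspace_add[OF subspace_carr vr, of r] that RX by auto
      then show ?thesis using f(1)[OF False] by simp
    qed (simp add: indicator_def)
    then have "(\<Sum>r\<in>R. ?g r v) = 0" by (rule sum.neutral[OF ballI])
    then show ?thesis using f(1)[OF False] by simp
  qed
  have "m f = m (\<lambda>v. \<Sum>r\<in>R. ?g r v)" by (rule arg_cong[of _ _ m]) (use eq in blast)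
  also have "\<dots> = (\<Sum>r\<in>R. m (?g r))"
    by (rule meas_sum[OF m], rule sch_scale, rule sch_translate) (use U neg sch_indicator in auto)
  also have "\<dots> = (\<Sum>r\<in>R. f r * mass m U)"
    by (rule sum.cong[OF refl]) (simp only: meas_scale[OF m] meas_translate[OF m neg] mass_def)
  finally show ?thesis by (simp add: sum_distrib_right)
qed

lemma mass_transversal:
  assumes "m \<in> meas X" "is_lattice X U" "is_lattice X W" "U \<subseteq> W" "transversal U W R"
  shows "mass m W = of_nat (card R) * mass m U"
proof -
  have R: "R \<subseteq> W" using assms by (simp add: transversal_def)
  have "m (indicator W) = sum (indicator W) R * mass m U"
    by (rule meas_transversal[OF assms(1,2,3,5)])
      (use assms lattice_translate[OF assms(3)] in \<open>auto simp: indicator_def\<close>)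
  also have "sum (indicator W) R = (\<Sum>r\<in>R. 1 :: complex)"
    by (rule sum.cong) (use R in auto)
  finally show ?thesis by (simp add: mass_def)
qed

lemma transversal_card_pos:
  assumes "transversal U W R" "is_lattice X W"
  shows "card R > 0"
proof -
  have "0 \<in> W" using subspace_0[OF lattice_subspace[OF assms(2)]] .
  then show ?thesis using assms(1) by (auto simp: transversal_def card_gt_0_iff)
qed

text \<open>The mass of \<open>K\<close> is a positive integer times the mass of any smaller
  lattice, so these vanish too, and with them all finite sums that express integrals. Applied to
  differences this gives uniqueness of the invariant measure.\<close>

lemma meas_eq_0:
  assumes m: "m \<in> meas X" and K: "is_lattice X K" "mass m K = 0"
  shows "m f = 0"
proof (cases "f \<in> sch X")
  case True
  obtain U W where f: "is_lattice X U" "is_lattice X W" "U \<subseteq> K"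
    "\<And>v. v \<notin> W \<Longrightarrow> f v = 0" "\<And>v u. v \<in> carr X \<Longrightarrow> u \<in> U \<Longrightarrow> f (v + u) = f v"
    using schE[OF True K(1)] by metis
  obtain R where R: "transversal U W R" using transversal_exists[OF f(1,2)] by blast
  obtain S where S: "transversal U K S" using transversal_exists[OF f(1) K(1)] by blast
  have "mass m U = 0"
    using mass_transversal[OF m f(1) K(1) f(3) S] K(2) transversal_card_pos[OF S K(1)] by simp
  then show ?thesis using meas_transversal[OF m f(1,2) R f(4,5)] by simp
qed (use m in \<open>simp add: meas_def\<close>)

lemma meas_lin:
  assumes "m \<in> meas X" "n \<in> meas X"
  shows "(\<lambda>f. c * m f + d * n f) \<in> meas X"
  unfolding meas_def mem_Collect_eq
proof (intro conjI ballI allI impI)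
  fix f g a b assume "f \<in> sch X" "g \<in> sch X"
  then show "c * m (f + g) + d * n (f + g) = c * m f + d * n f + (c * m g + d * n g)"
    using meas_add[OF assms(1)] meas_add[OF assms(2)] by (simp add: plus_fun_def algebra_simps)
next
  fix f a b
  show "c * m (\<lambda>v. b * f v) + d * n (\<lambda>v. b * f v) = b * (c * m f + d * n f)"
    by (simp add: meas_scale[OF assms(1)] meas_scale[OF assms(2)] algebra_simps)
next
  fix f a assume "a \<in> carr X"
  then show "c * m (\<lambda>v. f (v + a)) + d * n (\<lambda>v. f (v + a)) = c * m f + d * n f"
    using meas_translate[OF assms(1)] meas_translate[OF assms(2)] by metis
next
  fix f assume "f \<notin> sch X"
  then show "c * m f + d * n f = 0" using assms by (simp add: meas_def)
qed

lemma meas_smult: "m \<in> meas X \<Longrightarrow> (\<lambda>f. c * m f) \<in> meas X"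
  using meas_lin[of m m c 0] by simp

lemma meas_eqI:
  assumes "m \<in> meas X" "n \<in> meas X" "is_lattice X K" "mass m K = mass n K"
  shows "m = n"
proof
  fix f
  show "m f = n f"
    using meas_eq_0[OF meas_lin[OF assms(1,2), of 1 "-1"] assms(3), of f] assms(4)
    by (simp add: mass_def)
qed

section \<open>Existence of the invariant measure\<close>

text \<open>A sum over \<open>W/U\<close>, divided by the order of \<open>K/U\<close> so that \<open>K\<close> gets mass \<open>1\<close>.\<close>

definition riemann :: "'v set \<Rightarrow> ('v \<Rightarrow> complex) \<Rightarrow> complex \<Rightarrow> bool" where
  "riemann K f z \<longleftrightarrow> (\<exists>U W R S. is_lattice X U \<and> is_lattice X W \<and> U \<subseteq> W \<and> U \<subseteq> K \<and>
     (\<forall>v. v \<notin> W \<longrightarrow> f v = 0) \<and> (\<forall>v\<in>carr X. \<forall>u\<in>U. f (v + u) = f v) \<and>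
     transversal U W R \<and> transversal U K S \<and> z = sum f R / of_nat (card S))"

lemma transversal_sum_lattice:
  assumes "is_lattice X U" "is_lattice X W" "transversal U W R" "transversal U W S"
    "\<And>v u. v \<in> carr X \<Longrightarrow> u \<in> U \<Longrightarrow> f (v + u) = (f v :: complex)"
  shows "sum f R = sum f S"
proof (rule transversal_sum_eq[OF assms(3,4)])
  show "- u \<in> U" if "u \<in> U" for u using that by (rule subspace_neg[OF lattice_subspace[OF assms(1)]])
  show "f (v + u) = f v" if "v \<in> W" "u \<in> U" for v u
    using that assms(5) lattice_subset_carr[OF assms(2)] by blast
qed

text \<open>A coset of \<open>U\<close> splits into \<open>card S\<close> cosets of
  \<open>V\<close>, and \<open>f\<close> takes one value on all of them.\<close>

lemma transversal_refine:
  assumes U: "is_lattice X U" and W: "is_lattice X W" and V: "is_lattice X V"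
    and sub: "V \<subseteq> U" "U \<subseteq> W"
    and R: "transversal U W R" and S: "transversal V U S" and Q: "transversal V W Q"
    and f: "\<And>v u. v \<in> carr X \<Longrightarrow> u \<in> U \<Longrightarrow> f (v + u) = (f v :: complex)"
  shows "sum f Q = of_nat (card S) * sum f R"
proof -
  note Us = lattice_subspace[OF U] and Ws = lattice_subspace[OF W] and Vs = lattice_subspace[OF V]
  let ?Q = "(\<lambda>(r, s). r + s) ` (R \<times> S)"
  have T: "transversal V W ?Q" "inj_on (\<lambda>(r, s). r + s) (R \<times> S)"
    by (rule transversal_tower[OF R S],
        use sub Us Vs Ws in \<open>auto simp: subspace_0 subspace_diff subspace_add subset_iff\<close>)+
  have RX: "R \<subseteq> carr X" "S \<subseteq> U"
    using R S lattice_subset_carr[OF W] by (auto simp: transversal_def)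
  have "sum f Q = sum f ?Q"
    by (rule transversal_sum_lattice[OF V W Q T(1)]) (use f sub in blast)
  also have "\<dots> = (\<Sum>(r, s)\<in>R \<times> S. f (r + s))"
    using T(2) by (simp add: sum.reindex case_prod_unfold)
  also have "\<dots> = (\<Sum>(r, s)\<in>R \<times> S. f r)"
    by (rule sum.cong) (use f RX in auto)
  also have "\<dots> = of_nat (card S) * sum f R"
    by (simp flip: sum.cartesian_product add: sum_distrib_left)
  finally show ?thesis .
qed

text \<open>Passing from \<open>U\<close> to \<open>V\<close> multiplies numerator and denominator
  by the same index, and enlarging \<open>W\<close> to \<open>Y\<close> only adds zeros.\<close>

lemma riemann_refine:
  assumes U: "is_lattice X U" and W: "is_lattice X W" and V: "is_lattice X V" and Y: "is_lattice X Y"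
    and K: "is_lattice X K"
    and sub: "V \<subseteq> U" "U \<subseteq> W" "U \<subseteq> K" "W \<subseteq> Y"
    and f: "\<And>v. v \<notin> W \<Longrightarrow> f v = (0 :: complex)"
      "\<And>v u. v \<in> carr X \<Longrightarrow> u \<in> U \<Longrightarrow> f (v + u) = f v"
    and R: "transversal U W R" "transversal U K S"
    and Q: "transversal V Y Q" "transversal V K P"
  shows "sum f Q / of_nat (card P) = sum f R / of_nat (card S)"
proof -
  obtain A where A: "transversal V U A" using transversal_exists[OF V U] by blast
  have cA: "card A > 0" by (rule transversal_card_pos[OF A U])
  have P: "(\<Sum>p\<in>P. 1 :: complex) = of_nat (card A) * (\<Sum>s\<in>S. 1)"
    by (rule transversal_refine[OF U K V sub(1,3) R(2) A Q(2)]) simp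
  \<comment> \<open>Since V \<subseteq> W, the representative of an element of \<open>W\<close> lies
    in \<open>W\<close> itself, so the part of \<open>Q\<close> inside \<open>W\<close> represents
    W/V.\<close>
  have Q': "transversal V W (Q \<inter> W)"
    unfolding transversal_def
  proof (intro conjI ballI)
    fix w assume w: "w \<in> W"
    then obtain r where r: "r \<in> Q" "w - r \<in> V" "\<And>s. s \<in> Q \<Longrightarrow> w - s \<in> V \<Longrightarrow> s = r"
      using Q(1) sub(4) unfolding transversal_def by blast
    have "w - (w - r) \<in> W"
      by (rule subspace_diff[OF lattice_subspace[OF W] w]) (use r sub in blast)
    then have "r \<in> Q \<inter> W \<and> w - r \<in> V" using r(1,2) by simp
    then show "\<exists>!r. r \<in> Q \<inter> W \<and> w - r \<in> V" by (rule ex1I) (use r(3) in blast)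
  qed (use Q(1) in \<open>auto simp: transversal_def\<close>)
  have "sum f Q = sum f (Q \<inter> W)"
    using Q(1) f(1) by (intro sum.mono_neutral_right) (auto simp: transversal_def)
  also have "\<dots> = of_nat (card A) * sum f R"
    by (rule transversal_refine[OF U W V sub(1,2) R(1) A Q' f(2)])
  finally show ?thesis using P cA by simp
qed

lemma riemann_unique:
  assumes "riemann K f z" "riemann K f z'" and K: "is_lattice X K"
  shows "z = z'"
proof -
  obtain U W R S where 1: "is_lattice X U" "is_lattice X W" "U \<subseteq> W" "U \<subseteq> K"
    "\<And>v. v \<notin> W \<Longrightarrow> f v = 0" "\<And>v u. v \<in> carr X \<Longrightarrow> u \<in> U \<Longrightarrow> f (v + u) = f v"
    "transversal U W R" "transversal U K S" "z = sum f R / of_nat (card S)"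
    using assms(1) unfolding riemann_def by blast
  obtain U' W' R' S' where 2: "is_lattice X U'" "is_lattice X W'" "U' \<subseteq> W'" "U' \<subseteq> K"
    "\<And>v. v \<notin> W' \<Longrightarrow> f v = 0" "\<And>v u. v \<in> carr X \<Longrightarrow> u \<in> U' \<Longrightarrow> f (v + u) = f v"
    "transversal U' W' R'" "transversal U' K S'" "z' = sum f R' / of_nat (card S')"
    using assms(2) unfolding riemann_def by blast
  \<comment> \<open>The two sums are compared through a common refinement: one filtration member
    inside both invariance lattices and one containing both supports.\<close>
  obtain i where i: "i \<in> idx X" "fil X i \<subseteq> U" "fil X i \<subseteq> U'"
    using lattice_bounds[OF 1(1) 2(1)] by metis
  obtain j where j: "j \<in> idx X" "W \<subseteq> fil X j" "W' \<subseteq> fil X j"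
    using lattice_bounds[OF 1(2) 2(2)] by metis
  note V = lattice_fil[OF i(1)] and Y = lattice_fil[OF j(1)]
  obtain Q where Q: "transversal (fil X i) (fil X j) Q" using transversal_exists[OF V Y] by blast
  obtain P where P: "transversal (fil X i) K P" using transversal_exists[OF V K] by blast
  show ?thesis
    using riemann_refine[OF 1(1,2) V Y K i(2) 1(3,4) j(2) 1(5,6,7,8) Q P]
      riemann_refine[OF 2(1,2) V Y K i(3) 2(3,4) j(3) 2(5,6,7,8) Q P] 1(9) 2(9) by simp
qed

text \<open>The value 0 off \<open>sch X\<close> is the convention built into
  \<open>meas\<close>.\<close>

definition haar_int :: "'v set \<Rightarrow> ('v \<Rightarrow> complex) \<Rightarrow> complex" where
  "haar_int K f = (if f \<in> sch X then (THE z. riemann K f z) else 0)"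

lemma haar_int_eq:
  assumes K: "is_lattice X K" and U: "is_lattice X U" and W: "is_lattice X W"
    and sub: "U \<subseteq> W" "U \<subseteq> K"
    and f: "\<And>v. v \<notin> W \<Longrightarrow> f v = 0" "\<And>v u. v \<in> carr X \<Longrightarrow> u \<in> U \<Longrightarrow> f (v + u) = f v"
    and R: "transversal U W R" "transversal U K S"
  shows "haar_int K f = sum f R / of_nat (card S)"
proof -
  have "riemann K f (sum f R / of_nat (card S))"
    unfolding riemann_def using U W sub f R by blast
  then have "(THE z. riemann K f z) = sum f R / of_nat (card S)"
    using riemann_unique[OF _ _ K] by blast
  moreover have "f \<in> sch X" by (rule schI[OF U W f])
  ultimately show ?thesis by (simp add: haar_int_def)
qed

lemma haar_int_add:
  assumes K: "is_lattice X K" and fg: "f \<in> sch X" "g \<in> sch X"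
  shows "haar_int K (f + g) = haar_int K f + haar_int K g"
proof -
  obtain U W where UW: "is_lattice X U" "is_lattice X W" "U \<subseteq> K" "K \<subseteq> W" "U \<subseteq> W"
    "\<And>v. v \<notin> W \<Longrightarrow> f v = 0" "\<And>v u. v \<in> carr X \<Longrightarrow> u \<in> U \<Longrightarrow> f (v + u) = f v"
    "\<And>v. v \<notin> W \<Longrightarrow> g v = 0" "\<And>v u. v \<in> carr X \<Longrightarrow> u \<in> U \<Longrightarrow> g (v + u) = g v"
    by (fact sch_two[OF fg K])
  obtain R where R: "transversal U W R" using transversal_exists[OF UW(1,2)] by blast
  obtain S where S: "transversal U K S" using transversal_exists[OF UW(1) K] by blast
  have "haar_int K (f + g) = sum (f + g) R / of_nat (card S)"
    by (rule haar_int_eq[OF K UW(1,2,5,3) _ _ R S]) (simp_all add: UW(6-9))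
  moreover have "haar_int K f = sum f R / of_nat (card S)"
    by (rule haar_int_eq[OF K UW(1,2,5,3) UW(6,7) R S])
  moreover have "haar_int K g = sum g R / of_nat (card S)"
    by (rule haar_int_eq[OF K UW(1,2,5,3) UW(8,9) R S])
  ultimately show ?thesis by (simp add: sum.distrib add_divide_distrib)
qed

lemma haar_int_scale:
  assumes K: "is_lattice X K" and f: "f \<in> sch X"
  shows "haar_int K (\<lambda>v. c * f v) = c * haar_int K f"
proof -
  obtain U W where UW: "is_lattice X U" "is_lattice X W" "U \<subseteq> K" "K \<subseteq> W" "U \<subseteq> W"
    "\<And>v. v \<notin> W \<Longrightarrow> f v = 0" "\<And>v u. v \<in> carr X \<Longrightarrow> u \<in> U \<Longrightarrow> f (v + u) = f v"
    by (fact schE[OF f K])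
  obtain R where R: "transversal U W R" using transversal_exists[OF UW(1,2)] by blast
  obtain S where S: "transversal U K S" using transversal_exists[OF UW(1) K] by blast
  have "haar_int K (\<lambda>v. c * f v) = (\<Sum>v\<in>R. c * f v) / of_nat (card S)"
    by (rule haar_int_eq[OF K UW(1,2,5,3) _ _ R S]) (simp_all add: UW(6,7))
  moreover have "haar_int K f = sum f R / of_nat (card S)"
    by (rule haar_int_eq[OF K UW(1,2,5,3) UW(6,7) R S])
  ultimately show ?thesis by (simp add: sum_distrib_left)
qed

lemma haar_int_translate:
  assumes K: "is_lattice X K" and f: "f \<in> sch X" and a: "a \<in> carr X"
  shows "haar_int K (\<lambda>v. f (v + a)) = haar_int K f"
proof -
  obtain U Y where UY: "is_lattice X U" "is_lattice X Y" "U \<subseteq> K" "K \<subseteq> Y" "U \<subseteq> Y"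
    "\<And>v. v \<notin> Y \<Longrightarrow> f v = 0" "\<And>v u. v \<in> carr X \<Longrightarrow> u \<in> U \<Longrightarrow> f (v + u) = f v"
    by (fact schE[OF f K])
  obtain k where k: "k \<in> idx X" "a \<in> fil X k" using a UN_fil by blast
  \<comment> \<open>The support is enlarged so as to contain \<open>a\<close>; translation by
    \<open>a\<close> then permutes it and carries transversals to transversals.\<close>
  obtain j where j: "j \<in> idx X" "fil X k \<subseteq> fil X j" "Y \<subseteq> fil X j"
    using lattice_bounds[OF lattice_fil[OF k(1)] UY(2)] by metis
  let ?W = "fil X j"
  note W = lattice_fil[OF j(1)]
  have aW: "a \<in> ?W" using k j by blast
  have UW: "U \<subseteq> ?W" using UY j by blast
  have fW: "f v = 0" if "v \<notin> ?W" for v using that UY(6) j by blast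
  obtain R where R: "transversal U ?W R" using transversal_exists[OF UY(1) W] by blast
  obtain S where S: "transversal U K S" using transversal_exists[OF UY(1) K] by blast
  have R': "transversal U ?W ((\<lambda>v. v + a) ` R)"
    unfolding transversal_def
  proof (intro conjI ballI)
    fix w assume "w \<in> ?W"
    then have "w - a \<in> ?W" by (rule subspace_diff[OF lattice_subspace[OF W] _ aW])
    then obtain r where r: "r \<in> R" "w - a - r \<in> U" "\<And>s. s \<in> R \<Longrightarrow> w - a - s \<in> U \<Longrightarrow> s = r"
      using R unfolding transversal_def by blast
    show "\<exists>!r. r \<in> (\<lambda>v. v + a) ` R \<and> w - r \<in> U"
    proof (rule ex1I[of _ "r + a"])
      show "r + a \<in> (\<lambda>v. v + a) ` R \<and> w - (r + a) \<in> U"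
        using r(1,2) by (simp add: algebra_simps)
      fix x assume "x \<in> (\<lambda>v. v + a) ` R \<and> w - x \<in> U"
      then obtain s where s: "s \<in> R" "x = s + a" "w - (s + a) \<in> U" by blast
      then have "w - a - s \<in> U" by (simp add: algebra_simps)
      then show "x = r + a" using r(3) s by blast
    qed
  qed (use R aW in \<open>auto simp: transversal_def lattice_translate[OF W]\<close>)
  have "haar_int K (\<lambda>v. f (v + a)) = (\<Sum>v\<in>R. f (v + a)) / of_nat (card S)"
  proof (rule haar_int_eq[OF K UY(1) W UW UY(3) _ _ R S])
    show "f (v + a) = 0" if "v \<notin> ?W" for v using that fW lattice_translate[OF W aW] by blast
    show "f (v + u + a) = f (v + a)" if "v \<in> carr X" "u \<in> U" for v u
      using UY(7)[of "v + a" u] that a subspace_add[OF subspace_carr] by (simp add: ac_simps)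
  qed
  also have "(\<Sum>v\<in>R. f (v + a)) = sum f ((\<lambda>v. v + a) ` R)"
    by (simp add: sum.reindex inj_on_def)
  also have "\<dots> / of_nat (card S) = haar_int K f"
    by (rule haar_int_eq[OF K UY(1) W UW UY(3) fW UY(7) R' S, symmetric])
  finally show ?thesis .
qed

lemma haar_int_meas: "is_lattice X K \<Longrightarrow> haar_int K \<in> meas X"
  unfolding meas_def
  by (simp add: haar_int_add haar_int_scale haar_int_translate) (simp add: haar_int_def)

lemma haar_int_mass:
  assumes K: "is_lattice X K"
  shows "mass (haar_int K) K = 1"
proof -
  have T: "transversal K K {0}"
    using subspace_0[OF lattice_subspace[OF K]] by (auto simp: transversal_def)
  have "haar_int K (indicator K) = sum (indicator K) {0} / of_nat (card {0 :: 'v})"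
    by (rule haar_int_eq[OF K K K _ _ _ _ T T]) (auto simp: indicator_def lattice_translate[OF K])
  then show ?thesis using subspace_0[OF lattice_subspace[OF K]] by (simp add: mass_def)
qed

text \<open>Existence is given by the normalized sums, uniqueness by the fact that the mass of one
  lattice determines an invariant functional.\<close>

lemma haar:
  assumes "is_lattice X K"
  shows "haar X K \<in> meas X" "mass (haar X K) K = 1"
proof -
  have "\<exists>!m. m \<in> meas X \<and> mass m K = 1"
    using haar_int_meas[OF assms] haar_int_mass[OF assms] meas_eqI[OF _ _ assms] by metis
  from theI'[OF this] show "haar X K \<in> meas X" "mass (haar X K) K = 1"
    by (simp_all add: haar_def)
qed

lemma mass_smult: "mass (\<lambda>f. c * m f) A = c * mass m A"
  by (simp add: mass_def)

lemma meas_haar: "is_lattice X K \<Longrightarrow> m \<in> meas X \<Longrightarrow> m = (\<lambda>f. mass m K * haar X K f)"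
  by (rule meas_eqI[of _ _ K]) (simp_all add: meas_smult haar mass_smult)

end

section \<open>Exact triples of \<open>C\<^sub>1\<close>-spaces\<close>

text \<open>Admissibility in terms of lattices: domination is relaxed to preimages and images being
  lattices, cofinal with the filtrations from below and from above. This form passes to the dual
  triple by exchanging the conditions in pairs.\<close>

locale c1_exact =
  fixes X1 :: "('f :: {field, finite}, 'v1 :: ab_group_add, 'i1) filtered"
    and X2 :: "('f, 'v2 :: ab_group_add, 'i2) filtered"
    and X3 :: "('f, 'v3 :: ab_group_add, 'i3) filtered"
    and \<alpha> :: "'v1 \<Rightarrow> 'v2" and \<beta> :: "'v2 \<Rightarrow> 'v3"
  assumes c1s: "c1_space X1" "c1_space X2" "c1_space X3"
    and exact: "short_exact X1 X2 X3 \<alpha> \<beta>"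
    and pre_fil: "\<And>j. j \<in> idx X2 \<Longrightarrow> is_lattice X1 {v \<in> carr X1. \<alpha> v \<in> fil X2 j}"
    and img_fil: "\<And>j. j \<in> idx X2 \<Longrightarrow> is_lattice X3 (\<beta> ` fil X2 j)"
    and pre_below: "\<And>i. i \<in> idx X1 \<Longrightarrow> \<exists>j\<in>idx X2. {v \<in> carr X1. \<alpha> v \<in> fil X2 j} \<subseteq> fil X1 i"
    and pre_above: "\<And>i. i \<in> idx X1 \<Longrightarrow> \<exists>j\<in>idx X2. \<alpha> ` fil X1 i \<subseteq> fil X2 j"
    and img_below: "\<And>i. i \<in> idx X3 \<Longrightarrow> \<exists>j\<in>idx X2. \<beta> ` fil X2 j \<subseteq> fil X3 i"
    and img_above: "\<And>i. i \<in> idx X3 \<Longrightarrow> \<exists>j\<in>idx X2. fil X3 i \<subseteq> \<beta> ` fil X2 j"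

sublocale c1_exact \<subseteq> X1: c1 X1 by unfold_locales (fact c1s)
sublocale c1_exact \<subseteq> X2: c1 X2 by unfold_locales (fact c1s)
sublocale c1_exact \<subseteq> X3: c1 X3 by unfold_locales (fact c1s)

lemma admissible1_imp_c1_exact:
  assumes "admissible1 X1 X2 X3 \<alpha> \<beta>"
  shows "c1_exact X1 X2 X3 \<alpha> \<beta>"
proof -
  have c: "c1_space X1" "c1_space X2" "c1_space X3" and ex: "short_exact X1 X2 X3 \<alpha> \<beta>"
    and dom: "dominates X1 (sub_fil \<alpha> X1 X2)" "dominates X3 (img_fil \<beta> X3 X2)"
    using assms unfolding admissible1_def by blast+
  interpret X1: c1 X1 by unfold_locales (fact c)
  interpret X2: c1 X2 by unfold_locales (fact c)
  interpret X3: c1 X3 by unfold_locales (fact c)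
  obtain \<phi> where ph: "dominates_via \<phi> X1 (sub_fil \<alpha> X1 X2)" using dom unfolding dominates_def by blast
  obtain \<chi> where ch: "dominates_via \<chi> X3 (img_fil \<beta> X3 X2)" using dom unfolding dominates_def by blast
  have p: "\<phi> j \<in> idx X1 \<and> fil X1 (\<phi> j) = {v \<in> carr X1. \<alpha> v \<in> fil X2 j}" if "j \<in> idx X2" for j
    using ph that by (simp add: dominates_via_def sub_fil_def)
  have q: "\<chi> j \<in> idx X3 \<and> fil X3 (\<chi> j) = \<beta> ` fil X2 j" if "j \<in> idx X2" for j
    using ch that by (simp add: dominates_via_def img_fil_def)
  have p': "\<exists>j\<in>idx X2. \<exists>k\<in>idx X2. fil X1 (\<phi> j) \<subseteq> fil X1 i \<and> fil X1 i \<subseteq> fil X1 (\<phi> k)"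
    if "i \<in> idx X1" for i
  proof -
    have "\<exists>j\<in>idx X2. \<exists>k\<in>idx X2. ile X1 (\<phi> j) i \<and> ile X1 i (\<phi> k)"
      using ph that by (simp add: dominates_via_def sub_fil_def)
    then show ?thesis using X1.fil_mono by metis
  qed
  have q': "\<exists>j\<in>idx X2. \<exists>k\<in>idx X2. fil X3 (\<chi> j) \<subseteq> fil X3 i \<and> fil X3 i \<subseteq> fil X3 (\<chi> k)"
    if "i \<in> idx X3" for i
  proof -
    have "\<exists>j\<in>idx X2. \<exists>k\<in>idx X2. ile X3 (\<chi> j) i \<and> ile X3 i (\<chi> k)"
      using ch that by (simp add: dominates_via_def img_fil_def)
    then show ?thesis using X3.fil_mono by metis
  qed
  show ?thesis
  proof
    show "is_lattice X1 {v \<in> carr X1. \<alpha> v \<in> fil X2 j}" if "j \<in> idx X2" for j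
      using X1.lattice_fil[of "\<phi> j"] p[OF that] by simp
    show "is_lattice X3 (\<beta> ` fil X2 j)" if "j \<in> idx X2" for j
      using X3.lattice_fil[of "\<chi> j"] q[OF that] by simp
    show "\<exists>j\<in>idx X2. {v \<in> carr X1. \<alpha> v \<in> fil X2 j} \<subseteq> fil X1 i" if "i \<in> idx X1" for i
      using p'[OF that] p by blast
    show "\<exists>j\<in>idx X2. \<alpha> ` fil X1 i \<subseteq> fil X2 j" if "i \<in> idx X1" for i
      using p'[OF that] p by blast
    show "\<exists>j\<in>idx X2. \<beta> ` fil X2 j \<subseteq> fil X3 i" if "i \<in> idx X3" for i
      using q'[OF that] q by blast
    show "\<exists>j\<in>idx X2. fil X3 i \<subseteq> \<beta> ` fil X2 j" if "i \<in> idx X3" for i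
      using q'[OF that] q by blast
  qed (fact c ex)+
qed

lemma transversal_card:
  assumes "transversal U W R" "transversal U W S" "\<And>u. u \<in> U \<Longrightarrow> - u \<in> U"
  shows "card R = card S"
proof -
  have "(\<Sum>r\<in>R. 1 :: complex) = (\<Sum>r\<in>S. 1)"
    by (rule transversal_sum_eq[OF assms(1,2)]) (use assms(3) in auto)
  then show ?thesis by simp
qed

context c1_exact
begin

lemma \<alpha>_carr: "v \<in> carr X1 \<Longrightarrow> \<alpha> v \<in> carr X2"
  and \<beta>_carr: "w \<in> carr X2 \<Longrightarrow> \<beta> w \<in> carr X3"
  and \<alpha>_add: "v \<in> carr X1 \<Longrightarrow> v' \<in> carr X1 \<Longrightarrow> \<alpha> (v + v') = \<alpha> v + \<alpha> v'"
  and \<beta>_add: "w \<in> carr X2 \<Longrightarrow> w' \<in> carr X2 \<Longrightarrow> \<beta> (w + w') = \<beta> w + \<beta> w'"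
  and \<alpha>_scale: "v \<in> carr X1 \<Longrightarrow> \<alpha> (scl X1 c v) = scl X2 c (\<alpha> v)"
  and \<beta>_scale: "w \<in> carr X2 \<Longrightarrow> \<beta> (scl X2 c w) = scl X3 c (\<beta> w)"
  and \<alpha>_inj: "inj_on \<alpha> (carr X1)"
  and \<beta>_img: "\<beta> ` carr X2 = carr X3"
  and ker_\<beta>: "w \<in> carr X2 \<Longrightarrow> \<beta> w = 0 \<longleftrightarrow> w \<in> \<alpha> ` carr X1"
  using exact by (auto simp: short_exact_def lin_map_def)

lemma \<alpha>_0: "\<alpha> 0 = 0"
  using \<alpha>_add[of 0 0] X1.subspace_0[OF X1.subspace_carr] by simp

lemma \<beta>_0: "\<beta> 0 = 0"
  using \<beta>_add[of 0 0] X2.subspace_0[OF X2.subspace_carr] by simp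

lemma \<beta>_\<alpha>: "v \<in> carr X1 \<Longrightarrow> \<beta> (\<alpha> v) = 0"
  using ker_\<beta> \<alpha>_carr by blast

lemma \<alpha>_diff: "v \<in> carr X1 \<Longrightarrow> v' \<in> carr X1 \<Longrightarrow> \<alpha> (v - v') = \<alpha> v - \<alpha> v'"
  using \<alpha>_add[of "v - v'" v'] X1.subspace_diff[OF X1.subspace_carr] by simp

lemma \<beta>_diff: "v \<in> carr X2 \<Longrightarrow> v' \<in> carr X2 \<Longrightarrow> \<beta> (v - v') = \<beta> v - \<beta> v'"
  using \<beta>_add[of "v - v'" v'] X2.subspace_diff[OF X2.subspace_carr] by simp

abbreviation pre :: "'v2 set \<Rightarrow> 'v1 set" where
  "pre U \<equiv> {v \<in> carr X1. \<alpha> v \<in> U}"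

lemma pre_subspace: "X2.subspace U \<Longrightarrow> X1.subspace (pre U)"
  unfolding X1.subspace_def X2.subspace_def
  using X1.subspace_carr unfolding X1.subspace_def
  by (auto simp: \<alpha>_0 \<alpha>_add \<alpha>_scale)

lemma img_subspace: "X2.subspace U \<Longrightarrow> U \<subseteq> carr X2 \<Longrightarrow> X3.subspace (\<beta> ` U)"
proof -
  assume U: "X2.subspace U" "U \<subseteq> carr X2"
  show ?thesis
    unfolding X3.subspace_def
  proof (intro conjI ballI allI)
    show "0 \<in> \<beta> ` U" using X2.subspace_0[OF U(1)] \<beta>_0 by force
    fix x assume "x \<in> \<beta> ` U"
    then obtain u where u: "u \<in> U" "x = \<beta> u" by blast
    show "scl X3 c x \<in> \<beta> ` U" for c
      using u X2.subspace_scale[OF U(1) u(1), of c] \<beta>_scale[of u c] U(2) by (metis image_eqI subsetD)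
    fix y assume "y \<in> \<beta> ` U"
    then obtain w where w: "w \<in> U" "y = \<beta> w" by blast
    show "x + y \<in> \<beta> ` U"
      using u w X2.subspace_add[OF U(1) u(1) w(1)] \<beta>_add[of u w] U(2) by (metis image_eqI subsetD)
  qed
qed

lemma pre_lattice:
  assumes U: "is_lattice X2 U"
  shows "is_lattice X1 (pre U)"
proof -
  obtain i j where ij: "i \<in> idx X2" "j \<in> idx X2" "fil X2 i \<subseteq> U" "U \<subseteq> fil X2 j"
    using X2.lattice_bounds[OF U U] by metis
  show ?thesis
    by (rule X1.lattice_sandwich[OF pre_fil[OF ij(1)] pre_fil[OF ij(2)] pre_subspace])
      (use ij X2.lattice_subspace[OF U] in blast)+
qed

lemma img_lattice:
  assumes U: "is_lattice X2 U"
  shows "is_lattice X3 (\<beta> ` U)"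
proof -
  obtain i j where ij: "i \<in> idx X2" "j \<in> idx X2" "fil X2 i \<subseteq> U" "U \<subseteq> fil X2 j"
    using X2.lattice_bounds[OF U U] by metis
  show ?thesis
    by (rule X3.lattice_sandwich[OF img_fil[OF ij(1)] img_fil[OF ij(2)] img_subspace])
      (use ij X2.lattice_subspace[OF U] X2.lattice_subset_carr[OF U] in blast)+
qed

text \<open>The index of \<open>U\<close> in \<open>W\<close> is the index on the subspace times the
  index on the quotient: the sums of \<open>\<alpha> r\<close> and a lift of \<open>t\<close>
  represent W/U.\<close>

lemma transversal_exact:
  assumes U: "is_lattice X2 U" and W: "is_lattice X2 W" and UW: "U \<subseteq> W"
    and R: "transversal U W R" and R1: "transversal (pre U) (pre W) R1"
    and R3: "transversal (\<beta> ` U) (\<beta> ` W) R3"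
  shows "card R = card R1 * card R3"
proof -
  note Us = X2.lattice_subspace[OF U] and Ws = X2.lattice_subspace[OF W]
    and WX = X2.lattice_subset_carr[OF W]
  have sub: "R1 \<subseteq> pre W" "R3 \<subseteq> \<beta> ` W" "finite R1" "finite R3"
    using R1 R3 by (auto simp: transversal_def)
  \<comment> \<open>Lifts are taken inside \<open>W\<close>, so that the sums below stay in
    \<open>W\<close>.\<close>
  define s where "s = inv_into W \<beta>"
  have s: "s r \<in> W" "\<beta> (s r) = r" if "r \<in> R3" for r
    using that sub(2) by (auto simp: s_def f_inv_into_f intro: inv_into_into)
  let ?h = "\<lambda>(r, t). \<alpha> r + s t"
  have hW: "\<alpha> r + s t \<in> W" if "r \<in> R1" "t \<in> R3" for r t
    using that sub s by (intro X2.subspace_add[OF Ws]) auto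
  have h\<beta>: "\<beta> (\<alpha> r + s t) = t" if "r \<in> R1" "t \<in> R3" for r t
  proof -
    have "\<beta> (\<alpha> r + s t) = \<beta> (\<alpha> r) + \<beta> (s t)"
      by (rule \<beta>_add) (use that sub s WX \<alpha>_carr in blast)+
    moreover have "r \<in> carr X1" using that sub by blast
    ultimately show ?thesis using \<beta>_\<alpha> s that by simp
  qed
  have uniq: "r = r' \<and> t = t'"
    if *: "r \<in> R1" "t \<in> R3" "r' \<in> R1" "t' \<in> R3" "\<alpha> r + s t - (\<alpha> r' + s t') \<in> U" for r t r' t'
  proof -
    have "\<beta> (\<alpha> r + s t - (\<alpha> r' + s t')) = t - t'"
      using \<beta>_diff[of "\<alpha> r + s t" "\<alpha> r' + s t'"] hW[OF *(1,2)] hW[OF *(3,4)] WX h\<beta>[OF *(1,2)] h\<beta>[OF *(3,4)]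
      by (simp add: subset_iff)
    then have "t - t' \<in> \<beta> ` U" using *(5) by (metis image_eqI)
    moreover have "0 \<in> \<beta> ` U" using X2.subspace_0[OF Us] \<beta>_0 by force
    ultimately have t: "t = t'" using transversal_inj[OF R3] * by blast
    have rr: "r \<in> carr X1" "r' \<in> carr X1" using * sub by auto
    have "\<alpha> (r - r') \<in> U" using *(5) t by (simp add: \<alpha>_diff[OF rr])
    then have "r - r' \<in> pre U" using rr X1.subspace_diff[OF X1.subspace_carr] by blast
    moreover have "0 \<in> pre U" using X1.subspace_0[OF pre_subspace[OF Us]] .
    ultimately show ?thesis using transversal_inj[OF R1] * t by blast
  qed
  have inj: "inj_on ?h (R1 \<times> R3)"
  proof (rule inj_onI, clarify)
    fix r t r' t' assume *: "r \<in> R1" "t \<in> R3" "r' \<in> R1" "t' \<in> R3" "\<alpha> r + s t = \<alpha> r' + s t'"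
    then have "\<alpha> r + s t - (\<alpha> r' + s t') \<in> U" using X2.subspace_0[OF Us] by simp
    then show "r = r' \<and> t = t'" using uniq * by blast
  qed
  have "transversal U W (?h ` (R1 \<times> R3))"
    unfolding transversal_def
  proof (intro conjI ballI)
    fix w assume w: "w \<in> W"
    then obtain t where t: "t \<in> R3" "\<beta> w - t \<in> \<beta> ` U" using R3 unfolding transversal_def by blast
    then obtain u where u: "u \<in> U" "\<beta> w - t = \<beta> u" by blast
    have st: "s t \<in> W" "\<beta> (s t) = t" using s t by auto
    have wX: "w \<in> carr X2" "s t \<in> carr X2" "u \<in> carr X2" using w st WX u UW by auto
    have wst: "w - s t \<in> carr X2" using wX X2.subspace_diff[OF X2.subspace_carr] by blast
    \<comment> \<open>After removing the lift \<open>s t\<close> and the correction \<open>u\<close>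
      from \<open>U\<close>, the remainder is in the kernel of \<beta>, hence comes from
      \<open>pre W\<close>, where \<open>R1\<close> supplies the other summand.\<close>
    then have "\<beta> (w - s t - u) = 0" using wX u st by (simp add: \<beta>_diff)
    moreover have mW: "w - s t - u \<in> W"
      using w st u UW X2.subspace_diff[OF Ws] by blast
    ultimately obtain v where v: "v \<in> carr X1" "w - s t - u = \<alpha> v" using ker_\<beta> WX by blast
    then have "v \<in> pre W" using mW by simp
    then obtain r where r: "r \<in> R1" "v - r \<in> pre U" using R1 unfolding transversal_def by blast
    have "r \<in> carr X1" using r sub by blast
    then have "\<alpha> v - \<alpha> r \<in> U" using r(2) v(1) by (simp add: \<alpha>_diff)
    then have "u + (\<alpha> v - \<alpha> r) \<in> U" using u X2.subspace_add[OF Us] by blast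
    moreover have "u + (\<alpha> v - \<alpha> r) = w - (\<alpha> r + s t)" using v(2)[symmetric] by (simp add: algebra_simps)
    ultimately have in_U: "w - (\<alpha> r + s t) \<in> U" by simp
    show "\<exists>!x. x \<in> ?h ` (R1 \<times> R3) \<and> w - x \<in> U"
    proof (rule ex1I[of _ "\<alpha> r + s t"])
      show "\<alpha> r + s t \<in> ?h ` (R1 \<times> R3) \<and> w - (\<alpha> r + s t) \<in> U" using r t in_U by force
      fix x assume x: "x \<in> ?h ` (R1 \<times> R3) \<and> w - x \<in> U"
      then obtain r' t' where x': "x = \<alpha> r' + s t'" "r' \<in> R1" "t' \<in> R3" by auto
      have "(w - x) - (w - (\<alpha> r + s t)) \<in> U" using X2.subspace_diff[OF Us] x in_U by blast
      then have "\<alpha> r + s t - (\<alpha> r' + s t') \<in> U" using x' by (simp add: algebra_simps)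
      then show "x = \<alpha> r + s t" using uniq r t x' by blast
    qed
  qed (use sub hW in auto)
  then have "card R = card (?h ` (R1 \<times> R3))"
    by (rule transversal_card[OF R]) (rule X2.subspace_neg[OF Us])
  then show ?thesis using inj by (simp add: card_image card_cartesian_product)
qed

text \<open>Going from \<open>U\<close> to \<open>W\<close> multiplies the mass in the middle and
  the product of the outer masses by the same index, that of \<open>U\<close> in
  \<open>W\<close>.\<close>

lemma mass_exact_mono:
  assumes U: "is_lattice X2 U" and W: "is_lattice X2 W" and UW: "U \<subseteq> W"
    and m: "m1 \<in> meas X1" "m2 \<in> meas X2" "m3 \<in> meas X3"
  shows "\<exists>n::nat. n > 0 \<and> mass m2 W = of_nat n * mass m2 U \<and>
    mass m1 (pre W) * mass m3 (\<beta> ` W) = of_nat n * (mass m1 (pre U) * mass m3 (\<beta> ` U))"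
proof -
  obtain R where R: "transversal U W R" using X2.transversal_exists[OF U W] by blast
  obtain R1 where R1: "transversal (pre U) (pre W) R1"
    using X1.transversal_exists[OF pre_lattice[OF U] pre_lattice[OF W]] by blast
  obtain R3 where R3: "transversal (\<beta> ` U) (\<beta> ` W) R3"
    using X3.transversal_exists[OF img_lattice[OF U] img_lattice[OF W]] by blast
  have "mass m1 (pre W) = of_nat (card R1) * mass m1 (pre U)"
    by (rule X1.mass_transversal[OF m(1) pre_lattice[OF U] pre_lattice[OF W] _ R1]) (use UW in blast)
  moreover have "mass m3 (\<beta> ` W) = of_nat (card R3) * mass m3 (\<beta> ` U)"
    by (rule X3.mass_transversal[OF m(3) img_lattice[OF U] img_lattice[OF W] _ R3]) (use UW in blast)
  ultimately show ?thesis
    using X2.mass_transversal[OF m(2) U W UW R] X2.transversal_card_pos[OF R W]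
      transversal_exact[OF U W UW R R1 R3]
    by (intro exI[of _ "card R"]) simp
qed

text \<open>At \<open>K\<close> both sides are 1. Going down to a filtration member inside K
  \<inter> U and up again to \<open>U\<close> changes both sides by the same factors.\<close>

lemma haar_exact:
  assumes K: "is_lattice X2 K" and U: "is_lattice X2 U"
  shows "mass (haar X2 K) U = mass (haar X1 (pre K)) (pre U) * mass (haar X3 (\<beta> ` K)) (\<beta> ` U)"
proof -
  note h = X1.haar[OF pre_lattice[OF K]] X2.haar[OF K] X3.haar[OF img_lattice[OF K]]
  obtain i where i: "i \<in> idx X2" "fil X2 i \<subseteq> K" "fil X2 i \<subseteq> U"
    using X2.lattice_bounds[OF K U] by metis
  note V = X2.lattice_fil[OF i(1)]
  let ?g = "\<lambda>A. mass (haar X1 (pre K)) (pre A) * mass (haar X3 (\<beta> ` K)) (\<beta> ` A)"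
  obtain n :: nat where n: "n > 0" "1 = of_nat n * mass (haar X2 K) (fil X2 i)"
    "1 = of_nat n * ?g (fil X2 i)"
    using mass_exact_mono[OF V K i(2) h(1,3,5)] unfolding h(2,4,6) mult_1_left by blast
  have "mass (haar X2 K) (fil X2 i) = ?g (fil X2 i)"
    by (rule iffD1[OF mult_left_cancel trans[OF n(2)[symmetric] n(3)]]) (use n(1) in simp)
  moreover obtain n' :: nat where "mass (haar X2 K) U = of_nat n' * mass (haar X2 K) (fil X2 i)"
    "?g U = of_nat n' * ?g (fil X2 i)"
    using mass_exact_mono[OF V U i(3) h(1,3,5)] by blast
  ultimately show ?thesis by argo
qed

text \<open>The equations defining \<open>meas_tensor\<close> overdetermine the measure: a single
  filtration member fixes it, and \<open>haar_exact\<close> shows that the remaining equations hold.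
  From here on tensor products are products of coefficients.\<close>

lemma meas_tensor_haar:
  assumes K: "is_lattice X2 K" and K13: "K1 = pre K" "K3 = \<beta> ` K"
  shows "meas_tensor X1 X2 X3 \<alpha> \<beta> (\<lambda>f. z * haar X1 K1 f) (\<lambda>f. w * haar X3 K3 f) =
    (\<lambda>f. z * w * haar X2 K f)"
proof -
  let ?P = "\<lambda>m. m \<in> meas X2 \<and> (\<forall>j\<in>idx X2. mass m (fil X2 j) =
    mass (\<lambda>f. z * haar X1 K1 f) (pre (fil X2 j)) * mass (\<lambda>f. w * haar X3 K3 f) (\<beta> ` fil X2 j))"
  have "?P (\<lambda>f. z * w * haar X2 K f)"
    using X2.meas_smult[OF X2.haar(1)[OF K]] haar_exact[OF K X2.lattice_fil]
    by (simp add: X1.mass_smult X2.mass_smult X3.mass_smult K13)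
  moreover have "m = (\<lambda>f. z * w * haar X2 K f)" if m: "?P m" for m
  proof -
    obtain i where i: "i \<in> idx X2" using X2.ex_idx by blast
    show ?thesis
      by (rule X2.meas_eqI[OF _ _ X2.lattice_fil[OF i]]) (use m \<open>?P (\<lambda>f. z * w * haar X2 K f)\<close> i in auto)
  qed
  ultimately have "(THE m. ?P m) = (\<lambda>f. z * w * haar X2 K f)" by (rule the_equality)
  then show ?thesis by (simp add: meas_tensor_def sub_fil_def Defs.img_fil_def)
qed

text \<open>The part of the fibre over \<open>w\<close> lying in \<open>K\<close> is empty unless
  \<open>w\<close> comes from \<open>K\<close>, and otherwise corresponds to a translate of
  \<open>pre K\<close>, which has mass 1.\<close>

lemma push1_indicator:
  assumes K: "is_lattice X2 K"
  shows "push1 X1 X2 X3 \<alpha> \<beta> (indicator K) (haar X1 (pre K)) = indicator (\<beta> ` K)"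
proof
  fix w
  note KX = X2.lattice_subset_carr[OF K] and Ks = X2.lattice_subspace[OF K]
    and h = X1.haar[OF pre_lattice[OF K]]
  show "push1 X1 X2 X3 \<alpha> \<beta> (indicator K) (haar X1 (pre K)) w = indicator (\<beta> ` K) w"
  proof (cases "w \<in> carr X3")
    case True
    define w' where "w' = (SOME w'. w' \<in> carr X2 \<and> \<beta> w' = w)"
    have w': "w' \<in> carr X2 \<and> \<beta> w' = w"
      unfolding w'_def by (rule someI_ex) (use True in \<open>unfold \<beta>_img[symmetric], blast\<close>)
    let ?g = "pullback X1 \<alpha> (\<lambda>v. indicator K (w' + v)) :: 'v1 \<Rightarrow> complex"
    have *: "push1 X1 X2 X3 \<alpha> \<beta> (indicator K) (haar X1 (pre K)) w = haar X1 (pre K) ?g"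
      using True by (simp add: push1_def w'_def)
    show ?thesis
    proof (cases "w \<in> \<beta> ` K")
      case w: True
      then obtain k where k: "k \<in> K" "\<beta> k = w" by blast
      then have "\<beta> (k - w') = 0" "k - w' \<in> carr X2"
        using w' KX X2.subspace_diff[OF X2.subspace_carr] by (auto simp: \<beta>_diff)
      \<comment> \<open>The arbitrary lift chosen by \<open>push1\<close> differs from the lift
        \<open>k\<close> in \<open>K\<close> by an element of the subspace; \<open>- a\<close> is
        the translation that turns the fibre into \<open>pre K\<close>.\<close>
      then obtain a where a: "a \<in> carr X1" "k - w' = \<alpha> a" using ker_\<beta> by blast
      have "?g v = indicator (pre K) (v + - a)" for v
      proof (cases "v \<in> carr X1")
        case v: True
        have va: "v - a \<in> carr X1" by (rule X1.subspace_diff[OF X1.subspace_carr v a(1)])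
        have "w' + \<alpha> v = \<alpha> (v - a) + k" using a(2)[symmetric] by (simp add: \<alpha>_diff[OF v a(1)])
        then have "w' + \<alpha> v \<in> K \<longleftrightarrow> \<alpha> (v - a) \<in> K"
          using X2.lattice_translate[OF K k(1)] by simp
        then show ?thesis using v va by (simp add: pullback_def indicator_def)
      next
        case v: False
        have "v - a \<notin> carr X1" using v X1.subspace_add[OF X1.subspace_carr _ a(1), of "v - a"] by auto
        then show ?thesis using v by (simp add: pullback_def)
      qed
      then have "haar X1 (pre K) ?g = haar X1 (pre K) (\<lambda>v. indicator (pre K) (v + - a))"
        by presburger
      also have "\<dots> = 1"
        using X1.meas_translate[OF h(1) X1.subspace_neg[OF X1.subspace_carr a(1)], of "indicator (pre K)"] h(2)
        by (simp add: mass_def)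
      finally show ?thesis using * w by simp
    next
      case w: False
      have "w' + \<alpha> v \<notin> K" if "v \<in> carr X1" for v
      proof
        assume "w' + \<alpha> v \<in> K"
        moreover have "\<beta> (w' + \<alpha> v) = w" using w' that \<alpha>_carr \<beta>_\<alpha> by (simp add: \<beta>_add)
        ultimately show False using w by blast
      qed
      then have "?g = (\<lambda>v. 0)" by (auto simp: pullback_def)
      then show ?thesis using * w X1.meas_zero[OF h(1)] by simp
    qed
  next
    case False
    then have "w \<notin> \<beta> ` K" using KX \<beta>_carr by blast
    then show ?thesis using False by (simp add: push1_def)
  qed
qed

lemma push1_scale:
  assumes "m \<in> meas X1"
  shows "push1 X1 X2 X3 \<alpha> \<beta> (\<lambda>v. c * f v) m = (\<lambda>w. c * push1 X1 X2 X3 \<alpha> \<beta> f m w)"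
proof -
  have "pullback X1 \<alpha> (\<lambda>v. c * f (w + v)) = (\<lambda>v. c * pullback X1 \<alpha> (\<lambda>v. f (w + v)) v)" for w
    by (auto simp: pullback_def)
  then show ?thesis by (auto simp: push1_def X1.meas_scale[OF assms])
qed

end

section \<open>Duality\<close>

lemma vector_space_forms: "vector_space (\<lambda>(c :: 'f :: field) (w :: 'v \<Rightarrow> 'f) v. c * w v)"
  by unfold_locales (auto simp: algebra_simps)

lemma vector_space_scalars: "vector_space ((*) :: 'f :: field \<Rightarrow> 'f \<Rightarrow> 'f)"
  by unfold_locales (auto simp: algebra_simps)

lemma dual1_simps [simp]:
  "scl (dual1 X) = (\<lambda>c w v. c * w v)" "idx (dual1 X) = idx X" "leq (dual1 X) = (\<lambda>i j. leq X j i)"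
  "fil (dual1 X) = (\<lambda>i. annih X (fil X i))" "carr (dual1 X) = (\<Union>i\<in>idx X. annih X (fil X i))"
  by (simp_all add: dual1_def)

lemma ile_dual1 [simp]: "ile (dual1 X) i j \<longleftrightarrow> ile X j i"
  by (auto simp: ile_def)

lemma annih_antimono: "A \<subseteq> B \<Longrightarrow> annih X B \<subseteq> annih X A"
  by (auto simp: annih_def)

section \<open>Linear forms: extension and separation\<close>

context c1
begin

lemma form_add: "w \<in> lin_forms X \<Longrightarrow> x \<in> carr X \<Longrightarrow> y \<in> carr X \<Longrightarrow> w (x + y) = w x + w y"
  and form_scale: "w \<in> lin_forms X \<Longrightarrow> x \<in> carr X \<Longrightarrow> w (scl X c x) = c * w x"
  and form_outside: "w \<in> lin_forms X \<Longrightarrow> x \<notin> carr X \<Longrightarrow> w x = 0"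
  by (auto simp: lin_forms_def lin_map_def)

lemma form_0: "w \<in> lin_forms X \<Longrightarrow> w 0 = 0"
  using form_scale[of w 0 0] subspace_0[OF subspace_carr] by simp

lemma form_diff:
  assumes "w \<in> lin_forms X" "x \<in> carr X" "y \<in> carr X"
  shows "w (x - y) = w x - w y"
  using form_add[OF assms(1) subspace_diff[OF subspace_carr assms(2,3)] assms(3)] by simp

lemma subspace_form_kernel: "w \<in> lin_forms X \<Longrightarrow> subspace {x \<in> carr X. w x = 0}"
  using subspace_carr unfolding subspace_def by (simp add: form_0 form_add form_scale)

lemma form_eqI: "w \<in> lin_forms X \<Longrightarrow> w' \<in> lin_forms X \<Longrightarrow> (\<And>x. x \<in> carr X \<Longrightarrow> w x = w' x) \<Longrightarrow> w = w'"
  by (rule ext) (metis form_outside)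

lemma extend_form:
  assumes S: "subspace S" "S \<subseteq> carr X"
    and g: "\<And>x y. x \<in> S \<Longrightarrow> y \<in> S \<Longrightarrow> g (x + y) = g x + g y"
      "\<And>c x. x \<in> S \<Longrightarrow> g (scl X c x) = c * g x"
  obtains w where "w \<in> lin_forms X" "\<And>x. x \<in> S \<Longrightarrow> w x = g x"
proof -
  interpret vp: vector_space_pair "scl X" "(*) :: 'f \<Rightarrow> 'f \<Rightarrow> 'f"
    unfolding vector_space_pair_def using vector_space_axioms vector_space_scalars by blast
  obtain B where B: "B \<subseteq> S" "independent B" "S \<subseteq> span B" using basis_exists[of S] by metis
  obtain h where h: "Vector_Spaces.linear (scl X) (*) h" "\<And>x. x \<in> B \<Longrightarrow> h x = g x"
    using vp.linear_independent_extend[OF B(2), of g] by blast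
  have hadd: "h (x + y) = h x + h y" and hsc: "h (scl X c x) = c * h x" for x y c
    using vp.linear_add[OF h(1)] vp.linear_scale[OF h(1)] by auto
  have "span B \<subseteq> {x \<in> S. h x = g x}"
  proof (rule span_minimal)
    have "g 0 = 0" using g(2)[of 0 0] subspace_0[OF S(1)] by simp
    moreover have "h 0 = 0" using hsc[of 0 0] by simp
    ultimately show "subspace {x \<in> S. h x = g x}"
      using S(1) by (auto simp: subspace_def hadd hsc g)
  qed (use B h in blast)
  then have hg: "h x = g x" if "x \<in> S" for x using that B by blast
  \<comment> \<open>Elements of \<open>lin_forms\<close> are total functions vanishing off the
    carrier, so the ambient extension is cut off.\<close>
  let ?w = "\<lambda>v. if v \<in> carr X then h v else 0"
  have "?w \<in> lin_forms X"
    using subspace_carr hadd hsc unfolding lin_forms_def lin_map_def subspace_def by simp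
  then show ?thesis by (rule that) (use hg S in auto)
qed

lemma extend_form_vanishing:
  assumes S: "subspace S" "S \<subseteq> carr X" and U: "subspace U" "U \<subseteq> carr X"
    and g: "\<And>x y. x \<in> S \<Longrightarrow> y \<in> S \<Longrightarrow> g (x + y) = g x + g y"
      "\<And>c x. x \<in> S \<Longrightarrow> g (scl X c x) = c * g x"
    and gU: "\<And>x. x \<in> S \<Longrightarrow> x \<in> U \<Longrightarrow> g x = 0"
  obtains w where "w \<in> lin_forms X" "\<And>x. x \<in> S \<Longrightarrow> w x = g x" "\<And>x. x \<in> U \<Longrightarrow> w x = 0"
proof -
  \<comment> \<open>On S + U the form is to be \<open>g\<close> on \<open>S\<close> and 0 on
    \<open>U\<close>; two components in \<open>S\<close> of one vector differ by an element of S
    \<inter> U, where \<open>g\<close> vanishes.\<close>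
  define g' where "g' z = g (SOME x. x \<in> S \<and> z - x \<in> U)" for z
  have g': "g' (x + y) = g x" if "x \<in> S" "y \<in> U" for x y
  proof -
    define x' where "x' = (SOME x'. x' \<in> S \<and> x + y - x' \<in> U)"
    have x': "x' \<in> S \<and> x + y - x' \<in> U"
      unfolding x'_def by (rule someI[of _ x]) (use that in simp)
    have "x + y - x' - y \<in> U" using x' that subspace_diff[OF U(1)] by blast
    then have "x - x' \<in> U" by simp
    moreover have xS: "x - x' \<in> S" using x' that subspace_diff[OF S(1)] by blast
    ultimately have "g (x - x') = 0" by (rule gU[rotated])
    moreover have "g (x - x' + x') = g (x - x') + g x'" using g(1)[OF xS] x' by blast
    ultimately have "g x = g x'" by simp
    then show ?thesis by (simp add: g'_def x'_def)
  qed
  let ?T = "{x + y |x y. x \<in> S \<and> y \<in> U}"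
  have T: "subspace ?T" by (rule subspace_sums[OF S(1) U(1)])
  have TX: "?T \<subseteq> carr X" using S U subspace_add[OF subspace_carr] by blast
  obtain w where w: "w \<in> lin_forms X" "\<And>z. z \<in> ?T \<Longrightarrow> w z = g' z"
  proof (rule extend_form[OF T TX, of g'])
    fix z z' assume "z \<in> ?T" "z' \<in> ?T"
    then obtain x y x' y' where *: "x \<in> S" "y \<in> U" "x' \<in> S" "y' \<in> U" "z = x + y" "z' = x' + y'" by blast
    have "g' ((x + x') + (y + y')) = g (x + x')"
      by (rule g') (use * subspace_add S(1) U(1) in blast)+
    then show "g' (z + z') = g' z + g' z'" using * by (simp add: g' g algebra_simps)
  next
    fix c z assume "z \<in> ?T"
    then obtain x y where *: "x \<in> S" "y \<in> U" "z = x + y" by blast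
    have "g' (scl X c x + scl X c y) = g (scl X c x)"
      by (rule g') (use * subspace_scale S(1) U(1) in blast)+
    then show "g' (scl X c z) = c * g' z" using * by (simp add: g' g scale_right_distrib)
  qed blast
  show ?thesis
  proof (rule that[OF w(1)])
    fix x assume x: "x \<in> S"
    have "x + 0 \<in> ?T" using x subspace_0[OF U(1)] by blast
    then show "w x = g x" using w(2)[of "x + 0"] g'[OF x subspace_0[OF U(1)]] by simp
  next
    fix x assume x: "x \<in> U"
    have "0 + x \<in> ?T" using x subspace_0[OF S(1)] by blast
    moreover have "g 0 = 0" using g(2)[of 0 0] subspace_0[OF S(1)] by simp
    ultimately show "w x = 0" using w(2)[of "0 + x"] g'[OF subspace_0[OF S(1)] x] by simp
  qed
qed

text \<open>The coordinate on the line through \<open>v\<close> vanishes on the intersection of this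
  line with \<open>U\<close>, which is zero, so it extends by 0 on \<open>U\<close>.\<close>

lemma separating_form:
  assumes U: "subspace U" "U \<subseteq> carr X" and v: "v \<in> carr X" "v \<notin> U"
  obtains w where "w \<in> annih X U" "w v = 1"
proof -
  have inj: "k = l" if "scl X k v = scl X l v" for k l
  proof -
    have "v \<noteq> 0" using v subspace_0[OF U(1)] by blast
    then show ?thesis using that by simp
  qed
  define g where "g x = (THE k. x = scl X k v)" for x
  have g: "g (scl X k v) = k" for k
    unfolding g_def by (rule the_equality) (use inj in auto)
  have S: "span {v} = range (\<lambda>k. scl X k v)" by (rule span_singleton)
  obtain w where w: "w \<in> lin_forms X" "\<And>x. x \<in> span {v} \<Longrightarrow> w x = g x" "\<And>x. x \<in> U \<Longrightarrow> w x = 0"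
  proof (rule extend_form_vanishing[OF subspace_span _ U, of "{v}" g])
    show "span {v} \<subseteq> carr X" using v subspace_carr by (intro span_minimal) auto
    show "g (x + y) = g x + g y" if "x \<in> span {v}" "y \<in> span {v}" for x y
      using that by (auto simp: S g simp flip: scale_left_distrib)
    show "g (scl X c x) = c * g x" if "x \<in> span {v}" for c x
      using that by (auto simp: S g)
    show "g x = 0" if x: "x \<in> span {v}" "x \<in> U" for x
    proof -
      obtain k where k: "x = scl X k v" using x S by blast
      have "k = 0"
      proof (rule ccontr)
        assume "k \<noteq> 0"
        then have "v = scl X (inverse k) x" using k by simp
        then show False using v(2) subspace_scale[OF U(1) x(2)] by metis
      qed
      then show ?thesis using k g[of 0] by simp
    qed
  qed blast
  have "v = scl X 1 v" by simp
  then have "w v = 1" using w(2)[OF span_base[of v "{v}"]] g[of 1] by simp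
  then show ?thesis using that[of w] w by (simp add: annih_def)
qed

section \<open>The dual of a space with finite-dimensional quotients\<close>

lemma annih_subspace: "module.subspace (\<lambda>c w v. c * w v) (annih X A)"
proof -
  interpret D: vector_space "\<lambda>(c :: 'f) (w :: 'v \<Rightarrow> 'f) v. c * w v" by (rule vector_space_forms)
  show ?thesis
    unfolding D.subspace_def
  proof (intro conjI ballI allI)
    show "0 \<in> annih X A" by (simp add: annih_def lin_forms_def lin_map_def)
    fix w assume w: "w \<in> annih X A"
    then have wf: "w \<in> lin_forms X" by (simp add: annih_def)
    have "(\<lambda>v. c * w v) \<in> lin_forms X" for c
      using form_add[OF wf] form_scale[OF wf] form_outside[OF wf]
      by (simp add: lin_forms_def lin_map_def algebra_simps)
    then show "(\<lambda>v. c * w v) \<in> annih X A" for c using w by (simp add: annih_def)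
    fix w' assume w': "w' \<in> annih X A"
    then have wf': "w' \<in> lin_forms X" by (simp add: annih_def)
    have "w + w' \<in> lin_forms X"
      using form_add[OF wf] form_scale[OF wf] form_outside[OF wf]
        form_add[OF wf'] form_scale[OF wf'] form_outside[OF wf']
      by (simp add: lin_forms_def lin_map_def algebra_simps)
    then show "w + w' \<in> annih X A" using w w' by (simp add: annih_def)
  qed
qed

lemma annih_inter_fil: "w \<in> lin_forms X \<Longrightarrow> (\<And>i. i \<in> idx X \<Longrightarrow> w \<in> annih X (fil X i)) \<Longrightarrow> w = 0"
proof
  fix v assume w: "w \<in> lin_forms X" "\<And>i. i \<in> idx X \<Longrightarrow> w \<in> annih X (fil X i)"
  show "w v = 0 v"
  proof (cases "v \<in> carr X")
    case True
    then obtain i where "i \<in> idx X" "v \<in> fil X i" using UN_fil by blast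
    then show ?thesis using w(2) by (simp add: annih_def)
  qed (simp add: form_outside[OF w(1)])
qed

text \<open>A form vanishing on \<open>fil X i\<close> is determined, modulo forms vanishing on
  \<open>fil X j\<close>, by its values on the finite set of representatives of the quotient; over a
  finite field there are finitely many such value tables.\<close>

lemma dual_finite_cover:
  assumes ij: "ile X i j"
  obtains B where "finite B" "B \<subseteq> annih X (fil X i)"
    "\<And>w. w \<in> annih X (fil X i) \<Longrightarrow> \<exists>b\<in>B. w - b \<in> annih X (fil X j)"
proof -
  note L = lattice_fil[OF ile_idx(1)[OF ij]] lattice_fil[OF ile_idx(2)[OF ij]]
  obtain R where R: "transversal (fil X i) (fil X j) R" using transversal_exists[OF L] by blast
  then have fR: "finite R" and RF: "R \<subseteq> fil X j" by (auto simp: transversal_def)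
  let ?A = "annih X (fil X i)"
  \<comment> \<open>Table of values on \<open>R\<close>; the default 0 off \<open>R\<close> makes
    the set of possible tables finite.\<close>
  define \<rho> where "\<rho> w = (\<lambda>r. if r \<in> R then w r else 0)" for w :: "'v \<Rightarrow> 'f"
  have "\<rho> ` ?A \<subseteq> {f. \<forall>r. (r \<in> R \<longrightarrow> f r \<in> UNIV) \<and> (r \<notin> R \<longrightarrow> f r = 0)}"
    by (auto simp: \<rho>_def)
  then have fin: "finite (\<rho> ` ?A)"
    by (rule finite_subset) (use finite_set_of_finite_funs[OF fR, of UNIV "0 :: 'f"] in simp)
  show ?thesis
  proof (rule that[of "inv_into ?A \<rho> ` (\<rho> ` ?A)"])
    show "finite (inv_into ?A \<rho> ` (\<rho> ` ?A))" using fin by blast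
    show "inv_into ?A \<rho> ` (\<rho> ` ?A) \<subseteq> ?A" by (auto intro: inv_into_into)
    fix w assume w: "w \<in> ?A"
    define b where "b = inv_into ?A \<rho> (\<rho> w)"
    have b: "b \<in> ?A" "\<rho> b = \<rho> w" using w by (auto simp: b_def f_inv_into_f intro: inv_into_into)
    interpret D: vector_space "\<lambda>(c :: 'f) (w :: 'v \<Rightarrow> 'f) v. c * w v" by (rule vector_space_forms)
    have wb: "w - b \<in> ?A" by (rule D.subspace_diff[OF annih_subspace w b(1)])
    have "(w - b) x = 0" if x: "x \<in> fil X j" for x
    proof -
      obtain r where r: "r \<in> R" "x - r \<in> fil X i" using R x unfolding transversal_def by blast
      have "w r = b r" using fun_cong[OF b(2), of r] r by (simp add: \<rho>_def)
      moreover have "(w - b) (x - r) = 0" using wb r by (simp add: annih_def)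
      moreover have "(w - b) (x - r) = (w - b) x - (w - b) r"
      proof (rule form_diff)
        show "w - b \<in> lin_forms X" using wb unfolding annih_def by blast
      qed (use x r RF lattice_subset_carr[OF L(2)] in blast)+
      ultimately show ?thesis by simp
    qed
    then have "w - b \<in> annih X (fil X j)" using wb by (simp add: annih_def)
    then show "\<exists>b\<in>inv_into ?A \<rho> ` (\<rho> ` ?A). w - b \<in> annih X (fil X j)" using w b_def by blast
  qed
qed

lemma c1_dual: "c1 (dual1 X)"
proof
  interpret D: vector_space "\<lambda>(c :: 'f) (w :: 'v \<Rightarrow> 'f) v. c * w v" by (rule vector_space_forms)
  have carr: "D.subspace (\<Union>i\<in>idx X. annih X (fil X i))"
    unfolding D.subspace_def
  proof (intro conjI ballI allI)
    show "0 \<in> (\<Union>i\<in>idx X. annih X (fil X i))" using ex_idx D.subspace_0[OF annih_subspace] by blast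
    fix x assume "x \<in> (\<Union>i\<in>idx X. annih X (fil X i))"
    then obtain i where i: "i \<in> idx X" "x \<in> annih X (fil X i)" by blast
    show "(\<lambda>v. c * x v) \<in> (\<Union>i\<in>idx X. annih X (fil X i))" for c
      using i D.subspace_scale[OF annih_subspace i(2)] by blast
    fix y assume "y \<in> (\<Union>i\<in>idx X. annih X (fil X i))"
    then obtain j where j: "j \<in> idx X" "y \<in> annih X (fil X j)" by blast
    obtain k where k: "ile X k i" "ile X k j" using ex_bounds[OF i(1) j(1)] by metis
    have "x \<in> annih X (fil X k)" "y \<in> annih X (fil X k)"
      using i j k annih_antimono[OF fil_mono] by blast+
    then show "x + y \<in> (\<Union>i\<in>idx X. annih X (fil X i))"
      using D.subspace_add[OF annih_subspace] ile_idx[OF k(1)] by blast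
  qed
  have po: "partial_order_on (idx X) {(i, j). ile X j i}"
  proof -
    have "{(i, j). ile X j i} = {(i, j). ile X i j}\<inverse>" by auto
    then show ?thesis using filtered by (simp only: filtered_space_def partial_order_on_converse)
  qed
  have dir: "\<exists>k l. ile X i k \<and> ile X l i \<and> ile X j k \<and> ile X l j"
    if "i \<in> idx X" "j \<in> idx X" for i j
    using ex_bounds[OF that] by metis
  have inter: "(\<Inter>i\<in>idx X. annih X (fil X i)) = {0}"
  proof
    show "(\<Inter>i\<in>idx X. annih X (fil X i)) \<subseteq> {0}"
    proof
      fix w assume w: "w \<in> (\<Inter>i\<in>idx X. annih X (fil X i))"
      then have "w \<in> lin_forms X" using ex_idx by (auto simp: annih_def)
      then show "w \<in> {0}" using annih_inter_fil w by blast
    qed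
    show "{0} \<subseteq> (\<Inter>i\<in>idx X. annih X (fil X i))" using D.subspace_0[OF annih_subspace] by blast
  qed
  have fin: "\<exists>B. finite B \<and> B \<subseteq> annih X (fil X i) \<and>
      annih X (fil X i) \<subseteq> D.span (B \<union> annih X (fil X j))" if ij: "ile X i j" for i j
  proof -
    obtain B where B: "finite B" "B \<subseteq> annih X (fil X i)"
      "\<And>w. w \<in> annih X (fil X i) \<Longrightarrow> \<exists>b\<in>B. w - b \<in> annih X (fil X j)"
      using dual_finite_cover[OF ij] by metis
    have "w \<in> D.span (B \<union> annih X (fil X j))" if w: "w \<in> annih X (fil X i)" for w
    proof -
      obtain b where b: "b \<in> B" "w - b \<in> annih X (fil X j)" using B(3)[OF w] by blast
      have "(w - b) + b \<in> D.span (B \<union> annih X (fil X j))"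
        by (intro D.span_add D.span_base) (use b in auto)
      then show ?thesis by simp
    qed
    then show ?thesis using B by blast
  qed
  show "c1_space (dual1 X)"
    unfolding c1_space_def filtered_space_def dual1_simps ile_dual1
  proof (intro conjI ballI allI impI)
    show "\<exists>k l. ile X i k \<and> ile X l i \<and> ile X j k \<and> ile X l j" if "i \<in> idx X" "j \<in> idx X" for i j
      using that by (rule dir)
    show "\<exists>B. finite B \<and> B \<subseteq> annih X (fil X j) \<and>
      annih X (fil X j) \<subseteq> D.span (B \<union> annih X (fil X i))" if "ile X j i" for i j
      using that by (rule fin)
    show "annih X (fil X i) \<subseteq> annih X (fil X j)" if "ile X j i" for i j
      by (rule annih_antimono[OF fil_mono[OF that]])
  qed (use vector_space_forms carr po inter annih_subspace in \<open>blast+\<close>)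
qed

section \<open>Masses of a lattice and of its annihilator\<close>

lemma annih_lattice:
  assumes U: "is_lattice X U"
  shows "is_lattice (dual1 X) (annih X U)"
proof -
  obtain i j where "i \<in> idx X" "j \<in> idx X" "fil X i \<subseteq> U" "U \<subseteq> fil X j"
    using lattice_bounds[OF U U] by metis
  then show ?thesis
    unfolding is_lattice_def dual1_simps using annih_subspace[of U] annih_antimono by meson
qed

text \<open>The multiples of \<open>v\<close> represent the quotient: adding one dimension
  multiplies the mass by the order of the field.\<close>

lemma mass_span_insert:
  assumes U: "is_lattice X U" and W: "is_lattice X W" "W = span (insert v U)" and v: "v \<notin> U"
    and m: "m \<in> meas X"
  shows "mass m W = of_nat (card (UNIV :: 'f set)) * mass m U"
proof -
  note Us = lattice_subspace[OF U]
  have sU: "span U = U" using Us by (simp add: span_eq_iff)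
  have eq: "k = l" if "scl X (k - l) v \<in> U" for k l
  proof (rule ccontr)
    assume "k \<noteq> l"
    then have "v = scl X (inverse (k - l)) (scl X (k - l) v)" by simp
    then show False using v subspace_scale[OF Us that] by metis
  qed
  have inj: "inj (\<lambda>k. scl X k v)"
  proof
    fix k l assume "scl X k v = scl X l v"
    then have "scl X (k - l) v = 0" by (simp only: scale_left_diff_distrib diff_self)
    then have "scl X (k - l) v \<in> U" by (simp only: subspace_0[OF Us])
    then show "k = l" by (rule eq)
  qed
  have "transversal U W (range (\<lambda>k. scl X k v))"
    unfolding transversal_def
  proof (intro conjI ballI)
    show "finite (range (\<lambda>k. scl X k v))" by simp
    show "range (\<lambda>k. scl X k v) \<subseteq> W" using W(2) by (auto intro: span_scale span_base)
    fix w assume "w \<in> W"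
    then obtain k where k: "w - scl X k v \<in> U" using W(2) sU by (auto simp: span_insert)
    then show "\<exists>!r. r \<in> range (\<lambda>k. scl X k v) \<and> w - r \<in> U"
    proof (intro ex1I[of _ "scl X k v"])
      fix r assume r: "r \<in> range (\<lambda>k. scl X k v) \<and> w - r \<in> U"
      then obtain l where l: "r = scl X l v" by blast
      have "(w - r) - (w - scl X k v) \<in> U" using r k subspace_diff[OF Us] by blast
      then have "scl X (k - l) v \<in> U" using l by (simp add: scale_left_diff_distrib)
      then show "r = scl X k v" using eq l by blast
    qed auto
  qed
  from mass_transversal[OF m U W(1) _ this] show ?thesis
    using W(2) inj by (auto simp: card_image intro: span_base)
qed

text \<open>Adding one new vector to the lattice multiplies its mass by the order of the field and
  divides the mass of the annihilator by it; representatives of W/U are added one at a time. This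
  makes the value described by \<open>meas_pair\<close> independent of the index.\<close>

lemma pairing_mono:
  assumes U: "is_lattice X U" and W: "is_lattice X W" and UW: "U \<subseteq> W"
    and m: "m \<in> meas X" and n: "n \<in> meas (dual1 X)"
  shows "mass m W * mass n (annih X W) = mass m U * mass n (annih X U)"
proof -
  interpret D: c1 "dual1 X" by (rule c1_dual)
  have step: "mass m (span (insert v Y)) * mass n (annih X (span (insert v Y))) =
      mass m Y * mass n (annih X Y)"
    if Y: "is_lattice X Y" "Y \<subseteq> W" and v: "v \<in> W" for Y v
  proof (cases "v \<in> Y")
    case True
    then show ?thesis using lattice_subspace[OF Y(1)] by (simp add: insert_absorb span_eq_iff[THEN iffD2])
  next
    case False
    let ?Z = "span (insert v Y)"
    have Z: "is_lattice X ?Z" using lattice_span[OF Y(1) W Y(2), of "{v}"] v by simp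
    note YX = lattice_subset_carr[OF Y(1)]
    have vX: "v \<in> carr X" using v lattice_subset_carr[OF W] by blast
    obtain w0 where w0: "w0 \<in> annih X Y" "w0 v = 1"
      using separating_form[OF lattice_subspace[OF Y(1)] YX vX False] by blast
    have YZ: "Y \<subseteq> ?Z" "v \<in> ?Z" by (auto intro: span_base)
    have "w0 \<notin> annih X ?Z" using w0(2) YZ(2) unfolding annih_def by force
    moreover have "annih X Y = D.span (insert w0 (annih X ?Z))"
    proof
      show "D.span (insert w0 (annih X ?Z)) \<subseteq> annih X Y"
        using w0 annih_antimono[OF YZ(1)] annih_subspace[of Y] by (intro D.span_minimal) auto
      show "annih X Y \<subseteq> D.span (insert w0 (annih X ?Z))"
      proof
        fix w assume w: "w \<in> annih X Y"
        \<comment> \<open>Since \<open>w0 v\<close> is 1, subtracting this multiple of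
          \<open>w0\<close> makes the form vanish at \<open>v\<close> too, hence on
          \<open>?Z\<close>: the annihilators differ by one dimension, spanned by
          \<open>w0\<close>.\<close>
        let ?u = "w - (\<lambda>x. w v * w0 x)"
        have u: "?u \<in> annih X Y"
          using D.subspace_diff[OF _ w D.subspace_scale[OF _ w0(1), of "w v"]] annih_subspace[of Y] by simp
        have uf: "?u \<in> lin_forms X" using u by (simp add: annih_def)
        have "?Z \<subseteq> {x \<in> carr X. ?u x = 0}"
        proof (rule span_minimal)
          show "subspace {x \<in> carr X. ?u x = 0}" by (rule subspace_form_kernel[OF uf])
          show "insert v Y \<subseteq> {x \<in> carr X. ?u x = 0}"
            using vX YX u w0(2) by (auto simp: annih_def)
        qed
        then have "?u \<in> annih X ?Z" using uf by (auto simp: annih_def)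
        then have "?u + (\<lambda>x. w v * w0 x) \<in> D.span (insert w0 (annih X ?Z))"
          using D.span_scale[OF D.span_base[of w0 "insert w0 (annih X ?Z)"], of "w v"]
          by (intro D.span_add[OF D.span_base]) auto
        then show "w \<in> D.span (insert w0 (annih X ?Z))" by simp
      qed
    qed
    ultimately have "mass n (annih X Y) = of_nat (card (UNIV :: 'f set)) * mass n (annih X ?Z)"
      using D.mass_span_insert[OF annih_lattice[OF Z] annih_lattice[OF Y(1)] _ _ n] by blast
    moreover have "mass m ?Z = of_nat (card (UNIV :: 'f set)) * mass m Y"
      by (rule mass_span_insert[OF Y(1) Z refl False m])
    ultimately show ?thesis by simp
  qed
  obtain R where R: "transversal U W R" using transversal_exists[OF U W] by blast
  then have "finite R" "R \<subseteq> W" by (auto simp: transversal_def)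
  then have "mass m (span (R \<union> U)) * mass n (annih X (span (R \<union> U))) = mass m U * mass n (annih X U)"
  proof (induction R rule: finite_induct)
    case empty
    then show ?case using lattice_subspace[OF U] by (simp add: span_eq_iff[THEN iffD2])
  next
    case (insert r R)
    then have Y: "is_lattice X (span (R \<union> U))" "span (R \<union> U) \<subseteq> W"
      using lattice_span[OF U W UW] by auto
    have "span (insert r R \<union> U) = span (insert r (span (R \<union> U)))"
      by (simp add: span_insert span_span)
    then show ?case using step[OF Y, of r] insert by simp
  qed
  moreover have "span (R \<union> U) = W"
  proof
    show "span (R \<union> U) \<subseteq> W" using lattice_span[OF U W UW] \<open>R \<subseteq> W\<close> by auto
    show "W \<subseteq> span (R \<union> U)"
    proof
      fix w assume "w \<in> W"
      then obtain r where "r \<in> R" "w - r \<in> U" using R unfolding transversal_def by blast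
      then have "(w - r) + r \<in> span (R \<union> U)" by (intro span_add span_base) auto
      then show "w \<in> span (R \<union> U)" by simp
    qed
  qed
  ultimately show ?thesis by simp
qed

text \<open>The product is 1 at \<open>K\<close> by normalization; \<open>pairing_mono\<close>
  carries it to \<open>U\<close> through a filtration member inside both.\<close>

lemma haar_dual_mass:
  assumes K: "is_lattice X K" and U: "is_lattice X U"
  shows "mass (haar X K) U * mass (haar (dual1 X) (annih X K)) (annih X U) = 1"
proof -
  interpret D: c1 "dual1 X" by (rule c1_dual)
  obtain i where i: "i \<in> idx X" "fil X i \<subseteq> K" "fil X i \<subseteq> U"
    using lattice_bounds[OF K U] by metis
  note h = haar[OF K] D.haar[OF annih_lattice[OF K]] and V = lattice_fil[OF i(1)]
  show ?thesis
    using pairing_mono[OF V K i(2) h(1,3)] pairing_mono[OF V U i(3) h(1,3)] h(2,4) by simp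
qed

lemma meas_pair_haar:
  assumes K: "is_lattice X K"
  shows "meas_pair X (\<lambda>f. z * haar X K f) (\<lambda>f. w * haar (dual1 X) (annih X K) f) = z * w"
proof -
  have "mass (\<lambda>f. z * haar X K f) (fil X i) *
      mass (\<lambda>f. w * haar (dual1 X) (annih X K) f) (fil (dual1 X) i) = z * w" if "i \<in> idx X" for i
    using arg_cong[OF haar_dual_mass[OF K lattice_fil[OF that]], of "\<lambda>x. z * w * x"]
    by (simp add: mass_def algebra_simps)
  then show ?thesis unfolding meas_pair_def using ex_idx by (intro the_equality) auto
qed

text \<open>On the annihilator the character is 1 on \<open>K\<close>, and the integral is the mass
  of \<open>K\<close>. Elsewhere a translation by a vector of \<open>K\<close> leaves the integral
  unchanged and also multiplies it by a number different from 1, so it vanishes.\<close>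

lemma fourier1_haar:
  assumes \<psi>: "nontrivial_character \<psi>" and K: "is_lattice X K"
  shows "fourier1 \<psi> X (haar X K) (indicator K) = indicator (annih X K)"
proof
  fix w
  note h = haar[OF K] and KX = lattice_subset_carr[OF K] and Ks = lattice_subspace[OF K]
  have \<psi>1: "\<psi> (x + y) = \<psi> x * \<psi> y" "\<psi> x \<noteq> 0" for x y using \<psi> by (auto simp: nontrivial_character_def)
  have "\<psi> 0 = 1" using \<psi>1(1)[of 0 0] \<psi>1(2)[of 0] by simp
  show "fourier1 \<psi> X (haar X K) (indicator K) w = indicator (annih X K) w"
  proof (cases "w \<in> carr (dual1 X)")
    case False
    obtain i where "i \<in> idx X" "fil X i \<subseteq> K" using K unfolding is_lattice_def by blast
    then have "w \<notin> annih X K" using False annih_antimono[of "fil X i" K X] by auto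
    then show ?thesis using False by (simp add: fourier1_def del: dual1_simps)
  next
    case True
    then have wf: "w \<in> lin_forms X" by (auto simp: annih_def)
    let ?g = "\<lambda>v. indicator K v * cnj (\<psi> (w v))"
    have *: "fourier1 \<psi> X (haar X K) (indicator K) w = haar X K ?g"
      using True by (simp add: fourier1_def del: dual1_simps)
    show ?thesis
    proof (cases "w \<in> annih X K")
      case in_annih: True
      then have "?g v = indicator K v" for v
        using \<open>\<psi> 0 = 1\<close> by (auto simp: annih_def indicator_def)
      then have "haar X K ?g = haar X K (indicator K)" by presburger
      then show ?thesis using * in_annih h(2) by (simp add: mass_def)
    next
      case False
      then obtain u where u: "u \<in> K" "w u \<noteq> 0" using wf by (auto simp: annih_def)
      obtain c where c: "\<psi> c \<noteq> 1" using \<psi> by (auto simp: nontrivial_character_def)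
      \<comment> \<open>Rescaling \<open>u\<close> makes \<open>w\<close> take the value
        \<open>c\<close>, at which the character is not 1; nontriviality of \<psi> alone would not
        give this at \<open>w u\<close>.\<close>
      let ?a = "scl X (c / w u) u"
      have a: "?a \<in> K" by (rule subspace_scale[OF Ks u(1)])
      then have aX: "?a \<in> carr X" using KX by blast
      have wa: "w ?a = c" using form_scale[OF wf] u KX by (simp add: subset_iff)
      have "?g (v + ?a) = cnj (\<psi> c) * ?g v" for v
        using lattice_translate[OF K a, of v] form_add[OF wf _ aX, of v] KX wa \<psi>1(1)
        by (auto simp: indicator_def)
      then have "haar X K (\<lambda>v. cnj (\<psi> c) * ?g v) = haar X K (\<lambda>v. ?g (v + ?a))" by presburger
      also have "\<dots> = haar X K ?g" by (rule meas_translate[OF h(1) aX])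
      finally have "cnj (\<psi> c) * haar X K ?g = haar X K ?g" by (simp only: meas_scale[OF h(1)])
      moreover have "cnj (\<psi> c) \<noteq> 1" using c by (metis complex_cnj_cnj complex_cnj_one)
      ultimately show ?thesis using * False by simp
    qed
  qed
qed

lemma fourier1_scale:
  assumes "m \<in> meas X"
  shows "fourier1 \<psi> X m (\<lambda>v. c * f v) = (\<lambda>w. c * fourier1 \<psi> X m f w)"
proof -
  have "m (\<lambda>v. c * f v * cnj (\<psi> (w v))) = c * m (\<lambda>v. f v * cnj (\<psi> (w v)))" for w
    by (subst meas_scale[OF assms, symmetric]) (simp add: mult.assoc)
  then show ?thesis by (auto simp: fourier1_def)
qed

end

section \<open>Transposed maps and the dual of an exact triple\<close>

lemma pullback_form:
  fixes X :: "('f :: {field, finite}, 'v :: ab_group_add, 'i) filtered"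
    and Y :: "('f, 'w :: ab_group_add, 'j) filtered"
  assumes X: "c1_space X" and Y: "c1_space Y"
    and h: "lin_map (scl X) (carr X) (scl Y) (carr Y) h" and w: "w \<in> lin_forms Y"
  shows "pullback X h w \<in> lin_forms X"
proof -
  interpret X: c1 X by unfold_locales (fact X)
  interpret Y: c1 Y by unfold_locales (fact Y)
  have hY: "x \<in> carr X \<Longrightarrow> h x \<in> carr Y" for x using h by (simp add: lin_map_def)
  show ?thesis
    unfolding lin_forms_def lin_map_def mem_Collect_eq
  proof (intro conjI ballI allI impI)
    fix x assume x: "x \<in> carr X"
    show "pullback X h w (scl X c x) = c * pullback X h w x" for c
      using x X.subspace_scale[OF X.subspace_carr x] h Y.form_scale[OF w hY[OF x]]
      by (simp add: pullback_def lin_map_def)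
    fix y assume y: "y \<in> carr X"
    show "pullback X h w (x + y) = pullback X h w x + pullback X h w y"
      using x y X.subspace_add[OF X.subspace_carr x y] h Y.form_add[OF w hY[OF x] hY[OF y]]
      by (simp add: pullback_def lin_map_def)
  qed (simp_all add: pullback_def)
qed

lemma annih_lattice_subset_dual: "is_lattice X U \<Longrightarrow> annih X U \<subseteq> carr (dual1 X)"
  unfolding is_lattice_def dual1_simps using annih_antimono by (metis UN_upper subset_trans)

context c1_exact
begin

lemma lin_maps: "lin_map (scl X1) (carr X1) (scl X2) (carr X2) \<alpha>"
    "lin_map (scl X2) (carr X2) (scl X3) (carr X3) \<beta>"
  using exact by (auto simp: short_exact_def)

lemmas pullback_\<alpha>_form = pullback_form[OF c1s(1,2) lin_maps(1)]
lemmas pullback_\<beta>_form = pullback_form[OF c1s(2,3) lin_maps(2)]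

lemma pre_annih:
  assumes U: "is_lattice X2 U"
  shows "{w \<in> carr (dual1 X3). pullback X2 \<beta> w \<in> annih X2 U} = annih X3 (\<beta> ` U)"
proof -
  note UX = X2.lattice_subset_carr[OF U]
  have form: "w \<in> lin_forms X3" if "w \<in> carr (dual1 X3)" for w using that by (auto simp: annih_def)
  have "pullback X2 \<beta> w \<in> annih X2 U \<longleftrightarrow> w \<in> annih X3 (\<beta> ` U)" if w: "w \<in> lin_forms X3" for w
    using w pullback_\<beta>_form[OF w] UX by (auto simp: annih_def pullback_def)
  then show ?thesis
    using form annih_lattice_subset_dual[OF img_lattice[OF U]] by blast
qed

text \<open>Surjectivity is an extension problem: a form vanishing on \<open>pre U\<close>, carried
  to the image of \<alpha>, vanishes on the intersection of that image with \<open>U\<close>, so it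
  extends to a form vanishing on all of \<open>U\<close>.\<close>

lemma img_annih:
  assumes U: "is_lattice X2 U"
  shows "pullback X1 \<alpha> ` annih X2 U = annih X1 (pre U)"
proof
  show "pullback X1 \<alpha> ` annih X2 U \<subseteq> annih X1 (pre U)"
    using pullback_\<alpha>_form by (auto simp: annih_def pullback_def)
  show "annih X1 (pre U) \<subseteq> pullback X1 \<alpha> ` annih X2 U"
  proof
    fix w assume w: "w \<in> annih X1 (pre U)"
    then have wf: "w \<in> lin_forms X1" by (simp add: annih_def)
    let ?S = "\<alpha> ` carr X1"
    define g where "g x = w (inv_into (carr X1) \<alpha> x)" for x
    have g: "g (\<alpha> v) = w v" if "v \<in> carr X1" for v using that \<alpha>_inj by (simp add: g_def)
    have S: "X2.subspace ?S"
      unfolding X2.subspace_def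
    proof (intro conjI ballI allI)
      show "0 \<in> ?S" using X1.subspace_0[OF X1.subspace_carr] \<alpha>_0 by force
      fix x assume "x \<in> ?S"
      then obtain v where v: "v \<in> carr X1" "x = \<alpha> v" by blast
      show "scl X2 c x \<in> ?S" for c
        using v X1.subspace_scale[OF X1.subspace_carr v(1)] by (simp flip: \<alpha>_scale)
      fix y assume "y \<in> ?S"
      then obtain u where u: "u \<in> carr X1" "y = \<alpha> u" by blast
      show "x + y \<in> ?S"
        using u v X1.subspace_add[OF X1.subspace_carr v(1) u(1)] by (simp flip: \<alpha>_add)
    qed
    obtain w' where w': "w' \<in> lin_forms X2" "\<And>x. x \<in> ?S \<Longrightarrow> w' x = g x" "\<And>x. x \<in> U \<Longrightarrow> w' x = 0"
    proof (rule X2.extend_form_vanishing[OF S _ X2.lattice_subspace[OF U] X2.lattice_subset_carr[OF U], of g])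
      show "?S \<subseteq> carr X2" using \<alpha>_carr by blast
      show "g (x + y) = g x + g y" if xy: "x \<in> ?S" "y \<in> ?S" for x y
      proof -
        obtain u v where uv: "u \<in> carr X1" "x = \<alpha> u" "v \<in> carr X1" "y = \<alpha> v" using xy by blast
        have "x + y = \<alpha> (u + v)" using uv by (simp add: \<alpha>_add)
        then show ?thesis
          using g uv X1.subspace_add[OF X1.subspace_carr uv(1,3)] X1.form_add[OF wf uv(1,3)] by simp
      qed
      show "g (scl X2 c x) = c * g x" if x: "x \<in> ?S" for c x
      proof -
        obtain u where u: "u \<in> carr X1" "x = \<alpha> u" using x by blast
        have "scl X2 c x = \<alpha> (scl X1 c u)" using u by (simp add: \<alpha>_scale)
        then show ?thesis
          using g u X1.subspace_scale[OF X1.subspace_carr u(1)] X1.form_scale[OF wf u(1)] by simp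
      qed
      show "g x = 0" if "x \<in> ?S" "x \<in> U" for x using that w g by (auto simp: annih_def)
    qed blast
    have "w = pullback X1 \<alpha> w'"
      by (rule X1.form_eqI[OF wf pullback_\<alpha>_form[OF w'(1)]]) (use w'(2) g in \<open>simp add: pullback_def\<close>)
    moreover have "w' \<in> annih X2 U" using w' by (simp add: annih_def)
    ultimately show "w \<in> pullback X1 \<alpha> ` annih X2 U" by blast
  qed
qed

lemma pullback_\<beta>_carr:
  assumes "w \<in> carr (dual1 X3)"
  shows "pullback X2 \<beta> w \<in> carr (dual1 X2)"
proof -
  obtain i where i: "i \<in> idx X3" "w \<in> annih X3 (fil X3 i)" using assms by auto
  obtain j where j: "j \<in> idx X2" "\<beta> ` fil X2 j \<subseteq> fil X3 i" using img_below[OF i(1)] by blast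
  have "w \<in> annih X3 (\<beta> ` fil X2 j)" using i(2) annih_antimono[OF j(2)] by blast
  then have "pullback X2 \<beta> w \<in> annih X2 (fil X2 j)"
    using pre_annih[OF X2.lattice_fil[OF j(1)]] by blast
  then show ?thesis using j(1) by auto
qed

text \<open>The extension must again vanish on a filtration member. By \<open>pre_below\<close> a
  form on the subspace vanishes on the preimage of such a member, and \<open>img_annih\<close>
  extends it accordingly.\<close>

lemma pullback_\<alpha>_img: "pullback X1 \<alpha> ` carr (dual1 X2) = carr (dual1 X1)"
proof -
  have "pullback X1 \<alpha> ` carr (dual1 X2) = (\<Union>j\<in>idx X2. annih X1 (pre (fil X2 j)))"
    using img_annih[OF X2.lattice_fil] by (simp add: image_UN)
  also have "\<dots> = carr (dual1 X1)"
  proof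
    show "(\<Union>j\<in>idx X2. annih X1 (pre (fil X2 j))) \<subseteq> carr (dual1 X1)"
      using annih_lattice_subset_dual[OF pre_fil] by blast
    show "carr (dual1 X1) \<subseteq> (\<Union>j\<in>idx X2. annih X1 (pre (fil X2 j)))"
    proof
      fix w assume "w \<in> carr (dual1 X1)"
      then obtain i where i: "i \<in> idx X1" "w \<in> annih X1 (fil X1 i)" by auto
      obtain j where j: "j \<in> idx X2" "pre (fil X2 j) \<subseteq> fil X1 i" using pre_below[OF i(1)] by blast
      show "w \<in> (\<Union>j\<in>idx X2. annih X1 (pre (fil X2 j)))" using i(2) j annih_antimono[OF j(2)] by blast
    qed
  qed
  finally show ?thesis .
qed

text \<open>A form that is zero on the image of \<alpha> factors through \<beta>, and the factor
  vanishes on the image of a filtration member on which the form does.\<close>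

lemma pullback_\<alpha>_ker:
  assumes w: "w \<in> carr (dual1 X2)" and w0: "\<And>v. v \<in> carr X1 \<Longrightarrow> w (\<alpha> v) = 0"
  shows "w \<in> pullback X2 \<beta> ` carr (dual1 X3)"
proof -
  obtain j where j: "j \<in> idx X2" "w \<in> annih X2 (fil X2 j)" using w by auto
  then have wf: "w \<in> lin_forms X2" by (simp add: annih_def)
  define u where "u z = (if z \<in> carr X3 then w (inv_into (carr X2) \<beta> z) else 0)" for z
  have u: "u (\<beta> v) = w v" if v: "v \<in> carr X2" for v
  proof -
    define v' where "v' = inv_into (carr X2) \<beta> (\<beta> v)"
    have v': "v' \<in> carr X2" "\<beta> v' = \<beta> v"
      using v by (auto simp: v'_def f_inv_into_f intro: inv_into_into)
    have "v' - v \<in> carr X2" by (rule X2.subspace_diff[OF X2.subspace_carr v'(1) v])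
    moreover have "\<beta> (v' - v) = 0" using v' v by (simp add: \<beta>_diff)
    ultimately obtain a where "a \<in> carr X1" "v' - v = \<alpha> a" using ker_\<beta> by blast
    then have "w (v' - v) = 0" using w0 by simp
    then have "w v' = w v" using X2.form_diff[OF wf v'(1) v] by simp
    then show ?thesis using \<beta>_carr[OF v] by (simp add: u_def v'_def)
  qed
  have uf: "u \<in> lin_forms X3"
    unfolding lin_forms_def lin_map_def mem_Collect_eq
  proof (intro conjI ballI allI impI)
    fix x assume "x \<in> carr X3"
    then obtain a where a: "a \<in> carr X2" "x = \<beta> a" using \<beta>_img by blast
    have "u (\<beta> (scl X2 c a)) = c * w a" for c
      using u[OF X2.subspace_scale[OF X2.subspace_carr a(1)]] X2.form_scale[OF wf a(1)] by simp
    then show "u (scl X3 c x) = c * u x" for c using a u by (simp add: \<beta>_scale)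
    fix y assume "y \<in> carr X3"
    then obtain b where b: "b \<in> carr X2" "y = \<beta> b" using \<beta>_img by blast
    have "u (\<beta> (a + b)) = w a + w b"
      using u[OF X2.subspace_add[OF X2.subspace_carr a(1) b(1)]] X2.form_add[OF wf a(1) b(1)] by simp
    then show "u (x + y) = u x + u y" using a b u by (simp add: \<beta>_add)
  qed (simp_all add: u_def)
  have "u \<in> annih X3 (\<beta> ` fil X2 j)"
    using uf u j X2.fil_subset_carr[OF j(1)] by (auto simp: annih_def)
  then have "u \<in> carr (dual1 X3)" using annih_lattice_subset_dual[OF img_fil[OF j(1)]] by blast
  moreover have "w = pullback X2 \<beta> u"
    by (rule X2.form_eqI[OF wf pullback_\<beta>_form[OF uf]]) (simp add: pullback_def u)
  ultimately show ?thesis by blast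
qed

lemma pullback_\<alpha>_\<beta>:
  assumes w: "w \<in> lin_forms X3"
  shows "pullback X1 \<alpha> (pullback X2 \<beta> w) = 0"
  using \<alpha>_carr \<beta>_\<alpha> X3.form_0[OF w] by (auto simp: pullback_def)

lemma short_exact_dual:
  "short_exact (dual1 X3) (dual1 X2) (dual1 X1) (pullback X2 \<beta>) (pullback X1 \<alpha>)"
  unfolding short_exact_def
proof (intro conjI)
  have form: "w \<in> lin_forms X3" if "w \<in> carr (dual1 X3)" for w using that by (auto simp: annih_def)
  show "lin_map (scl (dual1 X3)) (carr (dual1 X3)) (scl (dual1 X2)) (carr (dual1 X2)) (pullback X2 \<beta>)"
    using pullback_\<beta>_carr by (auto simp: lin_map_def pullback_def simp del: dual1_simps(5))
  show "lin_map (scl (dual1 X2)) (carr (dual1 X2)) (scl (dual1 X1)) (carr (dual1 X1)) (pullback X1 \<alpha>)"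
    using pullback_\<alpha>_img by (auto simp: lin_map_def pullback_def simp del: dual1_simps(5))
  show "inj_on (pullback X2 \<beta>) (carr (dual1 X3))"
  proof (rule inj_onI)
    fix w w' assume w: "w \<in> carr (dual1 X3)" "w' \<in> carr (dual1 X3)" "pullback X2 \<beta> w = pullback X2 \<beta> w'"
    show "w = w'"
    proof (rule X3.form_eqI[OF form[OF w(1)] form[OF w(2)]])
      fix x assume "x \<in> carr X3"
      then obtain v where v: "v \<in> carr X2" "x = \<beta> v" using \<beta>_img by blast
      then show "w x = w' x" using fun_cong[OF w(3), of v] by (simp add: pullback_def)
    qed
  qed
  show "pullback X1 \<alpha> ` carr (dual1 X2) = carr (dual1 X1)" by (rule pullback_\<alpha>_img)
  show "{w \<in> carr (dual1 X2). pullback X1 \<alpha> w = 0} = pullback X2 \<beta> ` carr (dual1 X3)"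
  proof
    show "{w \<in> carr (dual1 X2). pullback X1 \<alpha> w = 0} \<subseteq> pullback X2 \<beta> ` carr (dual1 X3)"
    proof
      fix w assume w: "w \<in> {w \<in> carr (dual1 X2). pullback X1 \<alpha> w = 0}"
      then have "w (\<alpha> v) = 0" if "v \<in> carr X1" for v
        proof -
        have "pullback X1 \<alpha> w v = 0" using w by simp
        then show ?thesis using that by (simp add: pullback_def)
      qed
      then show "w \<in> pullback X2 \<beta> ` carr (dual1 X3)" using w pullback_\<alpha>_ker by blast
    qed
    show "pullback X2 \<beta> ` carr (dual1 X3) \<subseteq> {w \<in> carr (dual1 X2). pullback X1 \<alpha> w = 0}"
      using pullback_\<beta>_carr pullback_\<alpha>_\<beta> form by blast
  qed
qed

text \<open>Taking annihilators exchanges \<open>pre_fil\<close> with \<open>img_fil\<close>,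
  \<open>pre_below\<close> with \<open>img_above\<close>, and \<open>pre_above\<close> with
  \<open>img_below\<close>.\<close>

lemma c1_exact_dual:
  "c1_exact (dual1 X3) (dual1 X2) (dual1 X1) (pullback X2 \<beta>) (pullback X1 \<alpha>)"
proof
  show "c1_space (dual1 X3)" "c1_space (dual1 X2)" "c1_space (dual1 X1)"
    using X1.c1_dual X2.c1_dual X3.c1_dual by (simp_all add: c1_def)
  show "short_exact (dual1 X3) (dual1 X2) (dual1 X1) (pullback X2 \<beta>) (pullback X1 \<alpha>)"
    by (rule short_exact_dual)
  have P: "{w \<in> carr (dual1 X3). pullback X2 \<beta> w \<in> fil (dual1 X2) j} = annih X3 (\<beta> ` fil X2 j)"
    and Q: "pullback X1 \<alpha> ` fil (dual1 X2) j = annih X1 (pre (fil X2 j))" if "j \<in> idx X2" for j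
    using pre_annih[OF X2.lattice_fil[OF that]] img_annih[OF X2.lattice_fil[OF that]]
    by (simp_all del: dual1_simps(5))
  show "is_lattice (dual1 X3) {w \<in> carr (dual1 X3). pullback X2 \<beta> w \<in> fil (dual1 X2) j}"
    if "j \<in> idx (dual1 X2)" for j
    using X3.annih_lattice[OF img_fil] P that by simp
  show "is_lattice (dual1 X1) (pullback X1 \<alpha> ` fil (dual1 X2) j)" if "j \<in> idx (dual1 X2)" for j
    using X1.annih_lattice[OF pre_fil] Q that by simp
  show "\<exists>j\<in>idx (dual1 X2). {w \<in> carr (dual1 X3). pullback X2 \<beta> w \<in> fil (dual1 X2) j} \<subseteq> fil (dual1 X3) i"
    if i: "i \<in> idx (dual1 X3)" for i
  proof -
    obtain j where j: "j \<in> idx X2" "fil X3 i \<subseteq> \<beta> ` fil X2 j" using img_above[of i] i by auto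
    then show ?thesis using P[OF j(1)] annih_antimono[OF j(2)] by (intro bexI[of _ j]) (simp_all del: dual1_simps(5))
  qed
  show "\<exists>j\<in>idx (dual1 X2). pullback X2 \<beta> ` fil (dual1 X3) i \<subseteq> fil (dual1 X2) j"
    if i: "i \<in> idx (dual1 X3)" for i
  proof -
    obtain j where j: "j \<in> idx X2" "\<beta> ` fil X2 j \<subseteq> fil X3 i" using img_below[of i] i by auto
    have "annih X3 (fil X3 i) \<subseteq> annih X3 (\<beta> ` fil X2 j)" by (rule annih_antimono[OF j(2)])
    then have "pullback X2 \<beta> ` annih X3 (fil X3 i) \<subseteq> annih X2 (fil X2 j)"
      using P[OF j(1)] by auto
    then show ?thesis using j(1) by auto
  qed
  show "\<exists>j\<in>idx (dual1 X2). pullback X1 \<alpha> ` fil (dual1 X2) j \<subseteq> fil (dual1 X1) i"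
    if i: "i \<in> idx (dual1 X1)" for i
  proof -
    obtain j where j: "j \<in> idx X2" "\<alpha> ` fil X1 i \<subseteq> fil X2 j" using pre_above[of i] i by auto
    have "fil X1 i \<subseteq> pre (fil X2 j)" using j(2) X1.fil_subset_carr[of i] i by auto
    then show ?thesis using Q[OF j(1)] annih_antimono[of "fil X1 i"] j(1) by (intro bexI[of _ j]) simp_all
  qed
  show "\<exists>j\<in>idx (dual1 X2). fil (dual1 X1) i \<subseteq> pullback X1 \<alpha> ` fil (dual1 X2) j"
    if i: "i \<in> idx (dual1 X1)" for i
  proof -
    obtain j where j: "j \<in> idx X2" "pre (fil X2 j) \<subseteq> fil X1 i" using pre_below[of i] i by auto
    then show ?thesis using Q[OF j(1)] annih_antimono[OF j(2)] by (intro bexI[of _ j]) simp_all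
  qed
qed

end

section \<open>Virtual measures normalized by compatible lattices\<close>

text \<open>For lattices \<open>K i j\<close> in \<open>F(j)/F(i)\<close> compatible with inclusions and projections, the measures
  giving mass \<open>1\<close> to the \<open>K i j\<close> form a multiplicative system, which trivializes all virtual
  measures; \<open>theta\<close> is this trivialization.\<close>

definition theta ::
  "('f :: {field, finite}, 'v, 'w :: ab_group_add, 'i, 'k) c2 \<Rightarrow> ('i \<Rightarrow> 'i \<Rightarrow> 'w set) \<Rightarrow> 'i \<Rightarrow> 'i
   \<Rightarrow> ('i, 'w) vmeas" where
  "theta E K i j = (\<lambda>l a. if ile E l i \<and> ile E l j \<and> a \<in> meas (lev E l i)
     then (\<lambda>f. mass a (K l i) * haar (lev E l j) (K l j) f) else 0)"

text \<open>Common shape of everything compared in the theorem: the deltas of the triple and of its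
  dual take this form, and so does the Fourier transform, so that only the families \<open>K\<close>
  have to be matched.\<close>

definition lattice_delta ::
  "('f :: {field, finite}, 'v, 'w :: ab_group_add, 'i, 'k) c2 \<Rightarrow> ('i \<Rightarrow> 'i \<Rightarrow> 'w set) \<Rightarrow> 'i
   \<Rightarrow> 'i \<Rightarrow> 'i \<Rightarrow> 'w \<Rightarrow> ('i, 'w) vmeas" where
  "lattice_delta E K b = (\<lambda>i l. if ile E l i then tens (indicator (K l i)) (theta E K l b) else 0)"

lemma vscale_vscale: "vscale z (vscale w h) = vscale (z * w) h"
  by (simp add: vscale_def mult.assoc)

lemma vscale_1: "vscale 1 h = h"
  by (simp add: vscale_def)

lemma tens_vscale: "tens f (vscale c h) = tens (\<lambda>v. c * f v) h"
  by (simp add: tens_def vscale_vscale mult.commute)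

text \<open>Only the index order and the quotients with their maps occur, neither the ambient space
  nor \<open>quo\<close>. These assumptions can be verified for \<open>dual2 E\<close> directly from
  exactness of the dual triples.\<close>

locale level_system =
  fixes E :: "('f :: {field, finite}, 'v :: ab_group_add, 'w :: ab_group_add, 'i, 'k) c2"
    and K :: "'i \<Rightarrow> 'i \<Rightarrow> 'w set"
  assumes refl: "i \<in> idx E \<Longrightarrow> ile E i i"
    and trans: "ile E i j \<Longrightarrow> ile E j k \<Longrightarrow> ile E i k"
    and lower: "i \<in> idx E \<Longrightarrow> j \<in> idx E \<Longrightarrow> \<exists>k. ile E k i \<and> ile E k j"
    and upper: "i \<in> idx E \<Longrightarrow> j \<in> idx E \<Longrightarrow> \<exists>k. ile E i k \<and> ile E j k"
    and exact: "ile E i j \<Longrightarrow> ile E j k \<Longrightarrow>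
      c1_exact (lev E i j) (lev E i k) (lev E j k) (incl E i j k) (proj E i j k)"
    and lattice: "ile E i j \<Longrightarrow> is_lattice (lev E i j) (K i j)"
    and pre: "ile E i j \<Longrightarrow> ile E j k \<Longrightarrow> {v \<in> carr (lev E i j). incl E i j k v \<in> K i k} = K i j"
    and img: "ile E i j \<Longrightarrow> ile E j k \<Longrightarrow> proj E i j k ` K i k = K j k"
begin

abbreviation \<nu> :: "'i \<Rightarrow> 'i \<Rightarrow> 'w fnl" where
  "\<nu> i j \<equiv> haar (lev E i j) (K i j)"

abbreviation \<theta> :: "'i \<Rightarrow> 'i \<Rightarrow> ('i, 'w) vmeas" where
  "\<theta> \<equiv> theta E K"

lemma ile_idx: "ile E i j \<Longrightarrow> i \<in> idx E" "ile E i j \<Longrightarrow> j \<in> idx E"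
  by (auto simp: ile_def)

lemma c1_lev: "ile E i j \<Longrightarrow> c1 (lev E i j)"
  using exact[of i j j] refl[OF ile_idx(2)] by (auto simp: c1_def c1_exact_def)

lemma \<nu>_meas: "ile E i j \<Longrightarrow> \<nu> i j \<in> meas (lev E i j)"
  and \<nu>_mass: "ile E i j \<Longrightarrow> mass (\<nu> i j) (K i j) = 1"
  using c1.haar[OF c1_lev lattice] by auto

lemma \<nu>_smult: "ile E i j \<Longrightarrow> (\<lambda>f. c * \<nu> i j f) \<in> meas (lev E i j)"
  by (rule c1.meas_smult[OF c1_lev \<nu>_meas])

lemma \<nu>_smult_mass: "ile E i j \<Longrightarrow> mass (\<lambda>f. c * \<nu> i j f) (K i j) = c"
  using \<nu>_mass by (simp add: mass_def)

lemma meas_\<nu>: "ile E i j \<Longrightarrow> a \<in> meas (lev E i j) \<Longrightarrow> a = (\<lambda>f. mass a (K i j) * \<nu> i j f)"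
  by (rule c1.meas_haar[OF c1_lev lattice])

lemma \<nu>_cancel: "ile E i j \<Longrightarrow> (\<lambda>f. c * \<nu> i j f) = (\<lambda>f. d * \<nu> i j f) \<Longrightarrow> c = d"
  using \<nu>_smult_mass by metis

lemma lev_tensor_\<nu>:
  assumes "ile E i j" "ile E j k"
  shows "lev_tensor E i j k (\<lambda>f. z * \<nu> i j f) (\<lambda>f. w * \<nu> j k f) = (\<lambda>f. z * w * \<nu> i k f)"
  unfolding lev_tensor_def
  by (rule c1_exact.meas_tensor_haar[OF exact[OF assms] lattice[OF trans[OF assms]]
    pre[OF assms, symmetric] img[OF assms, symmetric]])

lemma lev_tensor_eq:
  assumes "ile E i j" "ile E j k" "a \<in> meas (lev E i j)" "c \<in> meas (lev E j k)"
  shows "lev_tensor E i j k a c = (\<lambda>f. mass a (K i j) * mass c (K j k) * \<nu> i k f)"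
  using lev_tensor_\<nu>[OF assms(1,2), of "mass a (K i j)" "mass c (K j k)"]
  by (simp flip: meas_\<nu>[OF assms(1,3)] meas_\<nu>[OF assms(2,4)])

section \<open>Trivialization of the lines of virtual measures\<close>

lemma scaled_\<theta>:
  assumes "ile E l i" "ile E l j" "a \<in> meas (lev E l i)"
  shows "vscale c (\<theta> i j) l a = (\<lambda>f. c * mass a (K l i) * \<nu> l j f)"
  using assms by (simp add: vscale_def theta_def mult.assoc)

lemma scaled_\<theta>_0:
  "\<not> (ile E l i \<and> ile E l j) \<Longrightarrow> vscale c (\<theta> i j) l = 0"
  "a \<notin> meas (lev E l i) \<Longrightarrow> vscale c (\<theta> i j) l a = 0"
  by (auto simp: vscale_def theta_def fun_eq_iff)

lemma vscale_\<theta>_inject: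
  assumes "i \<in> idx E" "j \<in> idx E" "vscale c (\<theta> i j) = vscale d (\<theta> i j)"
  shows "c = d"
proof -
  obtain l where l: "ile E l i" "ile E l j" using lower[OF assms(1,2)] by blast
  have "(\<lambda>f. c * \<nu> l j f) = (\<lambda>f. d * \<nu> l j f)"
    using fun_cong[OF fun_cong[OF assms(3), of l], of "\<nu> l i"]
    by (simp add: scaled_\<theta> l \<nu>_meas \<nu>_mass)
  then show ?thesis by (rule \<nu>_cancel[OF l(2)])
qed

text \<open>Compatibility with the transition maps is multiplicativity of the normalized measures,
  \<open>lev_tensor_eq\<close>.\<close>

lemma \<theta>_virt: "vscale c (\<theta> i j) \<in> virt E i j"
  unfolding virt_def mem_Collect_eq
proof (intro conjI allI impI ballI)
  fix l assume "\<not> (ile E l i \<and> ile E l j)"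
  then show "vscale c (\<theta> i j) l = 0" by (rule scaled_\<theta>_0)
next
  fix l assume l: "ile E l i \<and> ile E l j"
  then have li: "ile E l i" and lj: "ile E l j" by auto
  interpret L: c1 "lev E l i" by (rule c1_lev[OF li])
  show "vscale c (\<theta> i j) l \<in> meas_hom (meas (lev E l i)) (meas (lev E l j))"
    unfolding meas_hom_def mem_Collect_eq
  proof (intro conjI allI impI ballI)
    fix a assume a: "a \<in> meas (lev E l i)"
    show "vscale c (\<theta> i j) l a \<in> meas (lev E l j)"
      by (simp add: scaled_\<theta>[OF li lj a] \<nu>_smult[OF lj])
    show "vscale c (\<theta> i j) l (\<lambda>f. z * a f) = (\<lambda>f. z * vscale c (\<theta> i j) l a f)" for z
      by (simp add: scaled_\<theta>[OF li lj a] scaled_\<theta>[OF li lj L.meas_smult[OF a]] mass_def algebra_simps)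
    fix a' assume a': "a' \<in> meas (lev E l i)"
    have "a + a' \<in> meas (lev E l i)" using L.meas_lin[OF a a', of 1 1] by (simp add: plus_fun_def)
    then show "vscale c (\<theta> i j) l (a + a') = vscale c (\<theta> i j) l a + vscale c (\<theta> i j) l a'"
      by (simp add: scaled_\<theta>[OF li lj] a a') (simp add: mass_def plus_fun_def algebra_simps)
  qed (rule scaled_\<theta>_0)
next
  fix l l' a e
  assume l: "ile E l' l \<and> ile E l i \<and> ile E l j" and e: "e \<in> meas (lev E l' l)" and a: "a \<in> meas (lev E l i)"
  then have le: "ile E l' l" "ile E l i" "ile E l j" "ile E l' i" "ile E l' j" using trans by blast+
  have "vscale c (\<theta> i j) l' (lev_tensor E l' l i e a) = (\<lambda>f. c * (mass e (K l' l) * mass a (K l i)) * \<nu> l' j f)"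
    by (simp add: lev_tensor_eq[OF le(1,2) e a] scaled_\<theta>[OF le(4,5) \<nu>_smult[OF le(4)]] \<nu>_smult_mass[OF le(4)])
  also have "\<dots> = lev_tensor E l' l j e (vscale c (\<theta> i j) l a)"
    by (simp only: scaled_\<theta>[OF le(2,3) a] lev_tensor_eq[OF le(1,3) e \<nu>_smult[OF le(3)]]
        \<nu>_smult_mass[OF le(3)]) (simp add: algebra_simps)
  finally show "vscale c (\<theta> i j) l' (lev_tensor E l' l i e a) = lev_tensor E l' l j e (vscale c (\<theta> i j) l a)" .
qed

text \<open>Each component is a linear map between lines, hence a scalar \<open>c l\<close>; the
  transition maps force c l' = c l for l' below l, and downward directedness makes all these scalars
  equal.\<close>

lemma virt_E:
  assumes h: "h \<in> virt E i j" and ij: "i \<in> idx E" "j \<in> idx E"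
  obtains c where "h = vscale c (\<theta> i j)"
proof -
  have h0: "h l = 0" if "\<not> (ile E l i \<and> ile E l j)" for l using h that by (simp add: virt_def)
  have hom: "h l \<in> meas_hom (meas (lev E l i)) (meas (lev E l j))" if "ile E l i" "ile E l j" for l
    using h that by (simp add: virt_def)
  define c where "c l = mass (h l (\<nu> l i)) (K l j)" for l
  have hl: "h l a = (\<lambda>f. mass a (K l i) * c l * \<nu> l j f)"
    if l: "ile E l i" "ile E l j" and a: "a \<in> meas (lev E l i)" for l a
  proof -
    have "h l (\<nu> l i) = (\<lambda>f. c l * \<nu> l j f)"
      unfolding c_def by (rule meas_\<nu>[OF l(2)]) (use hom[OF l] \<nu>_meas[OF l(1)] in \<open>simp add: meas_hom_def\<close>)
    moreover have "h l (\<lambda>f. mass a (K l i) * \<nu> l i f) = (\<lambda>f. mass a (K l i) * h l (\<nu> l i) f)"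
      using hom[OF l] \<nu>_meas[OF l(1)] by (simp add: meas_hom_def)
    ultimately show ?thesis by (simp add: mult.assoc flip: meas_\<nu>[OF l(1) a])
  qed
  have c_eq: "c l' = c l" if l: "ile E l' l" "ile E l i" "ile E l j" for l l'
  proof -
    have l': "ile E l' i" "ile E l' j" using l trans by blast+
    have "h l' (lev_tensor E l' l i (\<nu> l' l) (\<nu> l i)) = lev_tensor E l' l j (\<nu> l' l) (h l (\<nu> l i))"
      using h l \<nu>_meas by (simp add: virt_def)
    moreover have "h l' (lev_tensor E l' l i (\<nu> l' l) (\<nu> l i)) = (\<lambda>f. c l' * \<nu> l' j f)"
      using hl[OF l' \<nu>_meas[OF l'(1)]] by (simp add: lev_tensor_eq[OF l(1,2) \<nu>_meas \<nu>_meas] l l' \<nu>_mass)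
    moreover have "lev_tensor E l' l j (\<nu> l' l) (h l (\<nu> l i)) = (\<lambda>f. c l * \<nu> l' j f)"
      by (simp add: hl[OF l(2,3) \<nu>_meas[OF l(2)]] \<nu>_mass[OF l(2)]
          lev_tensor_eq[OF l(1,3) \<nu>_meas[OF l(1)] \<nu>_smult[OF l(3)]] \<nu>_mass[OF l(1)] \<nu>_smult_mass[OF l(3)])
    ultimately have "(\<lambda>f. c l' * \<nu> l' j f) = (\<lambda>f. c l * \<nu> l' j f)" by simp
    then show ?thesis by (rule \<nu>_cancel[OF l'(2)])
  qed
  obtain m where m: "ile E m i" "ile E m j" using lower[OF ij] by blast
  have c_m: "c l = c m" if l: "ile E l i" "ile E l j" for l
  proof -
    obtain k where k: "ile E k l" "ile E k m" using lower[OF ile_idx(1)[OF l(1)] ile_idx(1)[OF m(1)]] by blast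
    show ?thesis using c_eq[OF k(1) l] c_eq[OF k(2) m] by simp
  qed
  have "h = vscale (c m) (\<theta> i j)"
  proof (intro ext)
    fix l a f
    show "h l a f = vscale (c m) (\<theta> i j) l a f"
    proof (cases "ile E l i \<and> ile E l j")
      case True
      then have l: "ile E l i" "ile E l j" by auto
      show ?thesis
      proof (cases "a \<in> meas (lev E l i)")
        case a: True
        show ?thesis by (simp add: hl[OF l a] scaled_\<theta>[OF l a] c_m[OF l] mult.commute)
      next
        case False
        then show ?thesis using hom[OF l] scaled_\<theta>_0(2) by (simp add: meas_hom_def)
      qed
    next
      case False
      then show ?thesis by (simp add: h0 scaled_\<theta>_0(1))
    qed
  qed
  then show ?thesis by (rule that)
qed

lemma virt_of_\<nu>:
  assumes ij: "ile E i j"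
  shows "virt_of E i j (\<lambda>f. c * \<nu> i j f) = vscale c (\<theta> i j)"
proof (intro ext)
  fix l a f
  show "virt_of E i j (\<lambda>f. c * \<nu> i j f) l a f = vscale c (\<theta> i j) l a f"
  proof (cases "ile E l i \<and> a \<in> meas (lev E l i)")
    case True
    then have l: "ile E l i" "ile E l j" and a: "a \<in> meas (lev E l i)" using trans[OF _ ij] by auto
    show ?thesis
      using l a by (simp add: virt_of_def lev_tensor_eq[OF l(1) ij a \<nu>_smult[OF ij]]
          \<nu>_smult_mass[OF ij] scaled_\<theta>[OF l a] mult.commute mult.left_commute)
  next
    case False
    then show ?thesis using scaled_\<theta>_0 by (auto simp: virt_of_def)
  qed
qed

lemma virt_comp_\<theta>:
  assumes ijk: "i \<in> idx E" "j \<in> idx E" "k \<in> idx E"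
  shows "virt_comp E i j k (vscale c (\<theta> i j)) (vscale d (\<theta> j k)) = vscale (c * d) (\<theta> i k)"
proof -
  have comp: "vscale d (\<theta> j k) l (vscale c (\<theta> i j) l a) = (\<lambda>f. c * d * mass a (K l i) * \<nu> l k f)"
    if l: "ile E l i" "ile E l j" "ile E l k" and a: "a \<in> meas (lev E l i)" for l a
    by (simp only: scaled_\<theta>[OF l(1,2) a] scaled_\<theta>[OF l(2,3) \<nu>_smult[OF l(2)]] \<nu>_smult_mass[OF l(2)])
      (simp add: algebra_simps)
  show ?thesis
    unfolding virt_comp_def
  proof (rule the_equality)
    show "vscale (c * d) (\<theta> i k) \<in> virt E i k \<and> (\<forall>l. ile E l i \<and> ile E l j \<and> ile E l k \<longrightarrow>
      (\<forall>a\<in>meas (lev E l i). vscale (c * d) (\<theta> i k) l a = vscale d (\<theta> j k) l (vscale c (\<theta> i j) l a)))"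
    proof (intro conjI allI impI ballI)
      fix l a assume "ile E l i \<and> ile E l j \<and> ile E l k" and a: "a \<in> meas (lev E l i)"
      then have l: "ile E l i" "ile E l j" "ile E l k" by auto
      show "vscale (c * d) (\<theta> i k) l a = vscale d (\<theta> j k) l (vscale c (\<theta> i j) l a)"
        unfolding comp[OF l a] by (rule scaled_\<theta>[OF l(1,3) a])
    qed (rule \<theta>_virt)
    fix t assume t: "t \<in> virt E i k \<and> (\<forall>l. ile E l i \<and> ile E l j \<and> ile E l k \<longrightarrow>
      (\<forall>a\<in>meas (lev E l i). t l a = vscale d (\<theta> j k) l (vscale c (\<theta> i j) l a)))"
    obtain e where e: "t = vscale e (\<theta> i k)" using virt_E[OF conjunct1[OF t] ijk(1,3)] by blast
    \<comment> \<open>The condition in \<open>virt_comp\<close> speaks only of indices below all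
      three; evaluating at one such \<open>l\<close> already fixes the scalar.\<close>
    obtain m where m: "ile E m i" "ile E m j" using lower[OF ijk(1,2)] by blast
    obtain l where l: "ile E l m" "ile E l k" using lower[OF ile_idx(1)[OF m(1)] ijk(3)] by blast
    have li: "ile E l i" "ile E l j" using l m trans by blast+
    have "t l (\<nu> l i) = (\<lambda>f. c * d * \<nu> l k f)"
      using t li l \<nu>_meas by (simp add: comp \<nu>_mass)
    moreover have "t l (\<nu> l i) = (\<lambda>f. e * \<nu> l k f)"
      unfolding e using scaled_\<theta>[OF li(1) l(2) \<nu>_meas[OF li(1)]] by (simp add: \<nu>_mass[OF li(1)])
    ultimately have "(\<lambda>f. e * \<nu> l k f) = (\<lambda>f. c * d * \<nu> l k f)" by simp
    then have "e = c * d" by (rule \<nu>_cancel[OF l(2)])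
    then show "t = vscale (c * d) (\<theta> i k)" using e by simp
  qed
qed

text \<open>The values on comparable pairs determine the system: for arbitrary \<open>i\<close>,
  \<open>j\<close> and \<open>l\<close> below both, multiplicativity along l, i, j leaves only the
  coefficient 1.\<close>

lemma mult_system_\<theta>:
  assumes N: "\<And>i j. ile E i j \<Longrightarrow> N i j = \<nu> i j"
  shows "mult_system E N = \<theta>"
  unfolding mult_system_def
proof (rule the_equality)
  have \<theta>1: "virt_of E i j (N i j) = \<theta> i j" if "ile E i j" for i j
    using virt_of_\<nu>[OF that, of 1] N[OF that] by (simp add: vscale_1)
  have "\<theta> i j = 0" if "\<not> (i \<in> idx E \<and> j \<in> idx E)" for i j
    using that ile_idx by (intro ext) (auto simp: theta_def)
  moreover have "\<theta> i j \<in> virt E i j" for i j using \<theta>_virt[of 1] by (simp add: vscale_1)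
  moreover have "virt_comp E i j k (\<theta> i j) (\<theta> j k) = \<theta> i k"
    if "i \<in> idx E" "j \<in> idx E" "k \<in> idx E" for i j k
    using virt_comp_\<theta>[OF that, of 1 1] by (simp add: vscale_1)
  ultimately show "(\<forall>i j. \<not> (i \<in> idx E \<and> j \<in> idx E) \<longrightarrow> \<theta> i j = 0) \<and>
      (\<forall>i\<in>idx E. \<forall>j\<in>idx E. \<theta> i j \<in> virt E i j) \<and>
      (\<forall>i\<in>idx E. \<forall>j\<in>idx E. \<forall>k\<in>idx E. virt_comp E i j k (\<theta> i j) (\<theta> j k) = \<theta> i k) \<and>
      (\<forall>i j. ile E i j \<longrightarrow> \<theta> i j = virt_of E i j (N i j))"
    using \<theta>1 by simp
  fix t assume t: "(\<forall>i j. \<not> (i \<in> idx E \<and> j \<in> idx E) \<longrightarrow> t i j = 0) \<and>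
      (\<forall>i\<in>idx E. \<forall>j\<in>idx E. t i j \<in> virt E i j) \<and>
      (\<forall>i\<in>idx E. \<forall>j\<in>idx E. \<forall>k\<in>idx E. virt_comp E i j k (t i j) (t j k) = t i k) \<and>
      (\<forall>i j. ile E i j \<longrightarrow> t i j = virt_of E i j (N i j))"
  have "t i j = \<theta> i j" for i j
  proof (cases "i \<in> idx E \<and> j \<in> idx E")
    case True
    then have ij: "i \<in> idx E" "j \<in> idx E" by auto
    obtain c where c: "t i j = vscale c (\<theta> i j)" using virt_E[of "t i j" i j] t ij by blast
    obtain l where l: "ile E l i" "ile E l j" using lower[OF ij] by blast
    note lI = ile_idx(1)[OF l(1)]
    have tl: "t l i = vscale 1 (\<theta> l i)" "t l j = vscale 1 (\<theta> l j)"
      using t l \<theta>1 by (simp_all add: vscale_1)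
    have "virt_comp E l i j (t l i) (t i j) = t l j" using t ij lI by blast
    then have "vscale (1 * c) (\<theta> l j) = vscale 1 (\<theta> l j)"
      unfolding tl c virt_comp_\<theta>[OF lI ij] .
    then have "c = 1" using vscale_\<theta>_inject[OF lI ij(2)] by fastforce
    then show ?thesis using c by (simp add: vscale_1)
  next
    case False
    then have "t i j = 0" using t by blast
    then show ?thesis using False ile_idx by (intro ext) (auto simp: theta_def)
  qed
  then show "t = \<theta>" by (intro ext) simp
qed

section \<open>The delta family of a system of lattices\<close>

lemma tens_\<theta>_inject:
  assumes "i \<in> idx E" "j \<in> idx E" "tens f (\<theta> i j) = tens g (\<theta> i j)"
  shows "f = g"
proof
  fix v
  show "f v = g v"
    using vscale_\<theta>_inject[OF assms(1,2)] fun_cong[OF assms(3), of v] by (simp add: tens_def)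
qed

text \<open>The description ranges over all pure representations. Writing the measure as c times the
  normalized one and the virtual measure as d times \<open>\<theta>\<close>, each representation
  satisfies indicator = c d f, and the result depends on c, d and f only through this product, by
  linearity of \<open>push1\<close>.\<close>

lemma push2_delta:
  assumes lj: "ile E l j" and ji: "ile E j i" and b: "b \<in> idx E"
  shows "push2 E b i j l (tens (indicator (K l i)) (\<theta> l b)) = tens (indicator (K j i)) (\<theta> j b)"
  unfolding push2_def
proof (rule the_equality)
  note li = trans[OF lj ji]
  interpret X: c1_exact "lev E l j" "lev E l i" "lev E j i" "incl E l j i" "proj E l j i"
    by (rule exact[OF lj ji])
  note I = ile_idx(1)[OF lj] ile_idx(2)[OF lj] b
  let ?push = "push1 (lev E l j) (lev E l i) (lev E j i) (incl E l j i) (proj E l j i)"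
  have push: "?push (indicator (K l i)) (\<nu> l j) = indicator (K j i)"
    using X.push1_indicator[OF lattice[OF li]] by (simp add: pre[OF lj ji] img[OF lj ji])
  have vc: "virt_comp E l j b (virt_of E l j (\<lambda>f. c * \<nu> l j f)) (vscale d (\<theta> j b)) = vscale (c * d) (\<theta> l b)"
    for c d unfolding virt_of_\<nu>[OF lj] by (rule virt_comp_\<theta>[OF I])
  show "\<exists>f \<nu>' h. f \<in> sch (lev E l i) \<and> \<nu>' \<in> meas (lev E l j) \<and> h \<in> virt E j b \<and>
      tens (indicator (K l i)) (\<theta> l b) = tens f (virt_comp E l j b (virt_of E l j \<nu>') h) \<and>
      tens (indicator (K j i)) (\<theta> j b) = tens (?push f \<nu>') h"
    by (intro exI[of _ "indicator (K l i)"] exI[of _ "\<nu> l j"] exI[of _ "\<theta> j b"])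
      (use vc[of 1 1] X.X2.sch_indicator[OF lattice[OF li]] \<nu>_meas[OF lj] \<theta>_virt[of 1 j b] push
        in \<open>simp add: vscale_1\<close>)
  fix t assume "\<exists>f \<nu>' h. f \<in> sch (lev E l i) \<and> \<nu>' \<in> meas (lev E l j) \<and> h \<in> virt E j b \<and>
      tens (indicator (K l i)) (\<theta> l b) = tens f (virt_comp E l j b (virt_of E l j \<nu>') h) \<and>
      t = tens (?push f \<nu>') h"
  then obtain f \<nu>' h where f: "\<nu>' \<in> meas (lev E l j)" "h \<in> virt E j b"
      "tens (indicator (K l i)) (\<theta> l b) = tens f (virt_comp E l j b (virt_of E l j \<nu>') h)"
      and t: "t = tens (?push f \<nu>') h" by blast
  obtain c where c: "\<nu>' = (\<lambda>f. c * \<nu> l j f)" using meas_\<nu>[OF lj f(1)] by blast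
  obtain d where d: "h = vscale d (\<theta> j b)" using virt_E[OF f(2) I(2,3)] by blast
  have "indicator (K l i) = (\<lambda>v. (c * d) * f v)"
    using tens_\<theta>_inject[OF I(1,3)] f(3) unfolding c d vc tens_vscale .
  then have "?push (indicator (K l i)) (\<nu> l j) = (\<lambda>w. (c * d) * ?push f (\<nu> l j) w)"
    using X.push1_scale[OF \<nu>_meas[OF lj], of "c * d" f] by simp
  then have "(\<lambda>w. d * ?push f (\<lambda>f. c * \<nu> l j f) w) = indicator (K j i)"
    unfolding push by (simp add: fun_eq_iff push1_def algebra_simps)
  then show "t = tens (indicator (K j i)) (\<theta> j b)"
    unfolding t c d tens_vscale by simp
qed

lemma lattice_delta_sch2:
  assumes b: "b \<in> idx E"
  shows "lattice_delta E K b \<in> sch2 E b"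
  unfolding sch2_def mem_Collect_eq
proof (intro conjI allI impI)
  fix i l assume "\<not> ile E l i"
  then show "lattice_delta E K b i l = 0" by (simp add: lattice_delta_def)
next
  fix i l assume li: "ile E l i"
  have "indicator (K l i) \<in> sch (lev E l i)" by (rule c1.sch_indicator[OF c1_lev[OF li] lattice[OF li]])
  moreover have "\<theta> l b \<in> virt E l b" using \<theta>_virt[of 1] by (simp add: vscale_1)
  ultimately show "lattice_delta E K b i l \<in> tens_space (sch (lev E l i)) (virt E l b)"
    using li by (auto simp: lattice_delta_def tens_space_def)
next
  fix i j l assume "ile E l j \<and> ile E j i"
  then have lj: "ile E l j" and ji: "ile E j i" by auto
  note li = trans[OF lj ji]
  show "push2 E b i j l (lattice_delta E K b i l) = lattice_delta E K b i j"
    using push2_delta[OF lj ji b] li ji by (simp add: lattice_delta_def)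
  show "pullback (lev E l j) (incl E l j i) (lattice_delta E K b i l) = lattice_delta E K b j l"
  proof
    fix v
    have zero: "vscale 0 h = 0" for h :: "('i, 'w) vmeas" by (intro ext) (simp add: vscale_def)
    have "v \<in> K l j \<longleftrightarrow> v \<in> carr (lev E l j) \<and> incl E l j i v \<in> K l i" using pre[OF lj ji] by blast
    then show "pullback (lev E l j) (incl E l j i) (lattice_delta E K b i l) v = lattice_delta E K b j l v"
      using li lj by (simp add: lattice_delta_def pullback_def tens_def zero indicator_def)
  qed
qed

end

section \<open>Dual systems of lattices and the Fourier transform\<close>

lemma dual2_simps [simp]:
  "idx (dual2 E) = idx E" "lev (dual2 E) i j = dual1 (lev E j i)"
  "incl (dual2 E) i j k = pullback (lev E k i) (proj E k j i)"
  "proj (dual2 E) i j k = pullback (lev E k j) (incl E k j i)"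
  by (simp_all add: dual2_def)

lemma ile_dual2 [simp]: "ile (dual2 E) i j \<longleftrightarrow> ile E j i"
  by (auto simp: ile_def dual2_def)

definition annih_system ::
  "('f :: {field, finite}, 'v, 'w :: ab_group_add, 'i, 'k) c2 \<Rightarrow> ('i \<Rightarrow> 'i \<Rightarrow> 'w set)
   \<Rightarrow> 'i \<Rightarrow> 'i \<Rightarrow> ('w \<Rightarrow> 'f) set" where
  "annih_system E K i j = annih (lev E j i) (K j i)"

context level_system
begin

text \<open>The order is reversed, and annihilators turn the condition on images into the one on
  preimages and conversely.\<close>

lemma level_system_dual: "level_system (dual2 E) (annih_system E K)"
proof (rule level_system.intro)
  fix i j k assume "ile (dual2 E) i j" "ile (dual2 E) j k"
  then have kj: "ile E k j" and ji: "ile E j i" by auto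
  note ki = trans[OF kj ji]
  interpret X: c1_exact "lev E k j" "lev E k i" "lev E j i" "incl E k j i" "proj E k j i"
    by (rule exact[OF kj ji])
  show "ile (dual2 E) i k" using ki by simp
  show "c1_exact (lev (dual2 E) i j) (lev (dual2 E) i k) (lev (dual2 E) j k)
      (incl (dual2 E) i j k) (proj (dual2 E) i j k)"
    using X.c1_exact_dual by simp
  show "{w \<in> carr (lev (dual2 E) i j). incl (dual2 E) i j k w \<in> annih_system E K i k} = annih_system E K i j"
    using X.pre_annih[OF lattice[OF ki]] img[OF kj ji] by (simp add: annih_system_def del: dual1_simps)
  show "proj (dual2 E) i j k ` annih_system E K i k = annih_system E K j k"
    using X.img_annih[OF lattice[OF ki]] pre[OF kj ji] by (simp add: annih_system_def)
next
  fix i j assume "ile (dual2 E) i j"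
  then have ji: "ile E j i" by simp
  show "is_lattice (lev (dual2 E) i j) (annih_system E K i j)"
    using c1.annih_lattice[OF c1_lev[OF ji] lattice[OF ji]] by (simp add: annih_system_def)
qed (use refl lower upper in auto)

text \<open>Composition gives r the coefficient c y when s has coefficient y, and normalized
  measures on a space and its dual pair to 1. Comparing coefficients shows that the transposed
  family has the scalar c, not its inverse.\<close>

lemma virt_dual_\<theta>:
  assumes ij: "i \<in> idx E" "j \<in> idx E"
  shows "virt_dual E i j (vscale c (\<theta> i j)) = vscale c (theta (dual2 E) (annih_system E K) i j)"
proof -
  interpret D: level_system "dual2 E" "annih_system E K" by (rule level_system_dual)
  let ?P = "\<lambda>h'. h' \<in> virt (dual2 E) i j \<and>
    (\<forall>k. ile E i k \<and> ile E j k \<longrightarrow>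
      (\<forall>n\<in>meas (dual1 (lev E i k)). \<forall>s\<in>meas (lev E j k). \<forall>r\<in>meas (lev E i k).
        virt_of E i k r = virt_comp E i j k (vscale c (\<theta> i j)) (virt_of E j k s) \<longrightarrow>
        meas_pair (lev E j k) s (h' k n) = meas_pair (lev E i k) r n))"
  have D\<nu>: "D.\<nu> k l = haar (dual1 (lev E l k)) (annih (lev E l k) (K l k))" for k l
    by (simp add: annih_system_def)
  have pair: "meas_pair (lev E j k) (\<lambda>f. y * \<nu> j k f) (vscale e (D.\<theta> i j) k (\<lambda>f. z * D.\<nu> k i f)) = y * (e * z)"
    if k: "ile E i k" "ile E j k" for k y z e
  proof -
    have k': "ile (dual2 E) k i" "ile (dual2 E) k j" using k by auto
    have "vscale e (D.\<theta> i j) k (\<lambda>f. z * D.\<nu> k i f) = (\<lambda>f. e * z * D.\<nu> k j f)"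
      by (simp only: D.scaled_\<theta>[OF k' D.\<nu>_smult[OF k'(1)]] D.\<nu>_smult_mass[OF k'(1)])
    moreover have "meas_pair (lev E j k) (\<lambda>f. y * \<nu> j k f) (\<lambda>f. e * z * D.\<nu> k j f) = y * (e * z)"
      unfolding D\<nu> by (rule c1.meas_pair_haar[OF c1_lev[OF k(2)] lattice[OF k(2)]])
    ultimately show ?thesis by (simp only:)
  qed
  have comp: "virt_comp E i j k (vscale c (\<theta> i j)) (virt_of E j k (\<lambda>f. y * \<nu> j k f)) = vscale (c * y) (\<theta> i k)"
    if k: "ile E i k" "ile E j k" for k y
    unfolding virt_of_\<nu>[OF k(2)] by (rule virt_comp_\<theta>[OF ij ile_idx(2)[OF k(1)]])
  have P: "?P (vscale c (D.\<theta> i j))"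
  proof (intro conjI allI impI ballI)
    show "vscale c (D.\<theta> i j) \<in> virt (dual2 E) i j" by (rule D.\<theta>_virt)
    fix k n s r
    assume k: "ile E i k \<and> ile E j k" and n: "n \<in> meas (dual1 (lev E i k))"
      and s: "s \<in> meas (lev E j k)" and r: "r \<in> meas (lev E i k)"
      and eq: "virt_of E i k r = virt_comp E i j k (vscale c (\<theta> i j)) (virt_of E j k s)"
    have k1: "ile E i k" and k2: "ile E j k" using k by auto
    obtain x where x: "r = (\<lambda>f. x * \<nu> i k f)" using meas_\<nu>[OF k1 r] by blast
    obtain y where y: "s = (\<lambda>f. y * \<nu> j k f)" using meas_\<nu>[OF k2 s] by blast
    obtain z where z: "n = (\<lambda>f. z * D.\<nu> k i f)" using D.meas_\<nu>[of k i n] k1 n by auto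
    have "x = c * y"
      using eq unfolding x y comp[OF k1 k2] virt_of_\<nu>[OF k1]
      by (rule vscale_\<theta>_inject[OF ij(1) ile_idx(2)[OF k1]])
    moreover have "meas_pair (lev E i k) r n = x * z"
      unfolding x z D\<nu> by (rule c1.meas_pair_haar[OF c1_lev[OF k1] lattice[OF k1]])
    ultimately show "meas_pair (lev E j k) s (vscale c (D.\<theta> i j) k n) = meas_pair (lev E i k) r n"
      unfolding y z pair[OF k1 k2] by simp
  qed
  have "t = vscale c (D.\<theta> i j)" if t: "?P t" for t
  proof -
    obtain e where e: "t = vscale e (D.\<theta> i j)" using D.virt_E[OF conjunct1[OF t]] ij by auto
    obtain k where k: "ile E i k" "ile E j k" using upper[OF ij] by blast
    have k': "ile (dual2 E) k i" using k by simp
    have "meas_pair (lev E j k) (\<lambda>f. 1 * \<nu> j k f) (t k (\<lambda>f. 1 * D.\<nu> k i f)) =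
        meas_pair (lev E i k) (\<lambda>f. c * \<nu> i k f) (\<lambda>f. 1 * D.\<nu> k i f)"
    proof (rule conjunct2[OF t, rule_format, OF conjI[OF k] _ \<nu>_smult[OF k(2)] \<nu>_smult[OF k(1)]])
      show "(\<lambda>f. 1 * D.\<nu> k i f) \<in> meas (dual1 (lev E i k))"
        using D.\<nu>_smult[OF k', of 1] by (simp only: dual2_simps)
      show "virt_of E i k (\<lambda>f. c * \<nu> i k f) =
          virt_comp E i j k (vscale c (\<theta> i j)) (virt_of E j k (\<lambda>f. 1 * \<nu> j k f))"
        unfolding comp[OF k] virt_of_\<nu>[OF k(1)] by simp
    qed
    moreover have "meas_pair (lev E i k) (\<lambda>f. c * \<nu> i k f) (\<lambda>f. 1 * D.\<nu> k i f) = c * 1"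
      unfolding D\<nu> by (rule c1.meas_pair_haar[OF c1_lev[OF k(1)] lattice[OF k(1)]])
    ultimately have "1 * (e * 1) = c * 1" unfolding e pair[OF k] by argo
    then show ?thesis using e by simp
  qed
  with P show ?thesis unfolding virt_dual_def by (rule the_equality)
qed

text \<open>The normalized representation, with indicator, normalized measure and
  \<open>\<theta>\<close>, is evaluated by \<open>fourier1_haar\<close> and
  \<open>virt_dual_\<theta>\<close>; any other representation differs by scalars that recombine by
  linearity.\<close>

lemma fourier2_lattice_delta:
  assumes \<psi>: "nontrivial_character \<psi>" and b: "b \<in> idx E"
  shows "fourier2 \<psi> E b (lattice_delta E K b) = lattice_delta (dual2 E) (annih_system E K) b"
proof (rule ext, rule ext)
  interpret D: level_system "dual2 E" "annih_system E K" by (rule level_system_dual)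
  fix j i
  let ?F = "fourier1 \<psi> (lev E j i)"
  have "(THE t'. \<exists>f \<rho> h. f \<in> sch (lev E j i) \<and> \<rho> \<in> meas (lev E j i) \<and> h \<in> virt E i b \<and>
        lattice_delta E K b i j = tens f (virt_comp E j i b (virt_of E j i \<rho>) h) \<and>
        t' = tens (?F \<rho> f) (virt_dual E i b h)) =
      tens (indicator (annih_system E K i j)) (D.\<theta> i b)" if ji: "ile E j i"
  proof (rule the_equality)
    note I = ile_idx[OF ji] b
    interpret X: c1 "lev E j i" by (rule c1_lev[OF ji])
    have delta: "lattice_delta E K b i j = tens (indicator (K j i)) (\<theta> j b)"
      using ji by (simp add: lattice_delta_def)
    have F: "?F (\<nu> j i) (indicator (K j i)) = indicator (annih_system E K i j)"
      unfolding annih_system_def by (rule X.fourier1_haar[OF \<psi> lattice[OF ji]])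
    have vc: "virt_comp E j i b (virt_of E j i (\<lambda>f. c * \<nu> j i f)) (vscale d (\<theta> i b)) = vscale (c * d) (\<theta> j b)"
      for c d unfolding virt_of_\<nu>[OF ji] by (rule virt_comp_\<theta>[OF I])
    show "\<exists>f \<rho> h. f \<in> sch (lev E j i) \<and> \<rho> \<in> meas (lev E j i) \<and> h \<in> virt E i b \<and>
        lattice_delta E K b i j = tens f (virt_comp E j i b (virt_of E j i \<rho>) h) \<and>
        tens (indicator (annih_system E K i j)) (D.\<theta> i b) = tens (?F \<rho> f) (virt_dual E i b h)"
      by (intro exI[of _ "indicator (K j i)"] exI[of _ "\<nu> j i"] exI[of _ "\<theta> i b"])
        (use vc[of 1 1] X.sch_indicator[OF lattice[OF ji]] \<nu>_meas[OF ji] \<theta>_virt[of 1 i b] F delta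
          virt_dual_\<theta>[OF I(2,3), of 1] in \<open>simp add: vscale_1\<close>)
    fix t assume "\<exists>f \<rho> h. f \<in> sch (lev E j i) \<and> \<rho> \<in> meas (lev E j i) \<and> h \<in> virt E i b \<and>
        lattice_delta E K b i j = tens f (virt_comp E j i b (virt_of E j i \<rho>) h) \<and>
        t = tens (?F \<rho> f) (virt_dual E i b h)"
    then obtain f \<rho> h where f: "\<rho> \<in> meas (lev E j i)" "h \<in> virt E i b"
        "tens (indicator (K j i)) (\<theta> j b) = tens f (virt_comp E j i b (virt_of E j i \<rho>) h)"
      and t: "t = tens (?F \<rho> f) (virt_dual E i b h)" unfolding delta by blast
    obtain c where c: "\<rho> = (\<lambda>f. c * \<nu> j i f)" using meas_\<nu>[OF ji f(1)] by blast
    obtain d where d: "h = vscale d (\<theta> i b)" using virt_E[OF f(2) I(2,3)] by blast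
    have "indicator (K j i) = (\<lambda>v. (c * d) * f v)"
      using tens_\<theta>_inject[OF I(1,3)] f(3) unfolding c d vc tens_vscale .
    then have "?F (\<nu> j i) (indicator (K j i)) = (\<lambda>w. (c * d) * ?F (\<nu> j i) f w)"
      using X.fourier1_scale[OF \<nu>_meas[OF ji], of \<psi> "c * d" f] by simp
    then have "(\<lambda>w. d * ?F (\<lambda>f. c * \<nu> j i f) f w) = indicator (annih_system E K i j)"
      unfolding F by (simp add: fun_eq_iff fourier1_def algebra_simps)
    then show "t = tens (indicator (annih_system E K i j)) (D.\<theta> i b)"
      unfolding t c d virt_dual_\<theta>[OF I(2,3)] tens_vscale by simp
  qed
  then show "fourier2 \<psi> E b (lattice_delta E K b) j i = lattice_delta (dual2 E) (annih_system E K) b j i"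
    by (simp add: fourier2_def lattice_delta_def[of "dual2 E"])
qed

end

section \<open>Admissible triples\<close>

text \<open>\<open>K1\<close> and \<open>K3\<close> encode the normalizations of the two outer
  terms, total mass 1 and mass 1 at zero, and \<open>K2\<close> is the family of lattices in the
  middle for which they multiply to the normalized measure.\<close>

locale level_triple =
  L1: level_system E1 K1 + L2: level_system E2 K2 + L3: level_system E3 K3
  for E1 :: "('f :: {field, finite}, 'v1 :: ab_group_add, 'w1 :: ab_group_add, 'i1, 'k1) c2" and K1
    and E2 :: "('f, 'v2 :: ab_group_add, 'w2 :: ab_group_add, 'i2, 'k2) c2" and K2
    and E3 :: "('f, 'v3 :: ab_group_add, 'w3 :: ab_group_add, 'i3, 'k3) c2" and K3 +
  fixes T :: "('v1, 'w1, 'i1, 'v2, 'w2, 'i2, 'v3, 'w3, 'i3) triple2"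
  assumes ile1: "ile E2 i j \<Longrightarrow> ile E1 (eps T i) (eps T j)"
    and ile3: "ile E2 i j \<Longrightarrow> ile E3 (gam T i) (gam T j)"
    and exact_lev: "ile E2 i j \<Longrightarrow>
      c1_exact (lev E1 (eps T i) (eps T j)) (lev E2 i j) (lev E3 (gam T i) (gam T j))
        (alphaq T i j) (betaq T i j)"
    and K1: "ile E1 m n \<Longrightarrow> K1 m n = carr (lev E1 m n)"
    and K2: "ile E2 i j \<Longrightarrow> K2 i j = alphaq T i j ` carr (lev E1 (eps T i) (eps T j))"
    and K3: "ile E3 p q \<Longrightarrow> K3 p q = {0}"
begin

lemma eps_idx: "i \<in> idx E2 \<Longrightarrow> eps T i \<in> idx E1"
  using ile1[OF L2.refl] by (auto simp: ile_def)

lemma cf_system_\<theta>: "cf_system E1 = L1.\<theta>"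
  unfolding cf_system_def by (rule L1.mult_system_\<theta>) (simp add: haar_def K1)

lemma df_system_\<theta>: "df_system E3 = L3.\<theta>"
  unfolding df_system_def by (rule L3.mult_system_\<theta>) (simp add: haar_def K3)

lemma K1_pre:
  assumes ij: "ile E2 i j"
  shows "K1 (eps T i) (eps T j) = {v \<in> carr (lev E1 (eps T i) (eps T j)). alphaq T i j v \<in> K2 i j}"
  unfolding K1[OF ile1[OF ij]] K2[OF ij] by blast

lemma K3_img:
  assumes ij: "ile E2 i j"
  shows "K3 (gam T i) (gam T j) = betaq T i j ` K2 i j"
proof -
  interpret X: c1_exact "lev E1 (eps T i) (eps T j)" "lev E2 i j" "lev E3 (gam T i) (gam T j)"
    "alphaq T i j" "betaq T i j" by (rule exact_lev[OF ij])
  show ?thesis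
    unfolding K3[OF ile3[OF ij]] K2[OF ij] image_image
    using X.X1.subspace_0[OF X.X1.subspace_carr] X.\<beta>_\<alpha> by force
qed

lemma triple_tensor_\<nu>:
  assumes ij: "ile E2 i j"
  shows "triple_tensor E1 E2 E3 T i j (\<lambda>f. z * L1.\<nu> (eps T i) (eps T j) f)
    (\<lambda>f. w * L3.\<nu> (gam T i) (gam T j) f) = (\<lambda>f. z * w * L2.\<nu> i j f)"
  unfolding triple_tensor_def
  by (rule c1_exact.meas_tensor_haar[OF exact_lev[OF ij] L2.lattice[OF ij] K1_pre[OF ij] K3_img[OF ij]])

lemma virt_tensor_\<theta>:
  assumes ij: "i \<in> idx E2" "j \<in> idx E2"
  shows "virt_tensor E1 E2 E3 T i j (vscale c (L1.\<theta> (eps T i) (eps T j))) (L3.\<theta> (gam T i) (gam T j)) =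
    vscale c (L2.\<theta> i j)"
proof -
  \<comment> \<open>The factor on the third space is written with the scalar 1 so that the rules for
    multiples of \<open>\<theta>\<close> apply to it.\<close>
  let ?h1 = "vscale c (L1.\<theta> (eps T i) (eps T j))" and ?h3 = "vscale 1 (L3.\<theta> (gam T i) (gam T j))"
  let ?P = "\<lambda>h. h \<in> virt E2 i j \<and>
    (\<forall>l. ile E2 l i \<and> ile E2 l j \<longrightarrow>
      (\<forall>a1\<in>meas (lev E1 (eps T l) (eps T i)). \<forall>a3\<in>meas (lev E3 (gam T l) (gam T i)).
        h l (triple_tensor E1 E2 E3 T l i a1 a3) =
          triple_tensor E1 E2 E3 T l j (?h1 (eps T l) a1) (?h3 (gam T l) a3)))"
  have rhs: "triple_tensor E1 E2 E3 T l j (?h1 (eps T l) (\<lambda>f. x * L1.\<nu> (eps T l) (eps T i) f))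
      (?h3 (gam T l) (\<lambda>f. y * L3.\<nu> (gam T l) (gam T i) f)) = (\<lambda>f. (c * x) * (1 * y) * L2.\<nu> l j f)"
    if l: "ile E2 l i" "ile E2 l j" for l x y
  proof -
    note l1 = ile1[OF l(1)] ile1[OF l(2)] and l3 = ile3[OF l(1)] ile3[OF l(2)]
    show ?thesis
      unfolding L1.scaled_\<theta>[OF l1 L1.\<nu>_smult[OF l1(1)]] L3.scaled_\<theta>[OF l3 L3.\<nu>_smult[OF l3(1)]]
        L1.\<nu>_smult_mass[OF l1(1)] L3.\<nu>_smult_mass[OF l3(1)]
      by (rule triple_tensor_\<nu>[OF l(2)])
  qed
  have lhs: "vscale e (L2.\<theta> i j) l (triple_tensor E1 E2 E3 T l i (\<lambda>f. x * L1.\<nu> (eps T l) (eps T i) f)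
      (\<lambda>f. y * L3.\<nu> (gam T l) (gam T i) f)) = (\<lambda>f. e * (x * y) * L2.\<nu> l j f)"
    if l: "ile E2 l i" "ile E2 l j" for l x y e
    unfolding triple_tensor_\<nu>[OF l(1)] L2.scaled_\<theta>[OF l L2.\<nu>_smult[OF l(1)]] L2.\<nu>_smult_mass[OF l(1)] ..
  have P: "?P (vscale c (L2.\<theta> i j))"
  proof (intro conjI allI impI ballI)
    show "vscale c (L2.\<theta> i j) \<in> virt E2 i j" by (rule L2.\<theta>_virt)
    fix l a1 a3
    assume l: "ile E2 l i \<and> ile E2 l j" and a1: "a1 \<in> meas (lev E1 (eps T l) (eps T i))"
      and a3: "a3 \<in> meas (lev E3 (gam T l) (gam T i))"
    have l1: "ile E2 l i" and l2: "ile E2 l j" using l by auto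
    obtain x where x: "a1 = (\<lambda>f. x * L1.\<nu> (eps T l) (eps T i) f)" using L1.meas_\<nu>[OF ile1[OF l1] a1] by blast
    obtain y where y: "a3 = (\<lambda>f. y * L3.\<nu> (gam T l) (gam T i) f)" using L3.meas_\<nu>[OF ile3[OF l1] a3] by blast
    show "vscale c (L2.\<theta> i j) l (triple_tensor E1 E2 E3 T l i a1 a3) =
        triple_tensor E1 E2 E3 T l j (?h1 (eps T l) a1) (?h3 (gam T l) a3)"
      unfolding x y lhs[OF l1 l2] rhs[OF l1 l2] by (simp add: mult.assoc)
  qed
  have "h = vscale c (L2.\<theta> i j)" if h: "?P h" for h
  proof -
    obtain e where e: "h = vscale e (L2.\<theta> i j)" using L2.virt_E[OF conjunct1[OF h] ij] by blast
    obtain l where l: "ile E2 l i" "ile E2 l j" using L2.lower[OF ij] by blast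
    have "(\<lambda>f. e * (1 * 1) * L2.\<nu> l j f) = (\<lambda>f. (c * 1) * (1 * 1) * L2.\<nu> l j f)"
      using conjunct2[OF h, rule_format, OF conjI[OF l] L1.\<nu>_smult[OF ile1[OF l(1)]] L3.\<nu>_smult[OF ile3[OF l(1)]]]
      unfolding e lhs[OF l] rhs[OF l] .
    then have "e * (1 * 1) = (c * 1) * (1 * 1)" by (rule L2.\<nu>_cancel[OF l(2)])
    then show ?thesis using e by simp
  qed
  with P have "(THE h. ?P h) = vscale c (L2.\<theta> i j)" by (rule the_equality)
  then show ?thesis unfolding virt_tensor_def vscale_1 .
qed

lemma ext0_carr:
  "ext0 (lev E1 (eps T j) (eps T i)) \<alpha> (indicator (carr (lev E1 (eps T j) (eps T i)))) =
    indicator (\<alpha> ` carr (lev E1 (eps T j) (eps T i)))"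
  by (auto simp: ext0_def fun_eq_iff indicator_def intro: inv_into_into)

text \<open>Extending the constant 1 by zero gives the indicator of \<open>K2\<close>, and
  \<open>virt_tensor_\<theta>\<close> turns the two trivializations into that of the middle space.
  Another pure representation moves a scalar between function and virtual measure, and both
  extension and tensor product are linear.\<close>

lemma delta2_eq_lattice_delta:
  assumes b: "b \<in> idx E2"
  shows "delta2 E1 E2 E3 T b = lattice_delta E2 K2 b"
proof (rule ext, rule ext)
  fix i j
  let ?X = "lev E1 (eps T j) (eps T i)"
  have "(THE t'. \<exists>f h. f \<in> sch ?X \<and> h \<in> virt E1 (eps T j) (eps T b) \<and>
        one2 E1 (eps T b) (eps T i) (eps T j) = tens f h \<and>
        t' = tens (ext0 ?X (alphaq T j i) f)
               (virt_tensor E1 E2 E3 T j b h (df_system E3 (gam T j) (gam T b)))) =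
      tens (indicator (K2 j i)) (L2.\<theta> j b)" if ji: "ile E2 j i"
  proof (rule the_equality)
    note I = L2.ile_idx(1)[OF ji] b and ji1 = ile1[OF ji]
    interpret X: c1 ?X by (rule L1.c1_lev[OF ji1])
    have one: "one2 E1 (eps T b) (eps T i) (eps T j) = tens (indicator (carr ?X)) (L1.\<theta> (eps T j) (eps T b))"
      using ji1 by (simp add: one2_def cf_system_\<theta>)
    have ext: "ext0 ?X (alphaq T j i) (indicator (carr ?X)) = indicator (K2 j i)"
      unfolding K2[OF ji] by (rule ext0_carr)
    have lat: "is_lattice ?X (carr ?X)" using L1.lattice[OF ji1] K1[OF ji1] by simp
    show "\<exists>f h. f \<in> sch ?X \<and> h \<in> virt E1 (eps T j) (eps T b) \<and>
        one2 E1 (eps T b) (eps T i) (eps T j) = tens f h \<and>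
        tens (indicator (K2 j i)) (L2.\<theta> j b) = tens (ext0 ?X (alphaq T j i) f)
               (virt_tensor E1 E2 E3 T j b h (df_system E3 (gam T j) (gam T b)))"
      by (intro exI[of _ "indicator (carr ?X)"] exI[of _ "L1.\<theta> (eps T j) (eps T b)"])
        (use X.sch_indicator[OF lat] L1.\<theta>_virt[of 1 "eps T j" "eps T b"] one ext
          virt_tensor_\<theta>[OF I, of 1] in \<open>simp add: vscale_1 df_system_\<theta>\<close>)
    fix t assume "\<exists>f h. f \<in> sch ?X \<and> h \<in> virt E1 (eps T j) (eps T b) \<and>
        one2 E1 (eps T b) (eps T i) (eps T j) = tens f h \<and>
        t = tens (ext0 ?X (alphaq T j i) f)
               (virt_tensor E1 E2 E3 T j b h (df_system E3 (gam T j) (gam T b)))"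
    then obtain f h where h: "h \<in> virt E1 (eps T j) (eps T b)"
      and f: "tens (indicator (carr ?X)) (L1.\<theta> (eps T j) (eps T b)) = tens f h"
      and t: "t = tens (ext0 ?X (alphaq T j i) f)
               (virt_tensor E1 E2 E3 T j b h (df_system E3 (gam T j) (gam T b)))"
      unfolding one by blast
    note I1 = eps_idx[OF I(1)] eps_idx[OF I(2)]
    obtain c where c: "h = vscale c (L1.\<theta> (eps T j) (eps T b))" using L1.virt_E[OF h I1] by blast
    have "indicator (carr ?X) = (\<lambda>v. c * f v)"
      using L1.tens_\<theta>_inject[OF I1] f unfolding c tens_vscale .
    then have "indicator (K2 j i) = (\<lambda>v. c * ext0 ?X (alphaq T j i) f v)"
      unfolding ext[symmetric] by (auto simp: ext0_def)
    then show "t = tens (indicator (K2 j i)) (L2.\<theta> j b)"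
      unfolding t c df_system_\<theta> virt_tensor_\<theta>[OF I] tens_vscale by simp
  qed
  then show "delta2 E1 E2 E3 T b i j = lattice_delta E2 K2 b i j"
    by (simp add: delta2_def image2_def lattice_delta_def)
qed

text \<open>The outer normalizations trade places: the annihilator of {0} is the whole dual and that
  of the whole space is {0}. The annihilator of \<open>K2\<close> consists of the forms factoring
  through the quotient, the image of the dual of the third term.\<close>

lemma level_triple_dual:
  "level_triple (dual2 E3) (annih_system E3 K3) (dual2 E2) (annih_system E2 K2)
    (dual2 E1) (annih_system E1 K1) (dual_triple E1 E2 T)"
proof (rule level_triple.intro[OF L3.level_system_dual L2.level_system_dual L1.level_system_dual],
    rule level_triple_axioms.intro)
  fix i j assume "ile (dual2 E2) i j"
  then have ji: "ile E2 j i" by simp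
  show "ile (dual2 E3) (eps (dual_triple E1 E2 T) i) (eps (dual_triple E1 E2 T) j)"
    "ile (dual2 E1) (gam (dual_triple E1 E2 T) i) (gam (dual_triple E1 E2 T) j)"
    using ile1[OF ji] ile3[OF ji] by (simp_all add: dual_triple_def)
  let ?X1 = "lev E1 (eps T j) (eps T i)" and ?X3 = "lev E3 (gam T j) (gam T i)"
  interpret X: c1_exact ?X1 "lev E2 j i" ?X3 "alphaq T j i" "betaq T j i" by (rule exact_lev[OF ji])
  show "c1_exact (lev (dual2 E3) (eps (dual_triple E1 E2 T) i) (eps (dual_triple E1 E2 T) j))
      (lev (dual2 E2) i j) (lev (dual2 E1) (gam (dual_triple E1 E2 T) i) (gam (dual_triple E1 E2 T) j))
      (alphaq (dual_triple E1 E2 T) i j) (betaq (dual_triple E1 E2 T) i j)"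
    using X.c1_exact_dual by (simp add: dual_triple_def)
  have "annih (lev E2 j i) (K2 j i) = pullback (lev E2 j i) (betaq T j i) ` carr (dual1 ?X3)"
  proof
    show "annih (lev E2 j i) (K2 j i) \<subseteq> pullback (lev E2 j i) (betaq T j i) ` carr (dual1 ?X3)"
    proof
      fix w assume w: "w \<in> annih (lev E2 j i) (K2 j i)"
      show "w \<in> pullback (lev E2 j i) (betaq T j i) ` carr (dual1 ?X3)"
      proof (rule X.pullback_\<alpha>_ker)
        show "w \<in> carr (dual1 (lev E2 j i))" using w annih_lattice_subset_dual[OF L2.lattice[OF ji]] by blast
        show "w (alphaq T j i v) = 0" if "v \<in> carr ?X1" for v
          using w that K2[OF ji] by (auto simp: annih_def)
      qed
    qed
    have "pullback (lev E2 j i) (betaq T j i) u \<in> annih (lev E2 j i) (K2 j i)" if "u \<in> lin_forms ?X3" for u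
      using X.pullback_\<beta>_form[OF that] X.\<beta>_\<alpha> X.X3.form_0[OF that] K2[OF ji]
      by (auto simp: annih_def pullback_def)
    then show "pullback (lev E2 j i) (betaq T j i) ` carr (dual1 ?X3) \<subseteq> annih (lev E2 j i) (K2 j i)"
      by (auto simp: annih_def)
  qed
  then show "annih_system E2 K2 i j = alphaq (dual_triple E1 E2 T) i j `
      carr (lev (dual2 E3) (eps (dual_triple E1 E2 T) i) (eps (dual_triple E1 E2 T) j))"
    by (simp add: annih_system_def dual_triple_def del: dual1_simps)
next
  fix m n assume "ile (dual2 E3) m n"
  then have nm: "ile E3 n m" by simp
  interpret X: c1 "lev E3 n m" by (rule L3.c1_lev[OF nm])
  have "annih (lev E3 n m) {0} = carr (dual1 (lev E3 n m))"
  proof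
    show "annih (lev E3 n m) {0} \<subseteq> carr (dual1 (lev E3 n m))"
      using annih_lattice_subset_dual[OF L3.lattice[OF nm]] K3[OF nm] by simp
    show "carr (dual1 (lev E3 n m)) \<subseteq> annih (lev E3 n m) {0}"
      using X.form_0 by (auto simp: annih_def)
  qed
  then show "annih_system E3 K3 m n = carr (lev (dual2 E3) m n)"
    using K3[OF nm] by (simp add: annih_system_def del: dual1_simps)
next
  fix p q assume "ile (dual2 E1) p q"
  then have qp: "ile E1 q p" by simp
  interpret X: c1 "lev E1 q p" by (rule L1.c1_lev[OF qp])
  have "w = 0" if w: "w \<in> annih (lev E1 q p) (carr (lev E1 q p))" for w
  proof
    fix v show "w v = 0 v"
      using w X.form_outside[of w v] by (cases "v \<in> carr (lev E1 q p)") (auto simp: annih_def)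
  qed
  moreover have "0 \<in> annih (lev E1 q p) (carr (lev E1 q p))"
    by (simp add: annih_def lin_forms_def lin_map_def)
  ultimately show "annih_system E1 K1 p q = {0}" using K1[OF qp] by (auto simp: annih_system_def)
qed

end

section \<open>Lattices obtained from an admissible triple\<close>

lemma c2_level_system:
  fixes E :: "('f :: {field, finite}, 'v :: ab_group_add, 'w :: ab_group_add, 'i, 'k) c2"
  assumes E: "c2_space E"
    and lat: "\<And>i j. ile E i j \<Longrightarrow> is_lattice (lev E i j) (K i j)"
    and pre: "\<And>i j k. ile E i j \<Longrightarrow> ile E j k \<Longrightarrow>
      c1_exact (lev E i j) (lev E i k) (lev E j k) (incl E i j k) (proj E i j k) \<Longrightarrow>
      {v \<in> carr (lev E i j). incl E i j k v \<in> K i k} = K i j"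
    and img: "\<And>i j k. ile E i j \<Longrightarrow> ile E j k \<Longrightarrow>
      c1_exact (lev E i j) (lev E i k) (lev E j k) (incl E i j k) (proj E i j k) \<Longrightarrow>
      proj E i j k ` K i k = K j k"
  shows "level_system E K"
proof -
  have po: "partial_order_on (idx E) {(i, j). ile E i j}"
    and dir: "\<forall>i\<in>idx E. \<forall>j\<in>idx E. \<exists>k l. ile E k i \<and> ile E i l \<and> ile E k j \<and> ile E j l"
    using E by (simp_all add: c2_space_def filtered_space_def)
  have exact: "c1_exact (lev E i j) (lev E i k) (lev E j k) (incl E i j k) (proj E i j k)"
    if "ile E i j" "ile E j k" for i j k
    by (rule admissible1_imp_c1_exact) (use E that in \<open>simp add: c2_space_def\<close>)
  show ?thesis
  proof (rule level_system.intro)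
    show "ile E i i" if "i \<in> idx E" for i
      using po that by (auto simp: partial_order_on_def preorder_on_def refl_on_def)
    show "ile E i k" if "ile E i j" "ile E j k" for i j k
      using po that by (auto simp: partial_order_on_def preorder_on_def dest: transD)
    show "\<exists>k. ile E k i \<and> ile E k j" "\<exists>k. ile E i k \<and> ile E j k" if "i \<in> idx E" "j \<in> idx E" for i j
      using dir that by blast+
  qed (use exact lat pre img in blast)+
qed

text \<open>\<open>K2\<close> is used both as an image and as a kernel. As an image of a compact
  space it lies in a filtration member and is compatible with projections; as the kernel of a map to
  a discrete space it contains a filtration member and is compatible with inclusions.\<close>

lemma admissible2_level_triple:
  fixes E1 :: "('f :: {field, finite}, 'v1 :: ab_group_add, 'w1 :: ab_group_add, 'i1, 'k1) c2"
    and E2 :: "('f, 'v2 :: ab_group_add, 'w2 :: ab_group_add, 'i2, 'k2) c2"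
    and E3 :: "('f, 'v3 :: ab_group_add, 'w3 :: ab_group_add, 'i3, 'k3) c2"
    and T :: "('v1, 'w1, 'i1, 'v2, 'w2, 'i2, 'v3, 'w3, 'i3) triple2"
  assumes adm: "admissible2 E1 E2 E3 T" and cf: "cf_c2_space E1" and df: "df_c2_space E3"
  defines "K2 \<equiv> \<lambda>i j. alphaq T i j ` carr (lev E1 (eps T i) (eps T j))"
  shows "level_triple E1 (\<lambda>i j. carr (lev E1 i j)) E2 K2 E3 (\<lambda>i j. {0}) T"
proof -
  have c2: "c2_space E1" "c2_space E2" "c2_space E3" using adm by (simp_all add: admissible2_def)
  have dom: "dominates_via (eps T) E1 (sub_fil (alpha T) E1 E2)"
    "dominates_via (gam T) E3 (img_fil (beta T) E3 E2)"
    using adm by (simp_all add: admissible2_def)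
  have ile1: "ile E1 (eps T i) (eps T j)" and ile3: "ile E3 (gam T i) (gam T j)" if "ile E2 i j" for i j
    using dom that by (auto simp: dominates_via_def sub_fil_def img_fil_def ile_def)
  have fil1: "fil E1 (eps T i) = {v \<in> carr E1. alpha T v \<in> fil E2 i}"
    and fil3: "fil E3 (gam T i) = beta T ` fil E2 i" if "i \<in> idx E2" for i
    using dom that by (auto simp: dominates_via_def sub_fil_def img_fil_def)
  have aq: "alphaq T i j (quo E1 (eps T i) (eps T j) v) = quo E2 i j (alpha T v)"
    if "ile E2 i j" "v \<in> fil E1 (eps T j)" for i j v
    using adm that by (simp add: admissible2_def)
  have bq: "betaq T i j (quo E2 i j v) = quo E3 (gam T i) (gam T j) (beta T v)"
    if "ile E2 i j" "v \<in> fil E2 j" for i j v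
    using adm that by (simp add: admissible2_def)
  have exact: "c1_exact (lev E1 (eps T i) (eps T j)) (lev E2 i j) (lev E3 (gam T i) (gam T j))
      (alphaq T i j) (betaq T i j)" if "ile E2 i j" for i j
    by (rule admissible1_imp_c1_exact) (use adm that in \<open>simp add: admissible2_def\<close>)
  have quo1: "quo E1 i j ` fil E1 j = carr (lev E1 i j)" if "ile E1 i j" for i j
    using c2(1) that by (simp add: c2_space_def)
  have quo2: "quo E2 i j ` fil E2 j = carr (lev E2 i j)" if "ile E2 i j" for i j
    using c2(2) that by (simp add: c2_space_def)
  have incl: "incl E2 i j k (quo E2 i j v) = quo E2 i k v" if "ile E2 i j" "ile E2 j k" "v \<in> fil E2 j" for i j k v
    using c2(2) that by (simp add: c2_space_def)
  have proj: "proj E2 i j k (quo E2 i k v) = quo E2 j k v" if "ile E2 i j" "ile E2 j k" "v \<in> fil E2 k" for i j k v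
    using c2(2) that by (simp add: c2_space_def)
  have incl3: "incl E3 i j k (quo E3 i j v) = quo E3 i k v" if "ile E3 i j" "ile E3 j k" "v \<in> fil E3 j" for i j k v
    using c2(3) that by (simp add: c2_space_def)
  have exact3: "c1_exact (lev E3 i j) (lev E3 i k) (lev E3 j k) (incl E3 i j k) (proj E3 i j k)"
    if "ile E3 i j" "ile E3 j k" for i j k
    by (rule admissible1_imp_c1_exact) (use c2(3) that in \<open>simp add: c2_space_def\<close>)
  have comp1: "compact_filtered (lev E1 i j)" if "ile E1 i j" for i j
    using cf that by (simp add: cf_c2_space_def)
  have disc3: "discrete_filtered (lev E3 i j)" if "ile E3 i j" for i j
    using df that by (simp add: df_c2_space_def)
  have c1_1: "c1 (lev E1 i j)" if "ile E1 i j" for i j using c2(1) that by (simp add: c2_space_def c1_def)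
  have c1_3: "c1 (lev E3 i j)" if "ile E3 i j" for i j using c2(3) that by (simp add: c2_space_def c1_def)
  have sub2: "fil E2 i \<subseteq> fil E2 j" "i \<in> idx E2" "j \<in> idx E2" if "ile E2 i j" for i j
    using c2(2) that by (simp_all add: c2_space_def filtered_space_def ile_def)
  have "trans {(i, j). ile E2 i j}"
    using c2(2) by (simp add: c2_space_def filtered_space_def partial_order_on_def preorder_on_def)
  then have trans2: "ile E2 i k" if "ile E2 i j" "ile E2 j k" for i j k
    using that by (auto dest: transD)
  have L1: "level_system E1 (\<lambda>i j. carr (lev E1 i j))"
  proof (rule c2_level_system[OF c2(1)])
    fix i j assume ij: "ile E1 i j"
    interpret X: c1 "lev E1 i j" by (rule c1_1[OF ij])
    obtain k where "k \<in> idx (lev E1 i j)" "fil (lev E1 i j) k = carr (lev E1 i j)"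
      using comp1[OF ij] by (auto simp: compact_filtered_def)
    then show "is_lattice (lev E1 i j) (carr (lev E1 i j))" using X.lattice_fil by metis
  next
    fix i j k assume "c1_exact (lev E1 i j) (lev E1 i k) (lev E1 j k) (incl E1 i j k) (proj E1 i j k)"
    then interpret X: c1_exact "lev E1 i j" "lev E1 i k" "lev E1 j k" "incl E1 i j k" "proj E1 i j k" .
    show "{v \<in> carr (lev E1 i j). incl E1 i j k v \<in> carr (lev E1 i k)} = carr (lev E1 i j)"
      using X.\<alpha>_carr by blast
    show "proj E1 i j k ` carr (lev E1 i k) = carr (lev E1 j k)" by (rule X.\<beta>_img)
  qed
  have L3: "level_system E3 (\<lambda>i j. {0})"
  proof (rule c2_level_system[OF c2(3)])
    fix i j assume ij: "ile E3 i j"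
    interpret X: c1 "lev E3 i j" by (rule c1_3[OF ij])
    obtain k where "k \<in> idx (lev E3 i j)" "fil (lev E3 i j) k = {0}"
      using disc3[OF ij] by (auto simp: discrete_filtered_def)
    then show "is_lattice (lev E3 i j) {0}" using X.lattice_fil by metis
  next
    fix i j k assume "c1_exact (lev E3 i j) (lev E3 i k) (lev E3 j k) (incl E3 i j k) (proj E3 i j k)"
    then interpret X: c1_exact "lev E3 i j" "lev E3 i k" "lev E3 j k" "incl E3 i j k" "proj E3 i j k" .
    have 0: "0 \<in> carr (lev E3 i j)" by (rule X.X1.subspace_0[OF X.X1.subspace_carr])
    show "{v \<in> carr (lev E3 i j). incl E3 i j k v \<in> {0}} = {0}"
      using 0 X.\<alpha>_0 inj_onD[OF X.\<alpha>_inj, of _ 0] by auto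
    show "proj E3 i j k ` {0} = {0}" by (simp add: X.\<beta>_0)
  qed
  have K2_ker: "K2 i j = {v \<in> carr (lev E2 i j). betaq T i j v = 0}" if ij: "ile E2 i j" for i j
  proof -
    interpret X: c1_exact "lev E1 (eps T i) (eps T j)" "lev E2 i j" "lev E3 (gam T i) (gam T j)"
      "alphaq T i j" "betaq T i j" by (rule exact[OF ij])
    show ?thesis unfolding K2_def using X.ker_\<beta> X.\<alpha>_carr by blast
  qed
  have L2: "level_system E2 K2"
  proof (rule c2_level_system[OF c2(2)])
    fix i j assume ij: "ile E2 i j"
    interpret X: c1_exact "lev E1 (eps T i) (eps T j)" "lev E2 i j" "lev E3 (gam T i) (gam T j)"
      "alphaq T i j" "betaq T i j" by (rule exact[OF ij])
    obtain k where k: "k \<in> idx (lev E1 (eps T i) (eps T j))"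
      "fil (lev E1 (eps T i) (eps T j)) k = carr (lev E1 (eps T i) (eps T j))"
      using comp1[OF ile1[OF ij]] by (auto simp: compact_filtered_def)
    obtain l where l: "l \<in> idx (lev E3 (gam T i) (gam T j))" "fil (lev E3 (gam T i) (gam T j)) l = {0}"
      using disc3[OF ile3[OF ij]] by (auto simp: discrete_filtered_def)
    obtain p where p: "p \<in> idx (lev E2 i j)" "K2 i j \<subseteq> fil (lev E2 i j) p"
      using X.pre_above[OF k(1)] unfolding k(2) K2_def by blast
    obtain q where q: "q \<in> idx (lev E2 i j)" "betaq T i j ` fil (lev E2 i j) q \<subseteq> {0}"
      using X.img_below[OF l(1)] unfolding l(2) by blast
    have "fil (lev E2 i j) q \<subseteq> K2 i j"
      using q X.X2.fil_subset_carr[OF q(1)] by (auto simp: K2_ker[OF ij])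
    moreover have "X.X2.subspace (K2 i j)"
      using X.X2.subspace_carr unfolding K2_ker[OF ij] X.X2.subspace_def
      by (simp add: X.\<beta>_0 X.\<beta>_add X.\<beta>_scale)
    ultimately show "is_lattice (lev E2 i j) (K2 i j)" using p q(1) by (auto simp: is_lattice_def)
  next
    fix i j k assume ij: "ile E2 i j" and jk: "ile E2 j k"
      and "c1_exact (lev E2 i j) (lev E2 i k) (lev E2 j k) (incl E2 i j k) (proj E2 i j k)"
    then interpret X: c1_exact "lev E2 i j" "lev E2 i k" "lev E2 j k" "incl E2 i j k" "proj E2 i j k" by simp
    interpret Y: c1_exact "lev E3 (gam T i) (gam T j)" "lev E3 (gam T i) (gam T k)" "lev E3 (gam T j) (gam T k)"
      "incl E3 (gam T i) (gam T j) (gam T k)" "proj E3 (gam T i) (gam T j) (gam T k)"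
      by (rule exact3[OF ile3[OF ij] ile3[OF jk]])
    interpret Z: c1_exact "lev E1 (eps T i) (eps T j)" "lev E2 i j" "lev E3 (gam T i) (gam T j)"
      "alphaq T i j" "betaq T i j" by (rule exact[OF ij])
    have ik: "ile E2 i k" by (rule trans2[OF ij jk])
    \<comment> \<open>The maps to the third term commute with the inclusions. As the inclusion there
      is injective, \<open>v\<close> lies in the kernel exactly when its image under
      \<open>incl\<close> does.\<close>
    have "betaq T i k (incl E2 i j k v) = incl E3 (gam T i) (gam T j) (gam T k) (betaq T i j v)"
      if "v \<in> carr (lev E2 i j)" for v
    proof -
      have "v \<in> quo E2 i j ` fil E2 j" using quo2[OF ij] that by simp
      then obtain x where x: "x \<in> fil E2 j" "v = quo E2 i j x" by blast
      have xk: "x \<in> fil E2 k" using x(1) sub2(1)[OF jk] by blast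
      have "beta T x \<in> fil E3 (gam T j)" using x(1) fil3[OF sub2(3)[OF ij]] by simp
      then show ?thesis
        using incl3[OF ile3[OF ij] ile3[OF jk]] by (simp add: x incl[OF ij jk] bq[OF ij] bq[OF ik xk])
    qed
    moreover have "incl E3 (gam T i) (gam T j) (gam T k) w = 0 \<longleftrightarrow> w = 0"
      if "w \<in> carr (lev E3 (gam T i) (gam T j))" for w
      using that Y.\<alpha>_0 inj_onD[OF Y.\<alpha>_inj, of w 0] Y.X1.subspace_0[OF Y.X1.subspace_carr] by auto
    ultimately show "{v \<in> carr (lev E2 i j). incl E2 i j k v \<in> K2 i k} = K2 i j"
      unfolding K2_ker[OF ij] K2_ker[OF ik] using X.\<alpha>_carr Z.\<beta>_carr Y.\<alpha>_0 by auto
    \<comment> \<open>Through the vectors of the filtered space, \<open>K2 m k\<close> is the image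
      of the same subspace of the first space for every m, so the projection carries one image to
      the other.\<close>
    have K2_quo: "K2 m k = (\<lambda>x. quo E2 m k (alpha T x)) ` fil E1 (eps T k)" if mk: "ile E2 m k" for m
      unfolding K2_def quo1[OF ile1[OF mk], symmetric] image_image using aq[OF mk] by (rule image_cong[OF refl])
    show "proj E2 i j k ` K2 i k = K2 j k"
      unfolding K2_quo[OF ik] K2_quo[OF jk] image_image
      using proj[OF ij jk] fil1[OF sub2(3)[OF jk]] by (intro image_cong) auto
  qed
  show ?thesis
    by (rule level_triple.intro[OF L1 L2 L3], rule level_triple_axioms.intro)
      (use ile1 ile3 exact in \<open>auto simp: K2_def\<close>)
qed

theorem theorem3:
  fixes \<psi> :: "'f :: {field, finite} \<Rightarrow> complex"
    and E1 :: "('f, 'v1 :: ab_group_add, 'w1 :: ab_group_add, 'i1, 'k1) c2"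
    and E2 :: "('f, 'v2 :: ab_group_add, 'w2 :: ab_group_add, 'i2, 'k2) c2"
    and E3 :: "('f, 'v3 :: ab_group_add, 'w3 :: ab_group_add, 'i3, 'k3) c2"
    and T :: "('v1, 'w1, 'i1, 'v2, 'w2, 'i2, 'v3, 'w3, 'i3) triple2"
    and b :: 'i2
  assumes "nontrivial_character \<psi>"
    and "admissible2 E1 E2 E3 T"
    and "complete2 E1" and "complete2 E2" and "complete2 E3"
    and "cf_c2_space E1" and "df_c2_space E3"
    and "b \<in> idx E2"
  shows "delta2 E1 E2 E3 T b \<in> sch2 E2 b \<and>
    delta2 (dual2 E3) (dual2 E2) (dual2 E1) (dual_triple E1 E2 T) b \<in> sch2 (dual2 E2) b \<and>
    fourier2 \<psi> E2 b (delta2 E1 E2 E3 T b) =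
      delta2 (dual2 E3) (dual2 E2) (dual2 E1) (dual_triple E1 E2 T) b"
proof -
  define K2 where "K2 i j = alphaq T i j ` carr (lev E1 (eps T i) (eps T j))" for i j
  interpret P: level_triple E1 "\<lambda>i j. carr (lev E1 i j)" E2 K2 E3 "\<lambda>i j. {0}" T
    using admissible2_level_triple[OF assms(2,6,7)] unfolding K2_def .
  interpret D: level_triple "dual2 E3" "annih_system E3 (\<lambda>i j. {0})" "dual2 E2" "annih_system E2 K2"
    "dual2 E1" "annih_system E1 (\<lambda>i j. carr (lev E1 i j))" "dual_triple E1 E2 T"
    by (rule P.level_triple_dual)
  have b: "b \<in> idx (dual2 E2)" using assms(8) by simp
  \<comment> \<open>The transform yields the family for the annihilators of \<open>K2\<close>, and
    the dual triple identifies precisely this family as its delta.\<close>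
  show ?thesis
    using P.L2.lattice_delta_sch2[OF assms(8)] D.L2.lattice_delta_sch2[OF b]
      P.L2.fourier2_lattice_delta[OF assms(1,8)]
    by (simp only: P.delta2_eq_lattice_delta[OF assms(8)] D.delta2_eq_lattice_delta[OF b] simp_thms)
qed

end
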